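(* Let $a<b$, $n\in\mathbb{N}$, $\beta>0$, $\alpha_k\in(k-1,k)$ for $k\in\{1,\ldots,n\}$, $y_{a,k},y_{b,k}\in\mathbb{R}$ for $k\in\{0,\ldots,n-1\}$, and let $L:(x,y,v_1,\ldots,v_n,w,z)\mapsto L$ and $l:(x,y,v_1,\ldots,v_n,w)\mapsto l$ be real-valued functions of class $C^1$. For $y\in\mathcal{F}^n([a,b];\mathbb{R})$ put ${^C_aD_x^\alpha}y(x)=({^C_aD_x^{\alpha_1}}y(x),\ldots,{^C_aD_x^{\alpha_n}}y(x))$, $$z(x)=\int_a^x l\bigl(t,y(t),{^C_aD_t^\alpha}y(t),{_aI_t^\beta}y(t)\bigr)\,dt,$$ $\{y\}(x)=(x,y(x),{^C_aD_x^\alpha}y(x),{_aI_x^\beta}y(x))$, $[y](x)=(x,y(x),{^C_aD_x^\alpha}y(x),{_aI_x^\beta}y(x),z(x))$, and $$J(y)=\int_a^b L[y](x)\,dx.$$ If $y\in\mathcal{F}^n([a,b];\mathbb{R})$ is a minimizer of $J$ subject to the boundary conditions $y^{(k)}(a)=y_{a,k}$ and $y^{(k)}(b)=y_{b,k}$, $k\in\{0,\ldots,n-1\}$, then for all $x\in[a,b]$ $$\frac{\partial L}{\partial y}[y](x)+\sum_{k=1}^n{_xD^{\alpha_k}_b}\left(\frac{\partial L}{\partial v_k}[y](x)\right)+{_xI^\beta_b}\left(\frac{\partial L}{\partial w}[y](x)\right)+\int_x^b\frac{\partial L}{\partial z}[y](t)\,dt\cdot\frac{\partial l}{\partial y}\{y\}(x)$$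 $$+\sum_{k=1}^n{_xD^{\alpha_k}_b}\left(\int_x^b\frac{\partial L}{\partial z}[y](t)\,dt\cdot\frac{\partial l}{\partial v_k}\{y\}(x)\right)+{_xI^\beta_b}\left(\int_x^b\frac{\partial L}{\partial z}[y](t)\,dt\cdot\frac{\partial l}{\partial w}\{y\}(x)\right)=0.$$
   Context: For $\gamma>0$, the left and right Riemann--Liouville fractional integrals are ${_aI_x^\gamma}f(x)=\frac{1}{\Gamma(\gamma)}\int_a^x(x-t)^{\gamma-1}f(t)\,dt$ and ${_xI_b^\gamma}f(x)=\frac{1}{\Gamma(\gamma)}\int_x^b(t-x)^{\gamma-1}f(t)\,dt$. For $k\in\mathbb{N}$ and $\gamma\in(k-1,k)$, the right Riemann--Liouville fractional derivative is ${_xD_b^\gamma}f(x)=\frac{(-1)^k}{\Gamma(k-\gamma)}\frac{d^k}{dx^k}\int_x^b(t-x)^{k-\gamma-1}f(t)\,dt$, and the left Caputo fractional derivative of $f\in AC^k([a,b];\mathbb{R})$ is ${^C_aD_x^\gamma}f(x)=\frac{1}{\Gamma(k-\gamma)}\int_a^x(x-t)^{k-\gamma-1}f^{(k)}(t)\,dt$. Here $AC^k([a,b];\mathbb{R})$ is the space of functions with continuous derivatives up to order $k-1$ on $[a,b]$ whose $(k-1)$-th derivative is absolutely continuous. $\mathcal{F}^n([a,b];\mathbb{R})$ denotes the class of functions $y\in AC^n([a,b];\mathbb{R})$ such that ${^C_aD_x^{\alpha_k}}y$, $k=1,\ldots,n$, and ${_aI_x^\beta}y$ exist and are continuous on $[a,b]$.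 Partial derivatives of $L$ are with respect to its named variables and are evaluated at $[y](\cdot)$; those of $l$ are evaluated at $\{y\}(\cdot)$. An expression such as ${_xD_b^\gamma}(\phi(x))$ means the operator applied to the function $\phi$, evaluated at $x$.
   Formalization: The equation is asserted at each x in [a,b] where the right Riemann–Liouville derivatives of ∂L/∂v_k and of (∫_x^b ∂L/∂z dt)·∂l/∂v_k all exist; their existence does not follow from the hypotheses and can fail, e.g. at x=b. *)

theory Defs
  imports "HOL-Analysis.Analysis"
begin

(* Derivatives are taken within S, so that they are one-sided at the end points of S = {a..b}. *)
primrec nth_deriv :: "real set \<Rightarrow> nat \<Rightarrow> (real \<Rightarrow> real) \<Rightarrow> real \<Rightarrow> real" where
  "nth_deriv S 0 f = f"
| "nth_deriv S (Suc k) f = (\<lambda>x. vector_derivative (nth_deriv S k f) (at x within S))"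

primrec differentiable_times :: "real set \<Rightarrow> nat \<Rightarrow> (real \<Rightarrow> real) \<Rightarrow> real \<Rightarrow> bool" where
  "differentiable_times S 0 f x \<longleftrightarrow> True"
| "differentiable_times S (Suc k) f x \<longleftrightarrow>
     (\<exists>e>0. \<forall>s\<in>S \<inter> ball x e. differentiable_times S k f s) \<and>
     nth_deriv S k f differentiable (at x within S)"

definition absolutely_continuous_on :: "real \<Rightarrow> real \<Rightarrow> (real \<Rightarrow> real) \<Rightarrow> bool" where
  "absolutely_continuous_on a b f \<longleftrightarrow>
     (\<forall>\<epsilon>>0. \<exists>\<delta>>0. \<forall>d T. d division_of T \<and> T \<subseteq> {a..b} \<and> (\<Sum>K\<in>d. Sup K - Inf K) < \<delta>
        \<longrightarrow> (\<Sum>K\<in>d. \<bar>f (Sup K) - f (Inf K)\<bar>) < \<epsilon>)"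

definition AC_space :: "nat \<Rightarrow> real \<Rightarrow> real \<Rightarrow> (real \<Rightarrow> real) set" where
  "AC_space k a b = {f.
     (\<forall>j. Suc j < k \<longrightarrow> (\<forall>x\<in>{a..b}. nth_deriv {a..b} j f differentiable (at x within {a..b}))) \<and>
     (\<forall>j<k. continuous_on {a..b} (nth_deriv {a..b} j f)) \<and>
     absolutely_continuous_on a b (nth_deriv {a..b} (k - 1) f)}"

(* The integrals below are meant as Lebesgue integrals: wherever existence is at issue it is
   required separately as absolute integrability, under which the gauge integral is the Lebesgue
   integral. *)

definition rl_integral_left :: "real \<Rightarrow> real \<Rightarrow> (real \<Rightarrow> real) \<Rightarrow> real \<Rightarrow> real" where
  "rl_integral_left a \<gamma> f x =
     1 / Gamma \<gamma> * integral {a..x} (\<lambda>t. (x - t) powr (\<gamma> - 1) * f t)"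

definition rl_integral_right :: "real \<Rightarrow> real \<Rightarrow> (real \<Rightarrow> real) \<Rightarrow> real \<Rightarrow> real" where
  "rl_integral_right b \<gamma> f x =
     1 / Gamma \<gamma> * integral {x..b} (\<lambda>t. (t - x) powr (\<gamma> - 1) * f t)"

(* In the three definitions that follow, \<gamma> lies in the open interval from k - 1 to k. *)

definition rl_deriv_right :: "real \<Rightarrow> real \<Rightarrow> nat \<Rightarrow> real \<Rightarrow> (real \<Rightarrow> real) \<Rightarrow> real \<Rightarrow> real" where
  "rl_deriv_right a b k \<gamma> f x =
     (-1) ^ k / Gamma (real k - \<gamma>) *
     nth_deriv {a..b} k (\<lambda>s. integral {s..b} (\<lambda>t. (t - s) powr (real k - \<gamma> - 1) * f t)) x"

(* nth_deriv is total, so an equation at x that involves rl_deriv_right ... x carries meaning only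
   where this predicate holds at x.  It may fail for the individual terms of an Euler-Lagrange
   equation of a problem with C^1 data: e.g. for L = v_1 + g(x) v_2 with a suitable multiple g of
   (b - x) powr (\<alpha>_2 - \<alpha>_1), \<alpha>_2 - \<alpha>_1 > 1, the functional is constant on the admissible class, but
   the right derivative of order \<alpha>_1 of the constant function 1 does not exist at b. *)
definition rl_deriv_right_exists ::
    "real \<Rightarrow> real \<Rightarrow> nat \<Rightarrow> real \<Rightarrow> (real \<Rightarrow> real) \<Rightarrow> real \<Rightarrow> bool" where
  "rl_deriv_right_exists a b k \<gamma> f x \<longleftrightarrow>
     (\<forall>s\<in>{a..b}. (\<lambda>t. (t - s) powr (real k - \<gamma> - 1) * f t) absolutely_integrable_on {s..b}) \<and>
     differentiable_times {a..b} k
       (\<lambda>s. integral {s..b} (\<lambda>t. (t - s) powr (real k - \<gamma> - 1) * f t)) x"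

(* For f in AC_space k a b the k-th derivative exists almost everywhere; its unspecified value
   elsewhere does not affect the integral. *)
definition caputo_left :: "real \<Rightarrow> real \<Rightarrow> nat \<Rightarrow> real \<Rightarrow> (real \<Rightarrow> real) \<Rightarrow> real \<Rightarrow> real" where
  "caputo_left a b k \<gamma> f x =
     1 / Gamma (real k - \<gamma>) *
     integral {a..x} (\<lambda>t. (x - t) powr (real k - \<gamma> - 1) * nth_deriv {a..b} k f t)"

definition frac_class ::
    "nat \<Rightarrow> real \<Rightarrow> real \<Rightarrow> (nat \<Rightarrow> real) \<Rightarrow> real \<Rightarrow> (real \<Rightarrow> real) set" where
  "frac_class n a b \<alpha> \<beta> = {y \<in> AC_space n a b.
     (\<forall>k\<in>{1..n}.
        (\<forall>x\<in>{a..b}. (\<lambda>t. (x - t) powr (real k - \<alpha> k - 1) * nth_deriv {a..b} k y t)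
                      absolutely_integrable_on {a..x}) \<and>
        continuous_on {a..b} (caputo_left a b k (\<alpha> k) y)) \<and>
     (\<forall>x\<in>{a..b}. (\<lambda>t. (x - t) powr (\<beta> - 1) * y t) absolutely_integrable_on {a..x}) \<and>
     continuous_on {a..b} (rl_integral_left a \<beta> y)}"

definition C1_on :: "'a::real_normed_vector set \<Rightarrow> ('a \<Rightarrow> real) \<Rightarrow> bool" where
  "C1_on S F \<longleftrightarrow>
     (\<exists>F' :: 'a \<Rightarrow> 'a \<Rightarrow>\<^sub>L real.
        (\<forall>p\<in>S. (F has_derivative blinfun_apply (F' p)) (at p within S)) \<and> continuous_on S F')"

(* The partial derivative of F at p in the coordinate with unit vector e. *)
definition partial :: "('a::real_normed_vector \<Rightarrow> real) \<Rightarrow> 'a \<Rightarrow> 'a \<Rightarrow> real" where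
  "partial F e p = deriv (\<lambda>s. F (p + s *\<^sub>R e)) 0"

(* The variables v_1, ..., v_n form a vector indexed by a finite type, and idx is a bijection from
   that type onto {1..n}: the component with index i is v_k for k = idx i. *)
definition caputo_vec ::
    "real \<Rightarrow> real \<Rightarrow> ('n::finite \<Rightarrow> nat) \<Rightarrow> (nat \<Rightarrow> real) \<Rightarrow> (real \<Rightarrow> real) \<Rightarrow> real \<Rightarrow> (real ^ 'n)" where
  "caputo_vec a b idx \<alpha> y x = (\<chi> i. caputo_left a b (idx i) (\<alpha> (idx i)) y x)"

definition curly ::
    "real \<Rightarrow> real \<Rightarrow> ('n::finite \<Rightarrow> nat) \<Rightarrow> (nat \<Rightarrow> real) \<Rightarrow> real \<Rightarrow> (real \<Rightarrow> real) \<Rightarrow> real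
       \<Rightarrow> real \<times> real \<times> (real ^ 'n) \<times> real" where
  "curly a b idx \<alpha> \<beta> y x = (x, y x, caputo_vec a b idx \<alpha> y x, rl_integral_left a \<beta> y x)"

definition bracket ::
    "(real \<times> real \<times> (real ^ 'n) \<times> real \<Rightarrow> real) \<Rightarrow> real \<Rightarrow> real \<Rightarrow> ('n::finite \<Rightarrow> nat)
       \<Rightarrow> (nat \<Rightarrow> real) \<Rightarrow> real \<Rightarrow> (real \<Rightarrow> real) \<Rightarrow> real \<Rightarrow> real \<times> real \<times> (real ^ 'n) \<times> real \<times> real" where
  "bracket l a b idx \<alpha> \<beta> y x =
     (x, y x, caputo_vec a b idx \<alpha> y x, rl_integral_left a \<beta> y x,
      integral {a..x} (\<lambda>t. l (curly a b idx \<alpha> \<beta> y t)))"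

definition J_functional ::
    "(real \<times> real \<times> (real ^ 'n) \<times> real \<times> real \<Rightarrow> real) \<Rightarrow> (real \<times> real \<times> (real ^ 'n) \<times> real \<Rightarrow> real)
       \<Rightarrow> real \<Rightarrow> real \<Rightarrow> ('n::finite \<Rightarrow> nat) \<Rightarrow> (nat \<Rightarrow> real) \<Rightarrow> real \<Rightarrow> (real \<Rightarrow> real) \<Rightarrow> real" where
  "J_functional L l a b idx \<alpha> \<beta> y = integral {a..b} (\<lambda>x. L (bracket l a b idx \<alpha> \<beta> y x))"

definition admissible ::
    "nat \<Rightarrow> real \<Rightarrow> real \<Rightarrow> (nat \<Rightarrow> real) \<Rightarrow> real \<Rightarrow> (nat \<Rightarrow> real) \<Rightarrow> (nat \<Rightarrow> real)
       \<Rightarrow> (real \<Rightarrow> real) set" where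
  "admissible n a b \<alpha> \<beta> ya yb = {y \<in> frac_class n a b \<alpha> \<beta>.
     \<forall>k<n. nth_deriv {a..b} k y a = ya k \<and> nth_deriv {a..b} k y b = yb k}"

end

(* A variation y + h eta, with eta a polynomial whose derivatives of order < n vanish at a and b, is
   admissible, because the absolutely continuous function y^(n-1) is differentiable almost
   everywhere, so that the Caputo derivatives depend affinely on h.  Setting the h-derivative of J to
   zero and moving the left fractional integrals to the other factors by Fubini gives
     int_a^b (P eta + sum_k G_k eta^(k)) = 0
   with P and G_k continuous, where G_k is a right fractional integral of order k - alpha_k.
   Integrating by parts towards eta^(n), the function
     H = (-1)^n I^n P + sum_k (-1)^(n-k) I^(n-k) G_k,   I f (x) = int_a^x f,
   is orthogonal to every eta^(n).  These are exactly the polynomials orthogonal to all polynomials of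
   degree < n, so by the Weierstrass theorem H is itself a polynomial of degree < n.  Its n-th
   derivative vanishes, which is the asserted equation at each point where the G_k are k times
   differentiable. *)
theory Submission
  imports Defs
begin

subsection \<open>Absolutely continuous functions are differentiable almost everywhere\<close>

text \<open>The coefficients along y are merely continuous, so nothing can be moved off eta by
  differentiating them; every integration by parts integrates the coefficient and differentiates
  eta. The existence of the right derivatives then enters only at the point where the equation is
  claimed. Since H equals a polynomial on the closed interval, the one-sided derivatives at a and b
  are covered by the same argument.

  The delicate order is n: \<open>nth_deriv\<close> is total, and where y^(n-1) is not
  differentiable its values for y and y + h eta are unrelated. That this set is null is a case of
  Lebesgue's differentiation theorem. It is obtained here from Vitali coverings: outside a null set
  the difference quotients are bounded and do not oscillate between two rationals.

  The functional contains an integral inside an integral, because z depends on h as well.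
  Differentiation under the integral sign is therefore carried out twice, and one more exchange of
  integrals produces the factor int_x^b of the z-derivative of L.\<close>

lemma sum_increments_division:
  fixes f :: "real \<Rightarrow> real"
  assumes "q division_of {u..v}" "u \<le> v"
  shows "(\<Sum>K\<in>q. f (Sup K) - f (Inf K)) = f v - f u"
proof -
  have inj: "inj_on (\<lambda>K. (Inf K, K)) q"
    by (auto simp: inj_on_def)
  \<comment> \<open>A division carries no order along which to telescope; tagging each interval by
    its left end point makes the additivity of tagged divisions applicable.\<close>
  have "(\<lambda>K. (Inf K, K)) ` q tagged_division_of {u..v}"
  proof (rule tagged_division_ofI)
    show "finite ((\<lambda>K. (Inf K, K)) ` q)"
      using assms(1) by (auto simp: division_of_def)
    show "\<Union> {K. \<exists>x. (x, K) \<in> (\<lambda>K. (Inf K, K)) ` q} = {u..v}"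
      using division_ofD(6)[OF assms(1)] by (auto simp: image_iff)
    fix x K assume "(x, K) \<in> (\<lambda>K. (Inf K, K)) ` q"
    then have K: "K \<in> q" "x = Inf K" by auto
    then obtain c d where "K = {c..d}" "K \<noteq> {}" "K \<subseteq> {u..v}"
      using division_ofD(2,3,4)[OF assms(1)] by (metis box_real(2))
    then show "x \<in> K" "K \<subseteq> {u..v}" "\<exists>a b. K = cbox a b"
      using K by (auto simp: cbox_interval)
  next
    fix x1 K1 x2 K2 assume "(x1, K1) \<in> (\<lambda>K. (Inf K, K)) ` q" "(x2, K2) \<in> (\<lambda>K. (Inf K, K)) ` q"
      "(x1, K1) \<noteq> (x2, K2)"
    then show "interior K1 \<inter> interior K2 = {}"
      using division_ofD(5)[OF assms(1)] by auto
  qed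
  from additive_tagged_division_1[OF assms(2) this, of f] show ?thesis
    by (simp add: sum.reindex[OF inj])
qed

text \<open>Turns the total length in the definition of absolute continuity into a Lebesgue measure,
  where monotonicity and subadditivity are at hand.\<close>

lemma division_lengths:
  assumes "q division_of T"
  shows "(\<Sum>K\<in>q. Sup K - Inf K) = measure lebesgue (T::real set)"
proof -
  have "measure lebesgue T = (\<Sum>K\<in>q. measure lebesgue K)"
    using content_division[OF assms] by simp
  also have "\<dots> = (\<Sum>K\<in>q. Sup K - Inf K)"
  proof (rule sum.cong)
    fix K assume "K \<in> q"
    then obtain c d where "K = {c..d}" "K \<noteq> {}"
      using division_ofD(3,4)[OF assms] by (metis box_real(2))
    then show "measure lebesgue K = Sup K - Inf K" by auto
  qed simp
  finally show ?thesis ..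
qed

text \<open>Absolute continuity speaks of finite families, whereas Vitali's theorem gives a
  countable disjoint family that covers \<open>E\<close> up to a null set. Finitely many members
  already exhaust the measure of the union up to \<open>e\<close>; the discarded members and the
  null set make up \<open>T\<close>. The open set \<open>U\<close> confines the chosen
  intervals.\<close>

lemma Vitali_finite_intervals:
  fixes E U :: "real set"
  assumes "open U" "U \<in> lmeasurable" "E \<subseteq> U" "0 < e"
    and fine: "\<And>x d. x \<in> E \<Longrightarrow> 0 < d \<Longrightarrow> \<exists>u v. u < v \<and> v - u < d \<and> u \<le> x \<and> x \<le> v \<and> P u v"
  obtains D T where "D division_of \<Union>D" "\<Union>D \<subseteq> U" "pairwise disjnt D"
    "\<And>K. K \<in> D \<Longrightarrow> \<exists>u v. u < v \<and> K = {u..v} \<and> P u v"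
    "T \<in> lmeasurable" "E \<subseteq> \<Union>D \<union> T" "measure lebesgue T < e"
proof -
  define I where "I = {(u, v). u < v \<and> P u v \<and> {u..v} \<subseteq> U}"
  \<comment> \<open>Intervals are the closed balls of the line. The covered point may lie anywhere
    in the ball, so the midpoint can serve as centre.\<close>
  define cen rad where "cen = (\<lambda>(u, v). (u + v) / 2 :: real)" and "rad = (\<lambda>(u, v). (v - u) / 2 :: real)"
  have ball: "cball (cen i) (rad i) = {fst i..snd i}" for i
    by (cases i) (auto simp: cen_def rad_def cball_eq_atLeastAtMost field_simps)
  have 1: "0 < rad i" if "i \<in> I" for i
    using that by (auto simp: I_def rad_def)
  have 2: "\<exists>i. i \<in> I \<and> x \<in> cball (cen i) (rad i) \<and> rad i < d" if "x \<in> E" "0 < d" for x d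
  proof -
    obtain r where r: "0 < r" "cball x r \<subseteq> U"
      using assms(1,3) \<open>x \<in> E\<close> open_contains_cball by blast
    obtain u v where uv: "u < v" "v - u < min r d" "u \<le> x" "x \<le> v" "P u v"
      using fine[OF \<open>x \<in> E\<close>, of "min r d"] r(1) \<open>0 < d\<close> by (metis min_less_iff_conj)
    then have "{u..v} \<subseteq> cball x r"
      by (auto simp: cball_eq_atLeastAtMost)
    then show ?thesis
      using uv r by (intro exI[of _ "(u, v)"], unfold ball) (auto simp: I_def rad_def)
  qed
  obtain C where C: "countable C" "C \<subseteq> I"
      "pairwise (\<lambda>i j. disjnt (cball (cen i) (rad i)) (cball (cen j) (rad j))) C"
      "negligible (E - (\<Union>i \<in> C. cball (cen i) (rad i)))"
    by (rule Vitali_covering_theorem_cballs[OF 1 2])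
  define F where "F = (\<lambda>i. {fst i..snd i :: real}) ` C"
  have CI: "fst i < snd i" "P (fst i) (snd i)" "{fst i..snd i} \<subseteq> U" if "i \<in> C" for i
    using subsetD[OF C(2) that] by (simp_all add: I_def case_prod_beta)
  have FU: "\<Union>F \<subseteq> U" using CI(3) unfolding F_def by blast
  have FP: "\<exists>u v. u < v \<and> K = {u..v} \<and> P u v" if "K \<in> F" for K
    using that CI(1,2) unfolding F_def by blast
  have Fm: "K \<in> lmeasurable" if "K \<in> F" for K using FP[OF that] by auto
  have Fdisj: "pairwise disjnt F"
    using C(3) unfolding F_def ball pairwise_def by auto
  have bd: "measure lebesgue (\<Union>D') \<le> measure lebesgue U" if "D' \<subseteq> F" "finite D'" for D'
    using that FU Fm by (intro measure_mono_fmeasurable[OF _ _ assms(2)] sets.finite_Union) (auto dest: fmeasurableD)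
  \<comment> \<open>The finite subunions have measure at most that of \<open>U\<close>, so their
    measures come arbitrarily close to that of the whole union.\<close>
  obtain D where D: "D \<subseteq> F" "finite D" "measure lebesgue (\<Union>F) - e < measure lebesgue (\<Union>D)"
    by (rule measure_countable_Union_approachable[OF _ \<open>0 < e\<close> Fm bd]) (simp_all add: F_def C(1))
  have FUm: "\<Union>F \<in> lmeasurable"
    using C(1) Fm FU assms(2) 
    by (intro fmeasurableI2[OF assms(2)] sets.countable_Union) (auto simp: F_def dest: fmeasurableD)
  have DUm: "\<Union>D \<in> lmeasurable"
    using D Fm by (intro fmeasurable.finite_Union) auto
  define T where "T = (\<Union>F - \<Union>D) \<union> (E - \<Union>F)"
  have neg: "negligible (E - \<Union>F)" using C(4) by (simp add: F_def ball)
  have mT: "measure lebesgue T = measure lebesgue (\<Union>F) - measure lebesgue (\<Union>D)"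
  proof -
    have "measure lebesgue T = measure lebesgue (\<Union>F - \<Union>D)"
      unfolding T_def using neg FUm DUm
      by (intro measure_Un_null_set) (auto simp: negligible_iff_null_sets[symmetric])
    also have "\<dots> = measure lebesgue (\<Union>F) - measure lebesgue (\<Union>D)"
      using FUm DUm D by (intro measurable_measure_Diff) auto
    finally show ?thesis .
  qed
  show thesis
  proof
    show "D division_of \<Union>D"
    proof (rule division_ofI)
      fix K assume "K \<in> D"
      then obtain u v where "u < v" "K = {u..v}" using FP[of K] D(1) by blast
      then show "K \<noteq> {}" "\<exists>a b. K = cbox a b" by (auto simp: cbox_interval)
    next
      fix K1 K2 assume "K1 \<in> D" "K2 \<in> D" "K1 \<noteq> K2"
      then have "K1 \<inter> K2 = {}"
        using Fdisj D(1) by (meson disjnt_def pairwiseD subsetD)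
      then show "interior K1 \<inter> interior K2 = {}"
        using interior_subset by blast
    qed (use D in auto)
    show "\<Union>D \<subseteq> U" "pairwise disjnt D" using D(1) FU pairwise_subset[OF Fdisj D(1)] by blast+
    show "T \<in> lmeasurable" unfolding T_def using FUm DUm neg
      by (auto intro: negligible_imp_measurable)
    show "E \<subseteq> \<Union>D \<union> T" by (auto simp: T_def)
    show "measure lebesgue T < e" using mT D by simp
    show "\<exists>u v. u < v \<and> K = {u..v} \<and> P u v" if "K \<in> D" for K using FP that D by auto
  qed
qed

lemma division_lmeasurable:
  assumes "q division_of T"
  shows "T \<in> lmeasurable"
proof -
  have "\<Union>q \<in> lmeasurable"
  proof (rule fmeasurable.finite_Union)
    show "q \<subseteq> lmeasurable" using division_ofD(4)[OF assms] lmeasurable_cbox by (metis subsetI)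
  qed (use division_ofD(1)[OF assms] in auto)
  then show ?thesis using division_ofD(6)[OF assms] by simp
qed

section \<open>Absolute continuity and sets of extreme slopes\<close>

lemma absolutely_continuous_onE:
  assumes "absolutely_continuous_on a b f" "0 < \<epsilon>"
  obtains \<delta> where "\<delta> > 0" "\<And>d T. d division_of T \<Longrightarrow> T \<subseteq> {a..b} \<Longrightarrow> (\<Sum>K\<in>d. Sup K - Inf K) < \<delta>
        \<Longrightarrow> (\<Sum>K\<in>d. \<bar>f (Sup K) - f (Inf K)\<bar>) < \<epsilon>"
proof -
  obtain \<delta> where "\<delta> > 0" and \<delta>: "\<forall>d T. d division_of T \<and> T \<subseteq> {a..b} \<and> (\<Sum>K\<in>d. Sup K - Inf K) < \<delta>
        \<longrightarrow> (\<Sum>K\<in>d. \<bar>f (Sup K) - f (Inf K)\<bar>) < \<epsilon>"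
    using assms(1)[unfolded absolutely_continuous_on_def, rule_format, OF assms(2)] by (elim exE conjE)
  show thesis
    by (rule that[OF \<open>\<delta> > 0\<close>]) (rule \<delta>[rule_format], intro conjI)
qed

lemma division_interval_cases:
  fixes K :: "real set"
  assumes "d division_of T" "K \<in> d"
  obtains u v where "K = {u..v}" "u \<le> v" "K \<subseteq> T" "Sup K = v" "Inf K = u"
proof -
  obtain u v where uv: "K = {u..v}"
    using division_ofD(4)[OF assms] by (auto simp: cbox_interval)
  moreover have "u \<le> v" using division_ofD(3)[OF assms] uv by auto
  moreover have "K \<subseteq> T" using division_ofD(2)[OF assms] .
  ultimately show thesis using that[of u v] by simp
qed

text \<open>Serves two purposes: tilting a function by a linear one in order to normalize slopes,
  and adding a polynomial variation to the derivative of order n - 1.\<close>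

lemma absolutely_continuous_on_add_Lipschitz:
  fixes f g :: "real \<Rightarrow> real"
  assumes f: "absolutely_continuous_on a b f"
    and g: "\<And>x y. a \<le> x \<Longrightarrow> x \<le> y \<Longrightarrow> y \<le> b \<Longrightarrow> \<bar>g y - g x\<bar> \<le> C * (y - x)" and "0 \<le> C"
  shows "absolutely_continuous_on a b (\<lambda>x. f x + g x)"
  unfolding absolutely_continuous_on_def
proof (intro allI impI)
  fix \<epsilon> :: real assume "\<epsilon> > 0"
  obtain \<delta> where \<delta>: "\<delta> > 0" "\<And>d T. d division_of T \<Longrightarrow> T \<subseteq> {a..b} \<Longrightarrow> (\<Sum>K\<in>d. Sup K - Inf K) < \<delta>
        \<Longrightarrow> (\<Sum>K\<in>d. \<bar>f (Sup K) - f (Inf K)\<bar>) < \<epsilon> / 2"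
    by (rule absolutely_continuous_onE[OF f half_gt_zero[OF \<open>\<epsilon> > 0\<close>]]) (rule that)
  show "\<exists>\<delta>>0. \<forall>d T. d division_of T \<and> T \<subseteq> {a..b} \<and> (\<Sum>K\<in>d. Sup K - Inf K) < \<delta>
        \<longrightarrow> (\<Sum>K\<in>d. \<bar>f (Sup K) + g (Sup K) - (f (Inf K) + g (Inf K))\<bar>) < \<epsilon>"
  \<comment> \<open>The increments of \<open>g\<close> add up to at most \<open>C\<close> times the
    total length; \<open>C + 1\<close> keeps the denominator positive when \<open>C\<close> is
    0.\<close>
  proof (intro exI[of _ "min \<delta> (\<epsilon> / (2 * (C + 1)))"] conjI allI impI)
    show "0 < min \<delta> (\<epsilon> / (2 * (C + 1)))" using \<delta> \<open>\<epsilon> > 0\<close> \<open>0 \<le> C\<close> by simp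
  next
    fix d T assume d: "d division_of T \<and> T \<subseteq> {a..b} \<and> (\<Sum>K\<in>d. Sup K - Inf K) < min \<delta> (\<epsilon> / (2 * (C + 1)))"
    have K: "\<bar>f (Sup K) + g (Sup K) - (f (Inf K) + g (Inf K))\<bar>
        \<le> \<bar>f (Sup K) - f (Inf K)\<bar> + C * (Sup K - Inf K)" "0 \<le> Sup K - Inf K" if K: "K \<in> d" for K
    proof -
      obtain u v where uv: "K = {u..v}" "u \<le> v" "K \<subseteq> T" "Sup K = v" "Inf K = u"
        by (rule division_interval_cases[OF conjunct1[OF d] K])
      then have "{u..v} \<subseteq> {a..b}" using d by blast
      then have "a \<le> u" "v \<le> b" using uv(2) by auto
      then show "\<bar>f (Sup K) + g (Sup K) - (f (Inf K) + g (Inf K))\<bar>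
        \<le> \<bar>f (Sup K) - f (Inf K)\<bar> + C * (Sup K - Inf K)" "0 \<le> Sup K - Inf K" using uv g[of u v] by auto
    qed
    have "(\<Sum>K\<in>d. \<bar>f (Sup K) + g (Sup K) - (f (Inf K) + g (Inf K))\<bar>)
      \<le> (\<Sum>K\<in>d. \<bar>f (Sup K) - f (Inf K)\<bar> + C * (Sup K - Inf K))"
      using K by (intro sum_mono) auto
    also have "\<dots> = (\<Sum>K\<in>d. \<bar>f (Sup K) - f (Inf K)\<bar>) + C * (\<Sum>K\<in>d. Sup K - Inf K)"
      by (simp add: sum.distrib sum_distrib_left)
    also have "\<dots> < \<epsilon> / 2 + (C + 1) * (\<epsilon> / (2 * (C + 1)))"
    proof (rule add_less_le_mono)
      show "(\<Sum>K\<in>d. \<bar>f (Sup K) - f (Inf K)\<bar>) < \<epsilon> / 2" using \<delta>(2)[of d T] d by auto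
      show "C * (\<Sum>K\<in>d. Sup K - Inf K) \<le> (C + 1) * (\<epsilon> / (2 * (C + 1)))"
        using d \<open>0 \<le> C\<close> K(2) by (intro mult_mono) (auto intro!: sum_nonneg)
    qed
    also have "\<dots> = \<epsilon>" using \<open>0 \<le> C\<close> by (simp add: field_simps)
    finally show "(\<Sum>K\<in>d. \<bar>f (Sup K) + g (Sup K) - (f (Inf K) + g (Inf K))\<bar>) < \<epsilon>" .
  qed
qed

text \<open>Inside a set shorter than the \<delta> that belongs to total increment 1, disjoint
  intervals of slope at least \<open>N\<close> have total length below \<open>1 / N\<close>. By
  Vitali such intervals cover the points in question up to an arbitrarily small set, and
  \<open>N\<close> is arbitrary.\<close>

lemma steep_negligible:
  fixes F :: "real \<Rightarrow> real"
  assumes F: "absolutely_continuous_on a b F" and E: "E \<subseteq> {a<..<b}"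
    and fine: "\<And>x d N. x \<in> E \<Longrightarrow> 0 < d \<Longrightarrow>
      \<exists>u v. u < v \<and> v - u < d \<and> u \<le> x \<and> x \<le> v \<and> N * (v - u) \<le> F v - F u"
  shows "negligible E"
proof -
  obtain \<delta> where \<delta>: "\<delta> > 0" "\<And>d T. d division_of T \<Longrightarrow> T \<subseteq> {a..b} \<Longrightarrow> (\<Sum>K\<in>d. Sup K - Inf K) < \<delta>
        \<Longrightarrow> (\<Sum>K\<in>d. \<bar>F (Sup K) - F (Inf K)\<bar>) < 1"
    by (rule absolutely_continuous_onE[OF F zero_less_one]) (rule that)
  \<comment> \<open>A ball of radius \<delta> / 3 has length below \<delta>, so every disjoint
    family inside it meets the smallness condition. Slope \<open>2 / e\<close> leaves the family
    with length below \<open>e / 2\<close>, and the uncovered rest contributes the other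
    half.\<close>
  have neg: "negligible (E \<inter> ball x (\<delta> / 3))" for x
    unfolding negligible_outer_le
  proof (intro allI impI)
    fix e :: real assume "e > 0"
    let ?U = "{a<..<b} \<inter> ball x (\<delta> / 3)"
    have Um: "?U \<in> lmeasurable" by (intro fmeasurable_Int_fmeasurable) auto
    have "measure lebesgue ?U \<le> measure lebesgue (ball x (\<delta> / 3))"
      by (intro measure_mono_fmeasurable) auto
    also have "\<dots> < \<delta>" using \<delta>(1) by (simp add: ball_eq_greaterThanLessThan)
    finally have Ul: "measure lebesgue ?U < \<delta>" .
    obtain D T where D: "D division_of \<Union>D" "\<Union>D \<subseteq> ?U" "pairwise disjnt D"
      "\<And>K. K \<in> D \<Longrightarrow> \<exists>u v. u < v \<and> K = {u..v} \<and> (2 / e) * (v - u) \<le> F v - F u"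
      "T \<in> lmeasurable" "E \<inter> ball x (\<delta> / 3) \<subseteq> \<Union>D \<union> T" "measure lebesgue T < e / 2"
    proof (rule Vitali_finite_intervals[of ?U "E \<inter> ball x (\<delta> / 3)" "e / 2" "\<lambda>u v. (2 / e) * (v - u) \<le> F v - F u"])
      show "\<exists>u v. u < v \<and> v - u < d \<and> u \<le> z \<and> z \<le> v \<and> 2 / e * (v - u) \<le> F v - F u"
        if "z \<in> E \<inter> ball x (\<delta> / 3)" "0 < d" for z d
        using fine that by blast
    qed (use Um E \<open>e > 0\<close> in auto)
    have DUm: "\<Union>D \<in> lmeasurable"
      using D(1) by (rule division_lmeasurable)
    have "measure lebesgue (\<Union>D) \<le> measure lebesgue ?U"
      using D(2) Um DUm by (intro measure_mono_fmeasurable) auto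
    then have "(\<Sum>K\<in>D. Sup K - Inf K) < \<delta>"
      unfolding division_lengths[OF D(1)] using Ul by simp
    then have 1: "(\<Sum>K\<in>D. \<bar>F (Sup K) - F (Inf K)\<bar>) < 1"
      by (intro \<delta>(2)[OF D(1)]) (use D(2) in auto)
    have "(2 / e) * (\<Sum>K\<in>D. Sup K - Inf K) \<le> (\<Sum>K\<in>D. \<bar>F (Sup K) - F (Inf K)\<bar>)"
      unfolding sum_distrib_left using D(4) by (intro sum_mono) fastforce
    then have "(2 / e) * measure lebesgue (\<Union>D) < 1"
      using 1 unfolding division_lengths[OF D(1)] by linarith
    then have "measure lebesgue (\<Union>D) < e / 2" using \<open>e > 0\<close> by (simp add: field_simps)
    then have "measure lebesgue (\<Union>D \<union> T) \<le> e"
      using measure_Un_le[of "\<Union>D" lebesgue T] D(5,7) DUm by auto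
    then show "\<exists>T. E \<inter> ball x (\<delta> / 3) \<subseteq> T \<and> T \<in> lmeasurable \<and> measure lebesgue T \<le> e"
      using D(5,6) DUm by (intro exI[of _ "\<Union>D \<union> T"]) auto
  qed
  show ?thesis
  proof (rule locally_negligible_alt[THEN iffD2], rule ballI)
    fix x assume "x \<in> E"
    then show "\<exists>U. openin (top_of_set E) U \<and> x \<in> U \<and> negligible U"
      by (intro exI[of _ "E \<inter> ball x (\<delta> / 3)"] conjI neg openin_open_Int IntI centre_in_ball[THEN iffD2])
        (use \<delta>(1) in auto)
  qed
qed

text \<open>Cover \<open>E\<close> up to a small set by disjoint intervals on which \<open>G\<close> does not increase, with total length
  close to the outer measure of \<open>E\<close>, and inside them by disjoint intervals on which \<open>G\<close> has slope at
  least \<open>s\<close>. The complement of the second family in the first is short, so absolute continuity makes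
  the increments of \<open>G\<close> over it too small to compensate the increase over the second family.\<close>

lemma oscillating_slopes_negligible_normalized:
  fixes G :: "real \<Rightarrow> real"
  assumes G: "absolutely_continuous_on a b G" and E: "E \<subseteq> {a<..<b}" and "0 < s"
    and lo: "\<And>x d. x \<in> E \<Longrightarrow> 0 < d \<Longrightarrow>
      \<exists>u v. u < v \<and> v - u < d \<and> u \<le> x \<and> x \<le> v \<and> G v - G u \<le> 0"
    and hi: "\<And>x d. x \<in> E \<Longrightarrow> 0 < d \<Longrightarrow>
      \<exists>u v. u < v \<and> v - u < d \<and> u \<le> x \<and> x \<le> v \<and> s * (v - u) \<le> G v - G u"
  shows "negligible E"
proof (rule ccontr)
  assume nn: "\<not> negligible E"
  \<comment> \<open>\<open>E\<close> is not known to be measurable; \<mu> is its outer measure, and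
    it is positive because \<open>E\<close> is assumed not negligible.\<close>
  define M where "M = {measure lebesgue T | T. E \<subseteq> T \<and> T \<in> lmeasurable}"
  define \<mu> where "\<mu> = Inf M"
  have Mne: "M \<noteq> {}" using E by (auto simp: M_def intro!: exI[of _ "{a<..<b}"])
  have Mbd: "bdd_below M" by (rule bdd_belowI[of _ 0]) (auto simp: M_def)
  have \<mu>le: "\<mu> \<le> measure lebesgue T" if "E \<subseteq> T" "T \<in> lmeasurable" for T
    unfolding \<mu>_def using Mbd that by (intro cInf_lower) (auto simp: M_def)
  obtain e0 where e0: "e0 > 0" "\<And>T. E \<subseteq> T \<Longrightarrow> T \<in> lmeasurable \<Longrightarrow> e0 \<le> measure lebesgue T"
    using nn unfolding negligible_outer by (meson not_le)
  have "e0 \<le> \<mu>" unfolding \<mu>_def using Mne by (rule cInf_greatest) (use e0 in \<open>auto simp: M_def\<close>)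
  then have \<mu>: "0 < \<mu>" using e0 by simp
  obtain \<delta> where \<delta>: "\<delta> > 0" "\<And>d T. d division_of T \<Longrightarrow> T \<subseteq> {a..b} \<Longrightarrow> (\<Sum>K\<in>d. Sup K - Inf K) < \<delta>
        \<Longrightarrow> (\<Sum>K\<in>d. \<bar>G (Sup K) - G (Inf K)\<bar>) < s * \<mu> / 4"
    by (rule absolutely_continuous_onE[OF G, of "s * \<mu> / 4"]) (use \<mu> \<open>0 < s\<close> in auto)
  \<comment> \<open>The first family has length below \<open>\<mu> + 2 * e\<close> and the second at
    least \<open>\<mu> - 2 * e\<close>, so the gaps are shorter than
    \<open>4 * e < \<delta>\<close>. Moreover \<open>e \<le> \<mu> / 4\<close> leaves the second
    family with length at least \<open>\<mu> / 2\<close>, hence with a rise of at least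
    \<open>s * \<mu> / 2\<close>, against a loss below \<open>s * \<mu> / 4\<close> over the
    gaps.\<close>
  define e where "e = min (\<delta> / 5) (\<mu> / 4)"
  have e: "0 < e" "4 * e < \<delta>" "e \<le> \<mu> / 4" using \<delta> \<mu> by (auto simp: e_def)
  have "\<exists>T0. E \<subseteq> T0 \<and> T0 \<in> lmeasurable \<and> measure lebesgue T0 < \<mu> + e"
    using cInf_lessD[OF Mne, of "\<mu> + e"] e(1) unfolding \<mu>_def[symmetric] by (auto simp: M_def)
  then obtain T0 where T0: "E \<subseteq> T0" "T0 \<in> lmeasurable" "measure lebesgue T0 < \<mu> + e" by blast
  obtain U0 where U0: "open U0" "T0 \<subseteq> U0" "U0 \<in> lmeasurable" "measure lebesgue U0 < measure lebesgue T0 + e"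
  proof -
    obtain V where V: "open V" "T0 \<subseteq> V" "V - T0 \<in> lmeasurable" "emeasure lebesgue (V - T0) < ennreal e"
      using sets_lebesgue_outer_open[OF fmeasurableD[OF T0(2)] e(1)] by metis
    have VT: "V = T0 \<union> (V - T0)" using V(2) by auto
    have "V \<in> lmeasurable" using T0(2) V(3) by (subst VT) (rule fmeasurable.Un)
    moreover have "measure lebesgue (V - T0) < e"
      using V(3,4) e(1) by (simp add: emeasure_eq_measure2 ennreal_less_iff)
    then have "measure lebesgue V < measure lebesgue T0 + e"
      using measure_Un_le[of T0 lebesgue "V - T0"] T0(2) V(3) VT by (auto dest: fmeasurableD)
    ultimately show thesis using that V by blast
  qed
  define U where "U = U0 \<inter> {a<..<b}"
  have Um: "U \<in> lmeasurable" unfolding U_def using U0 by (intro fmeasurable_Int_fmeasurable) auto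
  have Ul: "measure lebesgue U < \<mu> + 2 * e"
    using measure_mono_fmeasurable[of U U0 lebesgue] Um U0 T0(3) by (auto simp: U_def dest: fmeasurableD)
  obtain D T1 where D: "D division_of \<Union>D" "\<Union>D \<subseteq> U" "pairwise disjnt D"
      "\<And>K. K \<in> D \<Longrightarrow> \<exists>u v. u < v \<and> K = {u..v} \<and> G v - G u \<le> 0"
      "T1 \<in> lmeasurable" "E \<subseteq> \<Union>D \<union> T1" "measure lebesgue T1 < e"
  proof (rule Vitali_finite_intervals[of U E e "\<lambda>u v. G v - G u \<le> 0"])
    show "\<exists>u v. u < v \<and> v - u < d \<and> u \<le> x \<and> x \<le> v \<and> G v - G u \<le> 0" if "x \<in> E" "0 < d" for x d
      using lo that by blast
  qed (use Um U0 T0 E e in \<open>auto simp: U_def\<close>)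
  have finD: "finite D" using D(1) by auto
  \<comment> \<open>The error budget \<open>e\<close> is shared among the intervals of
    \<open>D\<close>, so that all exceptional sets together stay below \<open>e\<close>.\<close>
  define e' where "e' = e / (card D + 1)"
  have e': "0 < e'" "card D * e' < e" using e(1) by (auto simp: e'_def field_simps)
  have "\<exists>B q T. B \<subseteq> q \<and> q division_of K \<and> B division_of \<Union>B \<and> T \<in> lmeasurable \<and> E \<inter> K \<subseteq> \<Union>B \<union> T \<and>
      measure lebesgue T < e' \<and> (\<forall>J\<in>B. s * (Sup J - Inf J) \<le> G (Sup J) - G (Inf J))" if "K \<in> D" for K
  proof -
    obtain u v where uv: "u < v" "K = {u..v}" using D(4)[OF \<open>K \<in> D\<close>] by blast
    obtain B T where B: "B division_of \<Union>B" "\<Union>B \<subseteq> {u<..<v}" "pairwise disjnt B"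
        "\<And>J. J \<in> B \<Longrightarrow> \<exists>c d. c < d \<and> J = {c..d} \<and> s * (d - c) \<le> G d - G c"
        "T \<in> lmeasurable" "E \<inter> {u<..<v} \<subseteq> \<Union>B \<union> T" "measure lebesgue T < e'"
    proof (rule Vitali_finite_intervals[of "{u<..<v}" "E \<inter> {u<..<v}" e' "\<lambda>c d. s * (d - c) \<le> G d - G c"])
      show "\<exists>u v. u < v \<and> v - u < d \<and> u \<le> x \<and> x \<le> v \<and> s * (v - u) \<le> G v - G u" 
        if "x \<in> E \<inter> {u<..<v}" "0 < d" for x d
        using hi that by blast
    qed (use e'(1) in auto)
    have "\<Union>B \<subseteq> cbox u v" using B(2) by (auto simp: cbox_interval)
    then obtain q where q: "B \<subseteq> q" "q division_of cbox u v"
      using partial_division_extend_interval[OF B(1)] by blast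
    \<comment> \<open>The inner covering lives in the open interval; the two end points are returned
      to the exceptional set at no cost.\<close>
    have neg: "negligible {u, v}" by simp
    have "measure lebesgue (T \<union> {u, v}) = measure lebesgue T"
      using B(5) neg by (intro measure_Un_null_set) (auto simp: negligible_iff_null_sets[symmetric])
    moreover have "T \<union> {u, v} \<in> lmeasurable"
      using B(5) negligible_imp_measurable[OF neg] by blast
    moreover have "E \<inter> K \<subseteq> \<Union>B \<union> (T \<union> {u, v})"
    proof
      fix x assume "x \<in> E \<inter> K"
      then have "x \<in> E \<inter> {u<..<v} \<or> x = u \<or> x = v" using uv by auto
      then show "x \<in> \<Union>B \<union> (T \<union> {u, v})" using B(6) by blast
    qed
    moreover have "\<forall>J\<in>B. s * (Sup J - Inf J) \<le> G (Sup J) - G (Inf J)" using B(4) by fastforce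
    ultimately show ?thesis
      using B(1,7) q uv by (intro exI[of _ B] exI[of _ q] exI[of _ "T \<union> {u, v}"]) (auto simp: cbox_interval)
  qed
  then obtain B q T where BqT: "\<And>K. K \<in> D \<Longrightarrow> B K \<subseteq> q K \<and> q K division_of K \<and> B K division_of \<Union>(B K) \<and> T K \<in> lmeasurable \<and> E \<inter> K \<subseteq> \<Union>(B K) \<union> T K \<and>
      measure lebesgue (T K) < e' \<and> (\<forall>J\<in>B K. s * (Sup J - Inf J) \<le> G (Sup J) - G (Inf J))" by metis
  \<comment> \<open>\<open>q K\<close> completes \<open>B K\<close> to a division of
    \<open>K\<close>, so \<open>c K\<close> tiles the gaps and increments over \<open>K\<close>
    split accordingly.\<close>
  define c where "c K = q K - B K" for K
  have cdiv: "c K division_of \<Union>(c K)" "\<Union>(c K) \<subseteq> K" if "K \<in> D" for K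
  proof -
    show "c K division_of \<Union>(c K)" using BqT[OF that] unfolding c_def
      by (meson Diff_subset division_of_subset division_of_union_self)
    show "\<Union>(c K) \<subseteq> K" using BqT[OF that] unfolding c_def by (auto simp: division_of_def)
  qed
  have split: "(\<Sum>J\<in>q K. f J) = (\<Sum>J\<in>B K. f J) + (\<Sum>J\<in>c K. f J)" if "K \<in> D" for K and f :: "real set \<Rightarrow> real"
    unfolding c_def using BqT[OF that] by (intro sum.subset_diff[THEN trans[OF _ add.commute]]) auto
  have qG: "(\<Sum>J\<in>q K. G (Sup J) - G (Inf J)) \<le> 0" and qL: "(\<Sum>J\<in>q K. Sup J - Inf J) = Sup K - Inf K" if "K \<in> D" for K
  proof -
    obtain u v where uv: "u < v" "K = {u..v}" "G v - G u \<le> 0" using D(4)[OF \<open>K \<in> D\<close>] by blast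
    then have "q K division_of {u..v}" using BqT[OF that] by simp
    from sum_increments_division[OF this, of G] sum_increments_division[OF this, of "\<lambda>x. x"] uv
    show "(\<Sum>J\<in>q K. G (Sup J) - G (Inf J)) \<le> 0" "(\<Sum>J\<in>q K. Sup J - Inf J) = Sup K - Inf K" by auto
  qed
  define \<beta> where "\<beta> = (\<Sum>K\<in>D. \<Sum>J\<in>B K. Sup J - Inf J)"
  have \<beta>: "\<mu> \<le> \<beta> + 2 * e"
  proof -
    have m: "\<Union>(B K) \<in> lmeasurable" "T K \<in> lmeasurable" if "K \<in> D" for K
      using BqT[OF that] division_lmeasurable by blast+
    have EK: "E \<inter> K \<subseteq> \<Union>(B K) \<union> T K" if "K \<in> D" for K using BqT[OF that] by blast
    have "E \<subseteq> (\<Union>K\<in>D. \<Union>(B K) \<union> T K) \<union> T1" 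
    proof
      fix x assume x: "x \<in> E"
      show "x \<in> (\<Union>K\<in>D. \<Union>(B K) \<union> T K) \<union> T1"
      proof (cases "x \<in> T1")
        case False
        then obtain K where "K \<in> D" "x \<in> K" using D(6) x by blast
        then show ?thesis using EK x by blast
      qed simp
    qed
    moreover have mm: "(\<Union>K\<in>D. \<Union>(B K) \<union> T K) \<in> lmeasurable" 
      using m finD by (intro fmeasurable.finite_UN) auto
    ultimately have "\<mu> \<le> measure lebesgue ((\<Union>K\<in>D. \<Union>(B K) \<union> T K) \<union> T1)" using D(5) by (intro \<mu>le) auto
    also have "\<dots> \<le> measure lebesgue (\<Union>K\<in>D. \<Union>(B K) \<union> T K) + measure lebesgue T1"
      using mm D(5) by (intro measure_Un_le) auto
    also have "measure lebesgue (\<Union>K\<in>D. \<Union>(B K) \<union> T K) \<le> (\<Sum>K\<in>D. measure lebesgue (\<Union>(B K) \<union> T K))"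
      using m finD by (intro measure_UNION_le) auto
    also have "\<dots> \<le> (\<Sum>K\<in>D. (\<Sum>J\<in>B K. Sup J - Inf J) + e')"
    proof (intro sum_mono)
      fix K assume "K \<in> D"
      have "measure lebesgue (\<Union>(B K) \<union> T K) \<le> measure lebesgue (\<Union>(B K)) + measure lebesgue (T K)"
        using m[OF \<open>K \<in> D\<close>] by (intro measure_Un_le) auto
      then show "measure lebesgue (\<Union>(B K) \<union> T K) \<le> (\<Sum>J\<in>B K. Sup J - Inf J) + e'"
        using BqT[OF \<open>K \<in> D\<close>] division_lengths[of "B K"] by fastforce
    qed
    also have "\<dots> = \<beta> + card D * e'" by (simp add: \<beta>_def sum.distrib)
    finally show ?thesis using e'(2) D(7) by simp
  qed
  define R where "R = (\<Union>K\<in>D. c K)"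
  have Rdiv: "R division_of \<Union>R"
  proof (rule division_ofI)
    show "finite R" using finD cdiv(1) by (auto simp: R_def)
    fix K assume "K \<in> R"
    then obtain J where J: "J \<in> D" "K \<in> c J" by (auto simp: R_def)
    show "K \<noteq> {}" "\<exists>a b. K = cbox a b" using division_ofD(3,4)[OF cdiv(1)[OF J(1)] J(2)] by auto
  next
    fix K1 K2 assume "K1 \<in> R" "K2 \<in> R" and ne: "K1 \<noteq> K2"
    then obtain J1 J2 where J: "J1 \<in> D" "K1 \<in> c J1" "J2 \<in> D" "K2 \<in> c J2" by (auto simp: R_def)
    show "interior K1 \<inter> interior K2 = {}"
    proof (cases "J1 = J2")
      case True
      then show ?thesis using division_ofD(5)[OF cdiv(1)[OF J(1)]] J ne by auto
    next
      case False
      then have "J1 \<inter> J2 = {}" using D(3) J by (meson disjnt_def pairwiseD)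
      then have "K1 \<inter> K2 = {}" using cdiv(2) J by blast
      then show ?thesis using interior_subset by blast
    qed
  qed auto
  have Rsum: "(\<Sum>J\<in>R. f J) = (\<Sum>K\<in>D. \<Sum>J\<in>c K. f J)" for f :: "real set \<Rightarrow> real"
    unfolding R_def
  proof (rule sum.UNION_disjoint)
    show "\<forall>i\<in>D. \<forall>j\<in>D. i \<noteq> j \<longrightarrow> c i \<inter> c j = {}"
    proof (intro ballI impI)
      fix i j assume ij: "i \<in> D" "j \<in> D" "i \<noteq> j"
      then have "i \<inter> j = {}" using D(3) by (meson disjnt_def pairwiseD)
      moreover have "J \<noteq> {}" if "J \<in> c i" for J using division_ofD(3)[OF cdiv(1)[OF ij(1)] that] .
      ultimately show "c i \<inter> c j = {}" using cdiv(2)[OF ij(1)] cdiv(2)[OF ij(2)] by blast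
    qed
  qed (use finD cdiv(1) in auto)
  have Dlen: "(\<Sum>K\<in>D. Sup K - Inf K) \<le> measure lebesgue U"
    unfolding division_lengths[OF D(1)] using D(1,2) Um
    by (intro measure_mono_fmeasurable) (auto dest: division_lmeasurable)
  have "(\<Sum>J\<in>R. Sup J - Inf J) = (\<Sum>K\<in>D. (Sup K - Inf K) - (\<Sum>J\<in>B K. Sup J - Inf J))"
    unfolding Rsum 
  proof (intro sum.cong refl)
    fix K assume "K \<in> D"
    then show "(\<Sum>J\<in>c K. Sup J - Inf J) = Sup K - Inf K - (\<Sum>J\<in>B K. Sup J - Inf J)"
      using split[of K "\<lambda>J. Sup J - Inf J"] qL[of K] by linarith
  qed
  also have "\<dots> = (\<Sum>K\<in>D. Sup K - Inf K) - \<beta>"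
    by (simp add: sum_subtractf \<beta>_def)
  also have "\<dots> < \<delta>" using Dlen Ul \<beta> e by linarith
  finally have "(\<Sum>K\<in>R. \<bar>G (Sup K) - G (Inf K)\<bar>) < s * \<mu> / 4"
    using cdiv(2) D(2) by (intro \<delta>(2)[OF Rdiv]) (force simp: R_def U_def)+
  moreover have "(\<Sum>K\<in>R. G (Sup K) - G (Inf K)) \<ge> - (\<Sum>K\<in>R. \<bar>G (Sup K) - G (Inf K)\<bar>)"
    unfolding sum_negf[symmetric] by (intro sum_mono) auto
  \<comment> \<open>Over each \<open>K\<close> all increments telescope to at most 0, while those
    over \<open>B K\<close> amount to at least \<open>s\<close> times their length; the gaps have to
    lose as much.\<close>
  moreover have "(\<Sum>K\<in>R. G (Sup K) - G (Inf K)) + s * \<beta> \<le> 0"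
  proof -
    have "(\<Sum>K\<in>R. G (Sup K) - G (Inf K)) + s * \<beta> =
      (\<Sum>K\<in>D. (\<Sum>J\<in>c K. G (Sup J) - G (Inf J)) + (\<Sum>J\<in>B K. s * (Sup J - Inf J)))"
      unfolding Rsum \<beta>_def by (simp add: sum.distrib sum_distrib_left)
    also have "\<dots> \<le> (\<Sum>K\<in>D. (\<Sum>J\<in>c K. G (Sup J) - G (Inf J)) + (\<Sum>J\<in>B K. G (Sup J) - G (Inf J)))"
      using BqT by (intro sum_mono add_left_mono) auto
    also have "\<dots> \<le> (\<Sum>K\<in>D. 0)"
    proof (intro sum_mono)
      fix K assume "K \<in> D"
      then show "(\<Sum>J\<in>c K. G (Sup J) - G (Inf J)) + (\<Sum>J\<in>B K. G (Sup J) - G (Inf J)) \<le> 0"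
        using split[of K "\<lambda>J. G (Sup J) - G (Inf J)"] qG[of K] by linarith
    qed
    finally show ?thesis by simp
  qed
  moreover have "s * \<beta> \<ge> s * (\<mu> / 2)" using \<beta> e \<open>0 < s\<close> by (intro mult_left_mono) auto
  ultimately have "s * \<mu> / 4 \<le> 0" by linarith
  then show False using \<mu> \<open>0 < s\<close> by (simp add: mult_le_0_iff)
qed

lemma absolutely_continuous_on_uminus:
  assumes "absolutely_continuous_on a b f"
  shows "absolutely_continuous_on a b (\<lambda>x. - f x)"
proof -
  have "\<bar>- f y - - f x\<bar> = \<bar>f y - f x\<bar>" for x y by simp
  then show ?thesis using assms unfolding absolutely_continuous_on_def by presburger
qed

text \<open>Subtracting the linear function with slope \<open>p\<close> moves the lower slope bound
  to 0 and the upper one to \<open>q - p\<close>.\<close>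

lemma oscillating_slopes_negligible:
  fixes F :: "real \<Rightarrow> real"
  assumes F: "absolutely_continuous_on a b F" and E: "E \<subseteq> {a<..<b}" and "p < q"
    and lo: "\<And>x d. x \<in> E \<Longrightarrow> 0 < d \<Longrightarrow>
      \<exists>u v. u < v \<and> v - u < d \<and> u \<le> x \<and> x \<le> v \<and> F v - F u \<le> p * (v - u)"
    and hi: "\<And>x d. x \<in> E \<Longrightarrow> 0 < d \<Longrightarrow>
      \<exists>u v. u < v \<and> v - u < d \<and> u \<le> x \<and> x \<le> v \<and> q * (v - u) \<le> F v - F u"
  shows "negligible E"
proof (rule oscillating_slopes_negligible_normalized[of a b "\<lambda>x. F x + (- p) * x" E "q - p"])
  show "absolutely_continuous_on a b (\<lambda>x. F x + (- p) * x)"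
  proof (rule absolutely_continuous_on_add_Lipschitz[OF F, of _ "\<bar>p\<bar>"])
    fix x y :: real assume "x \<le> y"
    have "\<bar>- p * y - - p * x\<bar> = \<bar>- p * (y - x)\<bar>" by (simp add: algebra_simps)
    then show "\<bar>- p * y - - p * x\<bar> \<le> \<bar>p\<bar> * (y - x)" using \<open>x \<le> y\<close> by (simp add: abs_mult)
  qed simp
  fix x d :: real assume "x \<in> E" "0 < d"
  show "\<exists>u v. u < v \<and> v - u < d \<and> u \<le> x \<and> x \<le> v \<and> F v + - p * v - (F u + - p * u) \<le> 0"
    using lo[OF \<open>x \<in> E\<close> \<open>0 < d\<close>] by (elim exE, intro exI) (auto simp: algebra_simps)
  show "\<exists>u v. u < v \<and> v - u < d \<and> u \<le> x \<and> x \<le> v \<and> (q - p) * (v - u) \<le> F v + - p * v - (F u + - p * u)"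
    using hi[OF \<open>x \<in> E\<close> \<open>0 < d\<close>] by (elim exE, intro exI) (auto simp: algebra_simps)
qed (use assms in auto)

text \<open>The limit is the upper limit, the supremum of all levels that are exceeded frequently;
  the two bounds make this supremum finite. Oscillation is excluded for rational pairs only, so that
  in the application countably many null sets suffice.\<close>

lemma tendsto_if_not_oscillating:
  fixes \<phi> :: "'a \<Rightarrow> real"
  assumes "F \<noteq> bot" and N: "\<forall>\<^sub>F z in F. \<phi> z \<le> N" "\<forall>\<^sub>F z in F. M \<le> \<phi> z"
    and osc: "\<And>p q. p \<in> \<rat> \<Longrightarrow> q \<in> \<rat> \<Longrightarrow> p < q \<Longrightarrow>
      \<exists>\<^sub>F z in F. \<phi> z < p \<Longrightarrow> \<exists>\<^sub>F z in F. q < \<phi> z \<Longrightarrow> False"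
  shows "\<exists>c. (\<phi> \<longlongrightarrow> c) F"
proof -
  define A where "A = {q. \<exists>\<^sub>F z in F. q < \<phi> z}"
  have "\<forall>\<^sub>F z in F. M - 1 < \<phi> z" using N(2) by eventually_elim simp
  then have ne: "M - 1 \<in> A" unfolding A_def using eventually_frequently[OF assms(1)] by blast
  have "q \<le> N" if "q \<in> A" for q
  proof -
    have "\<exists>\<^sub>F z in F. q < \<phi> z \<and> \<phi> z \<le> N" using that N(1) unfolding A_def
      by (simp add: frequently_eventually_frequently)
    then show ?thesis using frequently_ex by fastforce
  qed
  then have bdd: "bdd_above A" by (rule bdd_aboveI)
  define c where "c = Sup A"
  have "(\<phi> \<longlongrightarrow> c) F"
  proof (rule order_tendstoI)
    fix r assume "r < c"
    obtain q where q: "q \<in> A" "r < q" 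
      using less_cSupE[OF \<open>r < c\<close>[unfolded c_def]] ne by blast
    \<comment> \<open>Two rationals are squeezed between \<open>r\<close> and \<open>q\<close>:
      \<open>q'\<close> is exceeded frequently, so values below \<open>p'\<close> cannot occur
      frequently.\<close>
    obtain q' where q': "q' \<in> \<rat>" "r < q'" "q' < q" using Rats_dense_in_real[OF q(2)] by blast
    obtain p' where p': "p' \<in> \<rat>" "r < p'" "p' < q'" using Rats_dense_in_real[OF q'(2)] by blast
    have "\<exists>\<^sub>F z in F. q' < \<phi> z" 
      by (rule frequently_mono[of "\<lambda>z. q < \<phi> z"]) (use q(1) q'(3) in \<open>auto simp: A_def\<close>)
    then have "\<not> (\<exists>\<^sub>F z in F. \<phi> z < p')" using osc p' q' by blast
    then have "\<forall>\<^sub>F z in F. \<not> \<phi> z < p'" by (simp add: not_frequently)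
    then show "\<forall>\<^sub>F z in F. r < \<phi> z" by eventually_elim (use p' in auto)
  next
    fix r assume "c < r"
    obtain s where s: "c < s" "s < r" using dense[OF \<open>c < r\<close>] by blast
    have "s \<notin> A" using cSup_upper[OF _ bdd, of s] s(1) unfolding c_def by auto
    then have "\<forall>\<^sub>F z in F. \<not> s < \<phi> z" by (simp add: A_def not_frequently)
    then show "\<forall>\<^sub>F z in F. \<phi> z < r" by eventually_elim (use s in auto)
  qed
  then show ?thesis ..
qed

lemma frequently_slope_interval:
  fixes f :: "real \<Rightarrow> real"
  assumes "\<exists>\<^sub>F z in at x. P ((f z - f x) / (z - x))" "0 < d"
  shows "\<exists>u v. u < v \<and> v - u < d \<and> u \<le> x \<and> x \<le> v \<and> P ((f v - f u) / (v - u))"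
proof -
  obtain z where z: "z \<noteq> x" "dist z x < d" "P ((f z - f x) / (z - x))"
    using assms unfolding frequently_at by blast
  show ?thesis
  proof (cases "x < z")
    case True
    then show ?thesis using z by (intro exI[of _ x] exI[of _ z]) (auto simp: dist_real_def)
  next
    case False
    have "(f z - f x) / (z - x) = (f x - f z) / (x - z)"
      using z(1) by (simp add: divide_simps) (simp add: algebra_simps)
    then show ?thesis using False z by (intro exI[of _ z] exI[of _ x]) (auto simp: dist_real_def)
  qed
qed

lemma frequently_steep_negligible:
  assumes "absolutely_continuous_on a b f"
  shows "negligible {x \<in> {a<..<b}. \<forall>N. \<exists>\<^sub>F z in at x. N < (f z - f x) / (z - x)}"
proof (rule steep_negligible[OF assms])
  fix x d N :: real assume x: "x \<in> {x \<in> {a<..<b}. \<forall>N. \<exists>\<^sub>F z in at x. N < (f z - f x) / (z - x)}" "0 < d"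
  then have "\<exists>\<^sub>F z in at x. N < (f z - f x) / (z - x)" by simp
  from frequently_slope_interval[of "\<lambda>s. N < s", OF this x(2)] obtain u v
    where uv: "u < v" "v - u < d" "u \<le> x" "x \<le> v" "N < (f v - f u) / (v - u)" by blast
  then show "\<exists>u v. u < v \<and> v - u < d \<and> u \<le> x \<and> x \<le> v \<and> N * (v - u) \<le> f v - f u"
    by (intro exI[of _ u] exI[of _ v]) (simp add: field_simps)
qed auto

text \<open>\<open>E\<close> and \<open>E'\<close> collect the points with difference quotients
  unbounded above and below, \<open>O' p q\<close> those where the quotients oscillate across the
  gap from \<open>p\<close> to \<open>q\<close>. Off these null sets the difference quotients
  converge.\<close>

theorem absolutely_continuous_on_differentiable_ae:
  assumes f: "absolutely_continuous_on a b f"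
  shows "negligible {x \<in> {a..b}. \<not> f differentiable (at x within {a..b})}"
proof -
  define E where "E = {x \<in> {a<..<b}. \<forall>N. \<exists>\<^sub>F z in at x. N < (f z - f x) / (z - x)}"
  define E' where "E' = {x \<in> {a<..<b}. \<forall>N. \<exists>\<^sub>F z in at x. N < (- f z - - f x) / (z - x)}"
  define O' where "O' p q = {x \<in> {a<..<b}. (\<exists>\<^sub>F z in at x. (f z - f x) / (z - x) < p) \<and>
      (\<exists>\<^sub>F z in at x. q < (f z - f x) / (z - x))}" for p q
  have negO: "negligible (O' p q)" if "p < q" for p q
  proof (rule oscillating_slopes_negligible[OF f _ that])
    fix x d :: real assume x: "x \<in> O' p q" and "0 < d"
    have "\<exists>\<^sub>F z in at x. (f z - f x) / (z - x) < p" using x by (simp add: O'_def)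
    from frequently_slope_interval[of "\<lambda>s. s < p", OF this \<open>0 < d\<close>] obtain u v
      where uv: "u < v" "v - u < d" "u \<le> x" "x \<le> v" "(f v - f u) / (v - u) < p" by blast
    then show "\<exists>u v. u < v \<and> v - u < d \<and> u \<le> x \<and> x \<le> v \<and> f v - f u \<le> p * (v - u)"
      by (intro exI[of _ u] exI[of _ v]) (simp add: field_simps)
    have "\<exists>\<^sub>F z in at x. q < (f z - f x) / (z - x)" using x by (simp add: O'_def)
    from frequently_slope_interval[of "\<lambda>s. q < s", OF this \<open>0 < d\<close>] obtain u v
      where uv: "u < v" "v - u < d" "u \<le> x" "x \<le> v" "q < (f v - f u) / (v - u)" by blast
    then show "\<exists>u v. u < v \<and> v - u < d \<and> u \<le> x \<and> x \<le> v \<and> q * (v - u) \<le> f v - f u"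
      by (intro exI[of _ u] exI[of _ v]) (simp add: field_simps)
  qed (auto simp: O'_def)
  \<comment> \<open>With the end points thrown in, every remaining point is interior and the
    two-sided limit can be used.\<close>
  define B where "B = {a, b} \<union> E \<union> E' \<union> (\<Union>(p, q)\<in>{(p, q). p \<in> \<rat> \<and> q \<in> \<rat> \<and> p < q}. O' p q)"
  have "countable {(p::real, q). p \<in> \<rat> \<and> q \<in> \<rat> \<and> p < q}"
    by (rule countable_subset[of _ "\<rat> \<times> \<rat>"]) (auto simp: countable_rat)
  then have "negligible (\<Union>(p, q)\<in>{(p, q). p \<in> \<rat> \<and> q \<in> \<rat> \<and> p < q}. O' p q)"
    using negO by (intro negligible_countable_Union) auto
  moreover have "negligible E" unfolding E_def using f by (rule frequently_steep_negligible)
  moreover have "negligible E'" unfolding E'_def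
    using absolutely_continuous_on_uminus[OF f] by (rule frequently_steep_negligible)
  ultimately have "negligible B"
    unfolding B_def by (intro negligible_Un) auto
  moreover have "{x \<in> {a..b}. \<not> f differentiable (at x within {a..b})} \<subseteq> B"
  proof (rule subsetI, rule ccontr)
    fix x assume x: "x \<in> {x \<in> {a..b}. \<not> f differentiable (at x within {a..b})}" "x \<notin> B"
    then have xab: "x \<in> {a<..<b}" by (auto simp: B_def)
    obtain N where "\<not> (\<exists>\<^sub>F z in at x. N < (f z - f x) / (z - x))"
      using x(2) xab by (auto simp: B_def E_def)
    then have N: "\<forall>\<^sub>F z in at x. (f z - f x) / (z - x) \<le> N" by (simp add: not_frequently not_less)
    obtain M where "\<not> (\<exists>\<^sub>F z in at x. M < (- f z - - f x) / (z - x))"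
      using x(2) xab by (auto simp: B_def E'_def)
    then have "\<forall>\<^sub>F z in at x. (- f z - - f x) / (z - x) \<le> M" by (simp add: not_frequently not_less)
    moreover have "(- f z - - f x) / (z - x) = - ((f z - f x) / (z - x))" for z
      by (simp add: minus_divide_left)
    ultimately have "\<forall>\<^sub>F z in at x. - ((f z - f x) / (z - x)) \<le> M" by (simp only:)
    then have M: "\<forall>\<^sub>F z in at x. - M \<le> (f z - f x) / (z - x)" by eventually_elim linarith
    have "\<exists>c. ((\<lambda>z. (f z - f x) / (z - x)) \<longlongrightarrow> c) (at x)"
    proof (rule tendsto_if_not_oscillating[OF _ N M])
      fix p q assume pq: "p \<in> \<rat>" "q \<in> \<rat>" "p < q" "\<exists>\<^sub>F z in at x. (f z - f x) / (z - x) < p"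
        "\<exists>\<^sub>F z in at x. q < (f z - f x) / (z - x)"
      then have "x \<in> O' p q" using xab unfolding O'_def by blast
      then show False using pq(1-3) x(2) unfolding B_def by blast
    qed simp
    then obtain c where "(f has_field_derivative c) (at x)" by (auto simp: has_field_derivative_iff)
    then have "f differentiable (at x within {a..b})"
      by (meson real_differentiable_def has_field_derivative_at_within)
    then show False using x by blast
  qed
  ultimately show ?thesis by (rule negligible_subset)
qed

subsection \<open>Fractional integrals of continuous functions\<close>

lemma absolutely_integrable_on_powr_from_0:
  fixes \<gamma> c :: real
  assumes "0 < \<gamma>" "0 \<le> c"
  shows "(\<lambda>r. r powr (\<gamma> - 1)) absolutely_integrable_on {0..c}"
  using has_integral_powr_from_0[of "\<gamma> - 1" c] assms
  by (intro nonnegative_absolutely_integrable_1) (auto simp: integrable_on_def)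

lemma absolutely_integrable_on_powr_diff:
  fixes \<gamma> a x :: real
  assumes "0 < \<gamma>" "a \<le> x"
  shows "(\<lambda>t. (x - t) powr (\<gamma> - 1)) absolutely_integrable_on {a..x}"
proof (rule nonnegative_absolutely_integrable_1)
  have "((\<lambda>r. r powr (\<gamma> - 1)) has_integral ((x - a) powr \<gamma> / \<gamma>)) (cbox 0 (x - a))"
    using has_integral_powr_from_0[of "\<gamma> - 1" "x - a"] assms by (simp add: cbox_interval)
  from has_integral_affinity[OF this, of "-1" x]
  have "((\<lambda>t. (- t + x) powr (\<gamma> - 1)) has_integral ((x - a) powr \<gamma> / \<gamma>)) ((\<lambda>t. - t + x) ` {0..x - a})"
    by (simp add: cbox_interval)
  moreover have "(\<lambda>t. - t + x) ` {0..x - a} = {a..x}"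
    by (auto intro!: image_eqI[where x = "x - t" for t])
  ultimately show "(\<lambda>t. (x - t) powr (\<gamma> - 1)) integrable_on {a..x}"
    by (auto simp: integrable_on_def)
qed auto

lemma absolutely_integrable_frac_left:
  fixes g :: "real \<Rightarrow> real"
  assumes "0 < \<gamma>" "continuous_on {a..b} g" "x \<in> {a..b}"
  shows "(\<lambda>t. (x - t) powr (\<gamma> - 1) * g t) absolutely_integrable_on {a..x}"
proof -
  have g: "continuous_on {a..x} g" using assms by (auto intro: continuous_on_subset)
  have "(\<lambda>t. g t * (x - t) powr (\<gamma> - 1)) absolutely_integrable_on {a..x}"
  proof (rule absolutely_integrable_bounded_measurable_product_real)
    show "g \<in> borel_measurable (lebesgue_on {a..x})"
      using g by (rule continuous_imp_measurable_on_sets_lebesgue) simp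
    show "bounded (g ` {a..x})"
      using compact_continuous_image[OF g compact_Icc] by (rule compact_imp_bounded)
    show "(\<lambda>t. (x - t) powr (\<gamma> - 1)) absolutely_integrable_on {a..x}"
      using assms by (intro absolutely_integrable_on_powr_diff) auto
  qed simp
  then show ?thesis by (simp add: mult.commute)
qed

text \<open>Over the fixed interval \<open>{0..1}\<close> the singular factor no longer depends on \<open>x\<close>, which makes the
  continuity in \<open>x\<close> a matter of uniform continuity of \<open>g\<close>.\<close>

lemma frac_left_rescaled:
  fixes g :: "real \<Rightarrow> real"
  assumes "0 < \<gamma>" "continuous_on {a..b} g" "x \<in> {a..b}"
  shows "integral {a..x} (\<lambda>t. (x - t) powr (\<gamma> - 1) * g t) =
    (x - a) powr \<gamma> * integral {0..1} (\<lambda>r. r powr (\<gamma> - 1) * g (x - (x - a) * r))"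
proof (cases "x = a")
  case False
  then have xa: "a < x" using assms by auto
  let ?f = "\<lambda>t. (x - t) powr (\<gamma> - 1) * g t"
  define I where "I = integral {a..x} ?f"
  have "?f integrable_on {a..x}"
    using absolutely_integrable_frac_left[OF assms] set_lebesgue_integral_eq_integral(1) by blast
  then have "(?f has_integral I) (cbox a x)" by (auto simp: I_def cbox_interval)
  from has_integral_affinity[OF this, of "a - x" x]
  have "((\<lambda>r. (- ((a - x) * r)) powr (\<gamma> - 1) * g ((a - x) * r + x)) has_integral I / (x - a))
    ((\<lambda>t. (t - x) / (a - x)) ` {a..x})"
    using xa by (simp add: cbox_interval divide_simps)
  moreover have "(\<lambda>t. (t - x) / (a - x)) ` {a..x} = {0..1}"
  proof (intro subset_antisym subsetI)
    fix r assume r: "r \<in> {0..1::real}"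
    have "0 \<le> r * (x - a)" "r * (x - a) \<le> 1 * (x - a)"
      using r xa by (intro mult_nonneg_nonneg mult_right_mono; simp)+
    then have "x - r * (x - a) \<in> {a..x}" by auto
    moreover have "r = ((x - r * (x - a)) - x) / (a - x)" using xa by (simp add: field_simps)
    ultimately show "r \<in> (\<lambda>t. (t - x) / (a - x)) ` {a..x}" by blast
  qed (use xa in \<open>auto simp: field_simps\<close>)
  ultimately have "((\<lambda>r. ((x - a) * r) powr (\<gamma> - 1) * g (x - (x - a) * r)) has_integral I / (x - a)) {0..1}"
    by (simp add: algebra_simps)
  moreover have "((x - a) * r) powr (\<gamma> - 1) * g (x - (x - a) * r) =
      (x - a) powr (\<gamma> - 1) * (r powr (\<gamma> - 1) * g (x - (x - a) * r))" if "r \<in> {0..1}" for r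
    using that xa by (simp add: powr_mult)
  ultimately have "((\<lambda>r. (x - a) powr (\<gamma> - 1) * (r powr (\<gamma> - 1) * g (x - (x - a) * r))) has_integral I / (x - a)) {0..1}"
    by (rule has_integral_eq[rotated])
  then have "(x - a) powr (\<gamma> - 1) * integral {0..1} (\<lambda>r. r powr (\<gamma> - 1) * g (x - (x - a) * r)) = I / (x - a)"
    by (metis integral_mult_right integral_unique)
  moreover have "(x - a) powr \<gamma> = (x - a) powr (\<gamma> - 1) * (x - a)"
    using xa by (simp add: powr_diff)
  ultimately have "(x - a) powr \<gamma> * integral {0..1} (\<lambda>r. r powr (\<gamma> - 1) * g (x - (x - a) * r)) = I / (x - a) * (x - a)"
    by (simp add: mult_ac)
  then show ?thesis using xa by (simp add: I_def)
qed simp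

lemma continuous_on_weighted_integral:
  fixes \<psi> :: "real \<Rightarrow> real \<Rightarrow> real"
  assumes "0 < \<gamma>" and \<psi>: "continuous_on ({a..b} \<times> {0..1}) (\<lambda>(x, r). \<psi> x r)"
  shows "continuous_on {a..b} (\<lambda>x. integral {0..1} (\<lambda>r. r powr (\<gamma> - 1) * \<psi> x r))"
  unfolding continuous_on_iff
proof (intro ballI allI impI)
  fix x and e :: real assume x: "x \<in> {a..b}" and "0 < e"
  have unif: "uniformly_continuous_on ({a..b} \<times> {0..1}) (\<lambda>(x, r). \<psi> x r)"
    using \<psi> by (rule compact_uniformly_continuous) (intro compact_Times compact_Icc)
  \<comment> \<open>The weight has integral \<open>1 / \<gamma>\<close> over the unit interval, so a
    uniform deviation of \<open>e'\<close> changes the integral by at most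
    \<open>e / 2\<close>.\<close>
  define e' where "e' = e * \<gamma> / 2"
  have e': "0 < e'" using \<open>0 < e\<close> assms(1) by (simp add: e'_def)
  then obtain d where d: "0 < d" "\<And>p q. p \<in> {a..b} \<times> {0..1} \<Longrightarrow> q \<in> {a..b} \<times> {0..1} \<Longrightarrow> dist q p < d \<Longrightarrow>
      dist (case q of (x, r) \<Rightarrow> \<psi> x r) (case p of (x, r) \<Rightarrow> \<psi> x r) < e'"
    using unif unfolding uniformly_continuous_on_def by meson
  have int: "(\<lambda>r. r powr (\<gamma> - 1) * \<psi> z r) integrable_on {0..1}" if "z \<in> {a..b}" for z
  proof -
    have c: "continuous_on {0..1} (\<psi> z)"
    proof -
      have "continuous_on {0..1} (\<lambda>r. case (z, r) of (x, r) \<Rightarrow> \<psi> x r)"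
        by (rule continuous_on_compose2[OF \<psi>]) (use that in \<open>auto intro!: continuous_intros\<close>)
      then show ?thesis by simp
    qed
    have "(\<lambda>r. \<psi> z r * r powr (\<gamma> - 1)) absolutely_integrable_on {0..1}"
    proof (rule absolutely_integrable_bounded_measurable_product_real)
      show "\<psi> z \<in> borel_measurable (lebesgue_on {0..1})"
        using c by (rule continuous_imp_measurable_on_sets_lebesgue) simp
      show "bounded (\<psi> z ` {0..1})"
        using compact_continuous_image[OF c compact_Icc] by (rule compact_imp_bounded)
    qed (use absolutely_integrable_on_powr_from_0[of \<gamma> 1] assms(1) in auto)
    then show ?thesis using set_lebesgue_integral_eq_integral(1) by (simp add: mult.commute)
  qed
  show "\<exists>d>0. \<forall>x'\<in>{a..b}. dist x' x < d \<longrightarrow>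
    dist (integral {0..1} (\<lambda>r. r powr (\<gamma> - 1) * \<psi> x' r)) (integral {0..1} (\<lambda>r. r powr (\<gamma> - 1) * \<psi> x r)) < e"
  proof (intro exI conjI ballI impI)
    fix x' assume x': "x' \<in> {a..b}" "dist x' x < d"
    have "integral {0..1} (\<lambda>r. r powr (\<gamma> - 1) * \<psi> x' r) - integral {0..1} (\<lambda>r. r powr (\<gamma> - 1) * \<psi> x r)
      = integral {0..1} (\<lambda>r. r powr (\<gamma> - 1) * \<psi> x' r - r powr (\<gamma> - 1) * \<psi> x r)"
      using int x x' by (intro Henstock_Kurzweil_Integration.integral_diff[symmetric]) auto
    also have "norm \<dots> \<le> integral {0..1} (\<lambda>r. r powr (\<gamma> - 1) * e')"
    proof (rule integral_norm_bound_integral)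
      show "(\<lambda>r. r powr (\<gamma> - 1) * \<psi> x' r - r powr (\<gamma> - 1) * \<psi> x r) integrable_on {0..1}"
        using int x x' by (intro integrable_diff) auto
      show "(\<lambda>r. r powr (\<gamma> - 1) * e') integrable_on {0..1}"
        using has_integral_powr_from_0[of "\<gamma> - 1" 1] assms(1)
        by (intro integrable_on_mult_left) (auto simp: integrable_on_def)
      fix r :: real assume r: "r \<in> {0..1}"
      have "dist (x', r) (x, r) < d" using x' by (simp add: dist_Pair_Pair)
      then have "\<bar>\<psi> x' r - \<psi> x r\<bar> \<le> e'"
        using d(2)[of "(x, r)" "(x', r)"] x x' r by (auto simp: dist_real_def)
      then show "norm (r powr (\<gamma> - 1) * \<psi> x' r - r powr (\<gamma> - 1) * \<psi> x r) \<le> r powr (\<gamma> - 1) * e'"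
        by (simp add: right_diff_distrib[symmetric] abs_mult mult_left_mono)
    qed
    also have "\<dots> = e / 2"
      using has_integral_powr_from_0[of "\<gamma> - 1" 1] assms(1) by (simp add: integral_unique e'_def)
    finally show "dist (integral {0..1} (\<lambda>r. r powr (\<gamma> - 1) * \<psi> x' r)) (integral {0..1} (\<lambda>r. r powr (\<gamma> - 1) * \<psi> x r)) < e"
      using \<open>0 < e\<close> by (simp add: dist_real_def)
  qed (rule d(1))
qed

lemma continuous_on_frac_left:
  fixes g :: "real \<Rightarrow> real"
  assumes "0 < \<gamma>" "continuous_on {a..b} g"
  shows "continuous_on {a..b} (\<lambda>x. integral {a..x} (\<lambda>t. (x - t) powr (\<gamma> - 1) * g t))"
proof -
  have "continuous_on {a..b} (\<lambda>x. integral {0..1} (\<lambda>r. r powr (\<gamma> - 1) * g (x - (x - a) * r)))"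
  proof (rule continuous_on_weighted_integral[OF assms(1)])
    have "x - (x - a) * r \<in> {a..b}" if "x \<in> {a..b}" "r \<in> {0..1}" for x r
    proof -
      have "0 \<le> (x - a) * r" "(x - a) * r \<le> (x - a) * 1"
        using that by (intro mult_nonneg_nonneg mult_left_mono; simp)+
      then show ?thesis using that by auto
    qed
    then show "continuous_on ({a..b} \<times> {0..1}) (\<lambda>(x, r). g (x - (x - a) * r))"
      unfolding case_prod_beta
      by (intro continuous_on_compose2[OF assms(2)] continuous_intros) auto
  qed
  moreover have "continuous_on {a..b} (\<lambda>x. (x - a) powr \<gamma>)"
    using assms(1) by (intro continuous_on_powr' continuous_intros) auto
  ultimately have "continuous_on {a..b} (\<lambda>x. (x - a) powr \<gamma> * integral {0..1} (\<lambda>r. r powr (\<gamma> - 1) * g (x - (x - a) * r)))"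
    by (intro continuous_on_mult)
  then show ?thesis
    by (rule continuous_on_eq) (use frac_left_rescaled[OF assms] in auto)
qed

text \<open>The reflection of the line exchanges right and left fractional integrals, so
  integrability and continuity carry over from the left case.\<close>

lemma frac_right_reflect:
  fixes g :: "real \<Rightarrow> real"
  shows "integral {x..b} (\<lambda>t. (t - x) powr c * g t) = integral {- b..- x} (\<lambda>s. (- x - s) powr c * g (- s))"
    and "(\<lambda>t. (t - x) powr c * g t) absolutely_integrable_on {x..b} \<longleftrightarrow>
      (\<lambda>s. (- x - s) powr c * g (- s)) absolutely_integrable_on {- b..- x}"
proof -
  have eq: "(- s - x) powr c * g (- s) = (- x - s) powr c * g (- s)" for s
    by (simp only: minus_diff_commute)
  show "integral {x..b} (\<lambda>t. (t - x) powr c * g t) = integral {- b..- x} (\<lambda>s. (- x - s) powr c * g (- s))"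
    using Henstock_Kurzweil_Integration.integral_reflect_real[where a = x and b = b and f = "\<lambda>t. (t - x) powr c * g t"]
    unfolding eq by (rule sym)
  show "(\<lambda>t. (t - x) powr c * g t) absolutely_integrable_on {x..b} \<longleftrightarrow>
      (\<lambda>s. (- x - s) powr c * g (- s)) absolutely_integrable_on {- b..- x}"
    using absolutely_integrable_reflect_real[where a = x and b = b and f = "\<lambda>t. (t - x) powr c * g t"]
    unfolding eq by (rule sym)
qed

lemma absolutely_integrable_frac_right:
  fixes g :: "real \<Rightarrow> real"
  assumes "0 < \<gamma>" "continuous_on {a..b} g" "x \<in> {a..b}"
  shows "(\<lambda>t. (t - x) powr (\<gamma> - 1) * g t) absolutely_integrable_on {x..b}"
  unfolding frac_right_reflect
proof (rule absolutely_integrable_frac_left[OF assms(1)])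
  show "continuous_on {- b..- a} (\<lambda>s. g (- s))"
    by (intro continuous_on_compose2[OF assms(2)] continuous_intros) auto
qed (use assms(3) in auto)

lemma continuous_on_frac_right:
  fixes g :: "real \<Rightarrow> real"
  assumes "0 < \<gamma>" "continuous_on {a..b} g"
  shows "continuous_on {a..b} (\<lambda>x. integral {x..b} (\<lambda>t. (t - x) powr (\<gamma> - 1) * g t))"
proof -
  have "continuous_on {- b..- a} (\<lambda>s. g (- s))"
    by (intro continuous_on_compose2[OF assms(2)] continuous_intros) auto
  from continuous_on_frac_left[OF assms(1) this]
  have "continuous_on {a..b} (\<lambda>x. integral {- b..- x} (\<lambda>s. (- x - s) powr (\<gamma> - 1) * g (- s)))"
    by (rule continuous_on_compose2[where f = uminus]) (auto intro!: continuous_intros)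
  then show ?thesis unfolding frac_right_reflect(1)[symmetric] .
qed

section \<open>Exchange of the order of integration in fractional integrals\<close>

lemma frac_left_Bochner:
  fixes g :: "real \<Rightarrow> real"
  assumes "0 < \<gamma>" "continuous_on {a..b} g" "x \<in> {a..b}"
  defines "h \<equiv> \<lambda>t. (if t \<le> x then (x - t) powr (\<gamma> - 1) else 0) * (indicator {a..b} t * g t)"
  shows "integrable lborel h"
    and "integral\<^sup>L lborel h = integral {a..x} (\<lambda>t. (x - t) powr (\<gamma> - 1) * g t)"
proof -
  have [measurable]: "(\<lambda>t. indicator {a..b} t * g t) \<in> borel_measurable borel"
    using borel_measurable_continuous_on_indicator[OF _ assms(2)] by simp
  have hm: "h \<in> borel_measurable lborel" unfolding h_def by measurable
  have eq: "h = (\<lambda>t. indicator {a..x} t *\<^sub>R ((x - t) powr (\<gamma> - 1) * g t))"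
    using assms(3) by (auto simp: h_def indicator_def fun_eq_iff)
  have ai: "(\<lambda>t. (x - t) powr (\<gamma> - 1) * g t) absolutely_integrable_on {a..x}"
    by (rule absolutely_integrable_frac_left[OF assms(1-3)])
  show "integrable lborel h"
    using ai hm unfolding set_integrable_def eq[symmetric] by (simp add: integrable_completion)
  show "integral\<^sup>L lborel h = integral {a..x} (\<lambda>t. (x - t) powr (\<gamma> - 1) * g t)"
    using set_lebesgue_integral_eq_integral(2)[OF ai] hm
    unfolding set_lebesgue_integral_def eq[symmetric] by (simp add: integral_completion)
qed

lemma frac_right_Bochner:
  fixes g :: "real \<Rightarrow> real"
  assumes "0 < \<gamma>" "continuous_on {a..b} g" "t \<in> {a..b}"
  defines "h \<equiv> \<lambda>x. (if t \<le> x then (x - t) powr (\<gamma> - 1) else 0) * (indicator {a..b} x * g x)"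
  shows "integral\<^sup>L lborel h = integral {t..b} (\<lambda>x. (x - t) powr (\<gamma> - 1) * g x)"
proof -
  have [measurable]: "(\<lambda>t. indicator {a..b} t * g t) \<in> borel_measurable borel"
    using borel_measurable_continuous_on_indicator[OF _ assms(2)] by simp
  have hm: "h \<in> borel_measurable lborel" unfolding h_def by measurable
  have eq: "h = (\<lambda>x. indicator {t..b} x *\<^sub>R ((x - t) powr (\<gamma> - 1) * g x))"
    using assms(3) by (auto simp: h_def indicator_def fun_eq_iff)
  show ?thesis
    using set_lebesgue_integral_eq_integral(2)[OF absolutely_integrable_frac_right[OF assms(1-3)]] hm
    unfolding set_lebesgue_integral_def eq[symmetric] by (simp add: integral_completion)
qed

lemma integral_indicator_Bochner:
  fixes F :: "real \<Rightarrow> real"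
  assumes "continuous_on {a..b} F"
  shows "integrable lborel (\<lambda>x. indicator {a..b} x * F x)"
    and "integral\<^sup>L lborel (\<lambda>x. indicator {a..b} x * F x) = integral {a..b} F"
  using borel_integrable_atLeastAtMost'[OF assms] set_borel_integral_eq_integral(2)[OF borel_integrable_atLeastAtMost'[OF assms]]
  by (simp_all add: set_integrable_def set_lebesgue_integral_def)

text \<open>Dirichlet's formula: Fubini on the triangle \<open>t \<le> x\<close>. The kernel
  \<open>k\<close> is cut off below the diagonal and the indicators sit on \<open>q\<close> and
  \<open>g\<close>, so that one measurable integrand on the plane yields the left integral in one
  order and the right integral in the other.\<close>

lemma frac_integral_swap:
  fixes q g :: "real \<Rightarrow> real"
  assumes "0 < \<gamma>" and q: "continuous_on {a..b} q" and g: "continuous_on {a..b} g"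
  shows "integral {a..b} (\<lambda>x. q x * integral {a..x} (\<lambda>t. (x - t) powr (\<gamma> - 1) * g t)) =
    integral {a..b} (\<lambda>t. integral {t..b} (\<lambda>x. (x - t) powr (\<gamma> - 1) * q x) * g t)"
proof -
  define k where "k x t = (if t \<le> x then (x - t) powr (\<gamma> - 1) else 0)" for x t :: real
  define Q G where "Q x = indicator {a..b} x * q x" and "G x = indicator {a..b} x * g x" for x
  have [measurable]: "Q \<in> borel_measurable borel" "G \<in> borel_measurable borel"
    using borel_measurable_continuous_on_indicator[OF _ q] borel_measurable_continuous_on_indicator[OF _ g]
    by (simp_all add: Q_def[abs_def] G_def[abs_def])
  have left: "(\<integral>t. k x t * G t \<partial>lborel) = integral {a..x} (\<lambda>t. (x - t) powr (\<gamma> - 1) * g t)"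
    "integrable lborel (\<lambda>t. k x t * G t)" if "x \<in> {a..b}" for x
    using frac_left_Bochner[OF assms(1) g that] by (simp_all add: k_def G_def)
  have abs_left: "(\<integral>t. norm (k x t * G t) \<partial>lborel) = integral {a..x} (\<lambda>t. (x - t) powr (\<gamma> - 1) * \<bar>g t\<bar>)"
    if "x \<in> {a..b}" for x
  proof -
    have "norm (k x t * G t) = k x t * (indicator {a..b} t * \<bar>g t\<bar>)" for t
      by (simp add: k_def G_def abs_mult)
    then show ?thesis
      using frac_left_Bochner(2)[OF assms(1) continuous_on_rabs[OF g] that] by (simp add: k_def)
  qed
  have right: "(\<integral>x. k x t * Q x \<partial>lborel) = integral {t..b} (\<lambda>x. (x - t) powr (\<gamma> - 1) * q x)"
    if "t \<in> {a..b}" for t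
    using frac_right_Bochner[OF assms(1) q that] by (simp add: k_def Q_def)
  have km[measurable]: "case_prod (\<lambda>x t. Q x * (k x t * G t)) \<in> borel_measurable (lborel \<Otimes>\<^sub>M lborel)"
    unfolding k_def by measurable
  have integ: "integrable (lborel \<Otimes>\<^sub>M lborel) (case_prod (\<lambda>x t. Q x * (k x t * G t)))"
  proof (rule lborel_pair.Fubini_integrable[OF km])
    \<comment> \<open>The inner integral of the absolute value is again a left fractional integral,
      now of \<open>\<bar>g\<bar>\<close>, hence continuous in \<open>x\<close>; this settles the
      integrability on the plane.\<close>
    have "(\<integral>t. norm (case (x, t) of (x, t) \<Rightarrow> Q x * (k x t * G t)) \<partial>lborel) =
      indicator {a..b} x * (\<bar>q x\<bar> * integral {a..x} (\<lambda>t. (x - t) powr (\<gamma> - 1) * \<bar>g t\<bar>))" for x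
    proof (cases "x \<in> {a..b}")
      case True
      then show ?thesis using abs_left[OF True] by (simp add: Q_def abs_mult[of "q x"])
    qed (simp add: Q_def)
    moreover have "integrable lborel (\<lambda>x. indicator {a..b} x * (\<bar>q x\<bar> * integral {a..x} (\<lambda>t. (x - t) powr (\<gamma> - 1) * \<bar>g t\<bar>)))"
      by (intro integral_indicator_Bochner(1) continuous_on_mult continuous_on_frac_left[OF assms(1)] continuous_on_rabs q g)
    ultimately show "integrable lborel (\<lambda>x. \<integral>t. norm (case (x, t) of (x, t) \<Rightarrow> Q x * (k x t * G t)) \<partial>lborel)"
      by presburger
    have "integrable lborel (\<lambda>t. Q x * (k x t * G t))" for x
    proof (cases "x \<in> {a..b}")
      case True
      then show ?thesis using left(2) by simp
    next
      case False
      then have "Q x = 0" by (simp add: Q_def)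
      then show ?thesis by simp
    qed
    then show "AE x in lborel. integrable lborel (\<lambda>t. case (x, t) of (x, t) \<Rightarrow> Q x * (k x t * G t))"
      by simp
  qed
  have "integral {a..b} (\<lambda>x. q x * integral {a..x} (\<lambda>t. (x - t) powr (\<gamma> - 1) * g t)) =
    (\<integral>x. indicator {a..b} x * (q x * integral {a..x} (\<lambda>t. (x - t) powr (\<gamma> - 1) * g t)) \<partial>lborel)"
    by (intro integral_indicator_Bochner(2)[symmetric] continuous_on_mult continuous_on_frac_left[OF assms(1)] q g)
  also have "\<dots> = (\<integral>x. (\<integral>t. Q x * (k x t * G t) \<partial>lborel) \<partial>lborel)"
  proof (rule Bochner_Integration.integral_cong[OF refl])
    fix x show "indicator {a..b} x * (q x * integral {a..x} (\<lambda>t. (x - t) powr (\<gamma> - 1) * g t)) = (\<integral>t. Q x * (k x t * G t) \<partial>lborel)"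
      using left[of x] by (cases "x \<in> {a..b}") (simp_all add: Q_def)
  qed
  also have "\<dots> = (\<integral>t. (\<integral>x. Q x * (k x t * G t) \<partial>lborel) \<partial>lborel)"
    using lborel_pair.Fubini_integral[OF integ] by simp
  also have "\<dots> = (\<integral>t. indicator {a..b} t * (integral {t..b} (\<lambda>x. (x - t) powr (\<gamma> - 1) * q x) * g t) \<partial>lborel)"
  proof (rule Bochner_Integration.integral_cong[OF refl])
    fix t
    have "(\<integral>x. Q x * (k x t * G t) \<partial>lborel) = (\<integral>x. G t * (k x t * Q x) \<partial>lborel)"
      by (simp add: mult.commute mult.left_commute)
    then show "(\<integral>x. Q x * (k x t * G t) \<partial>lborel) = indicator {a..b} t * (integral {t..b} (\<lambda>x. (x - t) powr (\<gamma> - 1) * q x) * g t)"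
      using right[of t] by (cases "t \<in> {a..b}") (simp_all add: G_def)
  qed
  also have "\<dots> = integral {a..b} (\<lambda>t. integral {t..b} (\<lambda>x. (x - t) powr (\<gamma> - 1) * q x) * g t)"
    by (intro integral_indicator_Bochner(2) continuous_on_mult continuous_on_frac_right[OF assms(1)] q g)
  finally show ?thesis .
qed

subsection \<open>A higher-order du Bois-Reymond lemma\<close>

lemma pderiv_sum: "pderiv (\<Sum>i\<in>A. f i) = (\<Sum>i\<in>A. pderiv (f i))"
  by (induction A rule: infinite_finite_induct) (simp_all add: pderiv_add)

lemma poly_continuous_on: "continuous_on A (poly (p :: real poly))"
  using continuous_on_poly[OF continuous_on_id] by simp

lemma poly_antiderivative:
  obtains P :: "real poly" where "pderiv P = q" "poly P a = 0"
proof -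
  define P0 where "P0 = (\<Sum>i\<le>degree q. monom (coeff q i / of_nat (Suc i)) (Suc i))"
  have "pderiv P0 = (\<Sum>i\<le>degree q. monom (coeff q i) i)"
    unfolding P0_def pderiv_sum by (intro sum.cong) (simp_all add: pderiv_monom)
  then have "pderiv P0 = q" by (simp add: poly_as_sum_of_monoms)
  then show thesis
    by (intro that[of "P0 - [:poly P0 a:]"]) (simp_all add: pderiv_diff pderiv_pCons)
qed

lemma integral_pderiv:
  fixes P :: "real poly"
  assumes "a \<le> b"
  shows "integral {a..b} (poly (pderiv P)) = poly P b - poly P a"
  using assms
  by (intro integral_unique fundamental_theorem_of_calculus)
    (auto intro!: has_vector_derivative_at_within DERIV_subset[OF poly_DERIV] simp: has_real_derivative_iff_has_vector_derivative[symmetric])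

lemma poly_integrable_on: "poly p integrable_on {a..b::real}"
  by (intro integrable_continuous_real continuous_intros)

lemma continuous_mult_integrable_on:
  fixes f g :: "real \<Rightarrow> real"
  assumes "continuous_on {a..b} f" "continuous_on {a..b} g"
  shows "(\<lambda>x. f x * g x) integrable_on {a..b}"
  using assms by (intro integrable_continuous_real continuous_intros)

text \<open>Orthogonality to the constant 1 gives \<open>P\<close> the value 0 at \<open>b\<close>.
  Integrating by parts against an antiderivative of \<open>p\<close> then shows that
  \<open>P\<close> is orthogonal to one degree less. The bound on the degree is expressed through
  vanishing coefficients, so that \<open>m = 0\<close> leaves only the zero polynomial.\<close>

lemma orthogonal_antiderivative:
  fixes P \<phi> :: "real poly"
  assumes ab: "a < b" and P: "pderiv P = \<phi>" "poly P a = 0"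
    and orth: "\<And>p. \<forall>i\<ge>Suc m. coeff p i = 0 \<Longrightarrow> integral {a..b} (poly (\<phi> * p)) = 0"
  shows "poly P b = 0"
    and "\<And>p. \<forall>i\<ge>m. coeff p i = 0 \<Longrightarrow> integral {a..b} (poly (P * p)) = 0"
proof -
  show Pb: "poly P b = 0"
    using orth[of 1] integral_pderiv[of a b P] ab P by simp
  fix p :: "real poly" assume p: "\<forall>i\<ge>m. coeff p i = 0"
  obtain R where R: "pderiv R = p" "poly R a = 0" by (rule poly_antiderivative)
  have "coeff R i = 0" if i: "Suc m \<le> i" for i
  proof -
    obtain k where "i = Suc k" "m \<le> k" using i by (cases i) auto
    then show ?thesis using p R(1) coeff_pderiv[of R k] by auto
  qed
  then have "integral {a..b} (poly (\<phi> * R)) = 0" using orth by blast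
  moreover have "integral {a..b} (poly (pderiv (P * R))) = 0"
    using integral_pderiv[of a b "P * R"] ab P Pb R by simp
  moreover have "poly (pderiv (P * R)) = (\<lambda>x. poly (\<phi> * R) x + poly (P * p) x)"
    using P(1) R(1) by (auto simp: pderiv_mult mult.commute)
  ultimately show "integral {a..b} (poly (P * p)) = 0"
    using integral_add[OF poly_integrable_on[of "\<phi> * R" a b] poly_integrable_on[of "P * p" a b]] by simp
qed

text \<open>Each antiderivative that vanishes at \<open>a\<close> uses up one order of orthogonality
  and gains one order of boundary conditions at \<open>b\<close>.\<close>

lemma orthogonal_iterated_antiderivative:
  fixes \<phi> :: "real poly"
  assumes "a < b" "\<And>p. \<forall>i\<ge>n. coeff p i = 0 \<Longrightarrow> integral {a..b} (poly (\<phi> * p)) = 0"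
  shows "\<exists>\<eta>. (pderiv ^^ n) \<eta> = \<phi> \<and> (\<forall>j<n. poly ((pderiv ^^ j) \<eta>) a = 0 \<and> poly ((pderiv ^^ j) \<eta>) b = 0)"
  using assms(2)
proof (induction n arbitrary: \<phi>)
  case (Suc n)
  obtain P where P: "pderiv P = \<phi>" "poly P a = 0" by (rule poly_antiderivative)
  note PP = orthogonal_antiderivative[OF assms(1) P Suc.prems]
  have "\<exists>\<eta>. (pderiv ^^ n) \<eta> = P \<and> (\<forall>j<n. poly ((pderiv ^^ j) \<eta>) a = 0 \<and> poly ((pderiv ^^ j) \<eta>) b = 0)"
    by (rule Suc.IH) (rule PP(2))
  then obtain \<eta> where \<eta>: "(pderiv ^^ n) \<eta> = P" "\<forall>j<n. poly ((pderiv ^^ j) \<eta>) a = 0 \<and> poly ((pderiv ^^ j) \<eta>) b = 0"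
    by blast
  then show ?case using P PP(1) by (intro exI[of _ \<eta>]) (auto simp: less_Suc_eq)
qed simp

lemma integral_square_eq_0:
  fixes f :: "real \<Rightarrow> real"
  assumes "a < b" "continuous_on {a..b} f" "integral {a..b} (\<lambda>x. f x * f x) = 0"
  shows "\<forall>x\<in>{a..b}. f x = 0"
proof -
  have "\<forall>x\<in>{a..b}. f x * f x = 0"
    using assms integral_eq_0_iff[of a b "\<lambda>x. f x * f x"] by (simp add: continuous_on_mult)
  then show ?thesis by simp
qed

text \<open>The orthogonal projection in L^2 onto polynomials of degree below \<open>n\<close>, by
  Gram-Schmidt. \<open>H\<close> is generalized in the induction because the hypothesis is applied
  to the monomial of degree \<open>n\<close> as well.\<close>

lemma polynomial_projection:
  fixes H :: "real \<Rightarrow> real"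
  assumes ab: "a < b" and "continuous_on {a..b} H"
  shows "\<exists>Q. (\<forall>i\<ge>n. coeff Q i = 0) \<and>
    (\<forall>p. (\<forall>i\<ge>n. coeff p i = 0) \<longrightarrow> integral {a..b} (\<lambda>x. (H x - poly Q x) * poly p x) = 0)"
  using assms(2)
proof (induction n arbitrary: H)
  case 0
  have "integral {a..b} (\<lambda>x. (H x - poly 0 x) * poly p x) = 0" if "\<forall>i\<ge>0. coeff p i = 0" for p :: "real poly"
  proof -
    have "p = 0" using that by (simp add: poly_eq_iff)
    then show ?thesis by simp
  qed
  then show ?case by (intro exI[of _ 0]) auto
next
  case (Suc n)
  have int: "(\<lambda>x. f x * poly p x) integrable_on {a..b}" if "continuous_on {a..b} f" for f p
    using that by (intro continuous_mult_integrable_on continuous_intros)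
  obtain q where q: "\<forall>i\<ge>n. coeff q i = 0"
    "\<And>p. \<forall>i\<ge>n. coeff p i = 0 \<Longrightarrow> integral {a..b} (\<lambda>x. (poly (monom 1 n) x - poly q x) * poly p x) = 0"
    using Suc.IH[OF poly_continuous_on] by blast
  \<comment> \<open>The next orthogonal polynomial. It is monic of degree \<open>n\<close>, hence
    nonzero, and so its square has a nonzero integral.\<close>
  define e where "e = monom 1 n - q"
  have e_orth: "integral {a..b} (\<lambda>x. poly e x * poly p x) = 0" if "\<forall>i\<ge>n. coeff p i = 0" for p
    using q(2)[OF that] by (simp add: e_def)
  have ecoeff: "coeff e n = 1" "\<forall>i\<ge>Suc n. coeff e i = 0" using q(1) by (auto simp: e_def)
  have een: "integral {a..b} (\<lambda>x. poly e x * poly e x) \<noteq> 0"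
  proof
    assume "integral {a..b} (\<lambda>x. poly e x * poly e x) = 0"
    then have "\<forall>x\<in>{a..b}. poly e x = 0" using ab by (intro integral_square_eq_0 continuous_intros) auto
    then have "{a..b} \<subseteq> {x. poly e x = 0}" by auto
    moreover have "infinite {a..b}" using ab by simp
    ultimately have "e = 0" using poly_roots_finite finite_subset by blast
    then show False using ecoeff(1) by simp
  qed
  obtain Q where Q: "\<forall>i\<ge>n. coeff Q i = 0"
    "\<And>p. \<forall>i\<ge>n. coeff p i = 0 \<Longrightarrow> integral {a..b} (\<lambda>x. (H x - poly Q x) * poly p x) = 0"
    using Suc.IH[OF Suc.prems] by blast
  define c where "c = integral {a..b} (\<lambda>x. H x * poly e x) / integral {a..b} (\<lambda>x. poly e x * poly e x)"
  have HQ: "continuous_on {a..b} (\<lambda>x. H x - poly Q x)" using Suc.prems by (intro continuous_intros)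
  have split: "integral {a..b} (\<lambda>x. (H x - poly (Q + smult c e) x) * poly p x) =
    integral {a..b} (\<lambda>x. (H x - poly Q x) * poly p x) - c * integral {a..b} (\<lambda>x. poly e x * poly p x)" for p
  proof -
    have "integral {a..b} (\<lambda>x. (H x - poly (Q + smult c e) x) * poly p x) =
      integral {a..b} (\<lambda>x. (H x - poly Q x) * poly p x - c * (poly e x * poly p x))"
      by (intro integral_cong) (simp add: algebra_simps)
    also have "\<dots> = integral {a..b} (\<lambda>x. (H x - poly Q x) * poly p x) - integral {a..b} (\<lambda>x. c * (poly e x * poly p x))"
      by (intro Henstock_Kurzweil_Integration.integral_diff int[OF HQ] integrable_on_mult_right int continuous_intros)
    finally show ?thesis by simp
  qed
  have He: "integral {a..b} (\<lambda>x. (H x - poly Q x) * poly e x) = integral {a..b} (\<lambda>x. H x * poly e x)"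
  proof -
    have "integral {a..b} (\<lambda>x. (H x - poly Q x) * poly e x) = integral {a..b} (\<lambda>x. H x * poly e x - poly e x * poly Q x)"
      by (intro integral_cong) (simp add: algebra_simps)
    also have "\<dots> = integral {a..b} (\<lambda>x. H x * poly e x) - integral {a..b} (\<lambda>x. poly e x * poly Q x)"
      by (intro Henstock_Kurzweil_Integration.integral_diff int continuous_intros Suc.prems)
    finally show ?thesis using e_orth[OF Q(1)] by simp
  qed
  show ?case
  proof (intro exI conjI allI impI)
    show "coeff (Q + smult c e) i = 0" if "Suc n \<le> i" for i using that Q(1) ecoeff(2) by auto
    fix p :: "real poly" assume p: "\<forall>i\<ge>Suc n. coeff p i = 0"
    define d where "d = coeff p n"
    \<comment> \<open>Removing the leading term by a multiple of \<open>e\<close> leaves a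
      polynomial of lower degree; both parts are orthogonal to the new remainder.\<close>
    define p' where "p' = p - smult d e"
    have p': "\<forall>i\<ge>n. coeff p' i = 0"
    proof (intro allI impI)
      fix i assume "n \<le> i"
      then show "coeff p' i = 0" using p ecoeff by (cases "i = n") (auto simp: p'_def d_def)
    qed
    let ?R = "\<lambda>x. H x - poly (Q + smult c e) x"
    have R: "continuous_on {a..b} ?R" using Suc.prems by (intro continuous_intros)
    have "integral {a..b} (\<lambda>x. ?R x * poly p x) = integral {a..b} (\<lambda>x. ?R x * poly p' x + d * (?R x * poly e x))"
      by (intro integral_cong) (simp add: p'_def algebra_simps)
    also have "\<dots> = integral {a..b} (\<lambda>x. ?R x * poly p' x) + integral {a..b} (\<lambda>x. d * (?R x * poly e x))"
      by (intro Henstock_Kurzweil_Integration.integral_add integrable_on_mult_right int R)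
    also have "\<dots> = 0"
    proof -
      have "integral {a..b} (\<lambda>x. ?R x * poly p' x) = 0"
        using split[of p'] Q(2)[OF p'] e_orth[OF p'] by simp
      moreover have "integral {a..b} (\<lambda>x. ?R x * poly e x) = 0"
        using split[of e] He een by (simp add: c_def)
      ultimately show ?thesis by simp
    qed
    finally show "integral {a..b} (\<lambda>x. ?R x * poly p x) = 0" .
  qed
qed

section \<open>From orthogonality to pointwise equality\<close>

lemma Weierstrass_poly:
  fixes f :: "real \<Rightarrow> real"
  assumes "continuous_on {a..b} f" "0 < e"
  obtains p :: "real poly" where "\<forall>x\<in>{a..b}. \<bar>f x - poly p x\<bar> < e"
proof -
  obtain g where g: "real_polynomial_function g" "\<And>x. x \<in> {a..b} \<Longrightarrow> \<bar>f x - g x\<bar> < e"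
    using Stone_Weierstrass_real_polynomial_function[OF compact_Icc assms] by blast
  obtain c n where "g = (\<lambda>x. \<Sum>i\<le>n. c i * x ^ i)" using g(1) real_polynomial_function_iff_sum by blast
  then have "g x = poly (\<Sum>i\<le>n. monom (c i) i) x" for x by (simp add: poly_sum poly_monom)
  then show thesis using g(2) by (intro that[of "\<Sum>i\<le>n. monom (c i) i"]) auto
qed

text \<open>For every polynomial p the integral of R^2 equals that of R (R - p), which is at most
  the maximum of |R - p| times the integral of |R|; by Weierstrass the maximum can be made
  arbitrarily small.\<close>

lemma orthogonal_to_polynomials_eq_0:
  fixes R :: "real \<Rightarrow> real"
  assumes "a < b" and R: "continuous_on {a..b} R"
    and orth: "\<And>p. integral {a..b} (\<lambda>x. R x * poly p x) = 0"
  shows "\<forall>x\<in>{a..b}. R x = 0"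
proof (rule integral_square_eq_0[OF assms(1,2)])
  have int: "(\<lambda>x. \<bar>R x\<bar>) integrable_on {a..b}" "(\<lambda>x. R x * R x) integrable_on {a..b}"
    using R by (intro integrable_continuous_real continuous_intros; assumption)+
  define M where "M = integral {a..b} (\<lambda>x. \<bar>R x\<bar>)"
  have M: "0 \<le> M" unfolding M_def by (intro Henstock_Kurzweil_Integration.integral_nonneg int) auto
  have "norm (integral {a..b} (\<lambda>x. R x * R x)) \<le> 0 + e" if "0 < e" for e
  proof -
    define d where "d = e / (M + 1)"
    have d: "0 < d" "d * M \<le> e"
      using M \<open>0 < e\<close> by (auto simp: d_def field_simps)
    obtain p where p: "\<forall>x\<in>{a..b}. \<bar>R x - poly p x\<bar> < d" using Weierstrass_poly[OF R d(1)] .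
    have "integral {a..b} (\<lambda>x. R x * R x) = integral {a..b} (\<lambda>x. R x * R x - R x * poly p x)"
      using orth[of p] Henstock_Kurzweil_Integration.integral_diff[OF int(2) continuous_mult_integrable_on[OF R, of "poly p"]]
      by (simp add: continuous_intros)
    also have "norm \<dots> \<le> integral {a..b} (\<lambda>x. d * \<bar>R x\<bar>)"
    proof (rule integral_norm_bound_integral)
      show "(\<lambda>x. R x * R x - R x * poly p x) integrable_on {a..b}"
        using R by (intro integrable_continuous_real continuous_intros)
      fix x assume "x \<in> {a..b}"
      then have "\<bar>R x - poly p x\<bar> \<le> d" using p by force
      then show "norm (R x * R x - R x * poly p x) \<le> d * \<bar>R x\<bar>"
        using mult_right_mono[of "\<bar>R x - poly p x\<bar>" d "\<bar>R x\<bar>"]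
        by (simp add: right_diff_distrib[symmetric] abs_mult mult.commute)
    qed (intro integrable_on_mult_right int)
    also have "\<dots> = d * M" by (simp add: M_def)
    finally show ?thesis using d(2) by simp
  qed
  then show "integral {a..b} (\<lambda>x. R x * R x) = 0" using field_le_epsilon[of "norm (integral {a..b} (\<lambda>x. R x * R x))" 0] by simp
qed

text \<open>Let \<open>Q\<close> be the projection of \<open>H\<close>. A test polynomial
  \<open>p\<close> splits into its own projection \<open>q\<close>, to which \<open>H - Q\<close> is
  orthogonal, and a remainder \<phi>, which is orthogonal to low degrees and hence of the form
  \<eta>^(n). To \<phi> both \<open>H\<close> and \<open>Q\<close> are orthogonal, the one by
  hypothesis, the other by its degree.\<close>

lemma du_Bois_Reymond_higher:
  fixes H :: "real \<Rightarrow> real"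
  assumes ab: "a < b" and H: "continuous_on {a..b} H"
    and var: "\<And>\<eta> :: real poly. \<forall>j<n. poly ((pderiv ^^ j) \<eta>) a = 0 \<and> poly ((pderiv ^^ j) \<eta>) b = 0 \<Longrightarrow>
      integral {a..b} (\<lambda>x. H x * poly ((pderiv ^^ n) \<eta>) x) = 0"
  obtains Q where "\<forall>i\<ge>n. coeff Q i = 0" "\<forall>x\<in>{a..b}. H x = poly Q x"
proof -
  obtain Q where Q: "\<forall>i\<ge>n. coeff Q i = 0"
    "\<And>p. \<forall>i\<ge>n. coeff p i = 0 \<Longrightarrow> integral {a..b} (\<lambda>x. (H x - poly Q x) * poly p x) = 0"
    using polynomial_projection[OF ab H, of n] by blast
  have R: "continuous_on {a..b} (\<lambda>x. H x - poly Q x)" using H by (intro continuous_intros)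
  have "\<forall>x\<in>{a..b}. H x - poly Q x = 0"
  proof (rule orthogonal_to_polynomials_eq_0[OF ab R])
    fix p :: "real poly"
    obtain q where q: "\<forall>i\<ge>n. coeff q i = 0"
      "\<And>r. \<forall>i\<ge>n. coeff r i = 0 \<Longrightarrow> integral {a..b} (\<lambda>x. (poly p x - poly q x) * poly r x) = 0"
      using polynomial_projection[OF ab poly_continuous_on] by blast
    define \<phi> where "\<phi> = p - q"
    have \<phi>: "integral {a..b} (poly (\<phi> * r)) = 0" if "\<forall>i\<ge>n. coeff r i = 0" for r
      using q(2)[OF that] by (simp add: \<phi>_def poly_mult[abs_def])
    obtain \<eta> where \<eta>: "(pderiv ^^ n) \<eta> = \<phi>" "\<forall>j<n. poly ((pderiv ^^ j) \<eta>) a = 0 \<and> poly ((pderiv ^^ j) \<eta>) b = 0"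
      using orthogonal_iterated_antiderivative[OF ab \<phi>] by blast
    have H\<phi>: "integral {a..b} (\<lambda>x. H x * poly \<phi> x) = 0" using var[OF \<eta>(2)] \<eta>(1) by simp
    have Q\<phi>: "integral {a..b} (\<lambda>x. poly Q x * poly \<phi> x) = 0"
      using \<phi>[OF Q(1)] by (simp add: poly_mult[abs_def] mult.commute)
    have i: "(\<lambda>x. f x * poly r x) integrable_on {a..b}" if "continuous_on {a..b} f" for f r
      using that by (intro continuous_mult_integrable_on continuous_intros)
    have "integral {a..b} (\<lambda>x. (H x - poly Q x) * poly p x) =
      integral {a..b} (\<lambda>x. (H x * poly \<phi> x - poly Q x * poly \<phi> x) + (H x - poly Q x) * poly q x)"
      by (intro integral_cong) (simp add: \<phi>_def algebra_simps)
    also have "\<dots> = (integral {a..b} (\<lambda>x. H x * poly \<phi> x) - integral {a..b} (\<lambda>x. poly Q x * poly \<phi> x))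
      + integral {a..b} (\<lambda>x. (H x - poly Q x) * poly q x)"
      using i[OF R, of q] i[OF H, of \<phi>] i[OF poly_continuous_on, of Q \<phi>]
      by (simp add: Henstock_Kurzweil_Integration.integral_add Henstock_Kurzweil_Integration.integral_diff integrable_diff)
    finally show "integral {a..b} (\<lambda>x. (H x - poly Q x) * poly p x) = 0"
      using H\<phi> Q\<phi> Q(2)[OF q(1)] by simp
  qed
  then show thesis using that[OF Q(1)] by simp
qed

subsection \<open>Iterated derivatives and primitives\<close>

text \<open>Holds without any differentiability: both functions have the same derivatives within
  \<open>S\<close>, so even the arbitrary values chosen by \<open>vector_derivative\<close>
  coincide.\<close>

lemma nth_deriv_cong:
  assumes "\<And>s. s \<in> S \<Longrightarrow> f s = g s" "x \<in> S"
  shows "nth_deriv S k f x = nth_deriv S k g x"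
  using assms(2)
proof (induction k arbitrary: x)
  case (Suc k)
  have "(nth_deriv S k f has_vector_derivative d) (at x within S) \<longleftrightarrow>
    (nth_deriv S k g has_vector_derivative d) (at x within S)" for d
    using Suc.IH has_vector_derivative_transform[OF Suc.prems] by metis
  then show ?case by (simp add: vector_derivative_def)
qed (use assms(1) in auto)

lemma nth_deriv_Suc_shift: "nth_deriv S (Suc k) f = nth_deriv S k (nth_deriv S 1 f)"
  by (induction k) (auto simp: fun_eq_iff)

lemma differentiable_times_cong:
  assumes "\<And>s. s \<in> S \<Longrightarrow> f s = g s" "x \<in> S" "differentiable_times S k f x"
  shows "differentiable_times S k g x"
  using assms(2,3)
proof (induction k arbitrary: x)
  case (Suc k)
  obtain e where e: "e > 0" "\<And>s. s \<in> S \<inter> ball x e \<Longrightarrow> differentiable_times S k f s"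
    using Suc.prems(2) by auto
  have "nth_deriv S k g differentiable (at x within S)"
  proof (rule differentiable_transform_within[OF _ zero_less_one Suc.prems(1)])
    show "nth_deriv S k f differentiable (at x within S)" using Suc.prems(2) by simp
  qed (use nth_deriv_cong[OF assms(1)] in auto)
  then show ?case using e Suc.IH by auto
qed simp

text \<open>The recursion of \<open>differentiable_times\<close> peels off the outermost derivative,
  whereas the first derivative of a primitive is the one that is known. Differentiability on all of
  \<open>S\<close> lets the induction also run at the points near \<open>x\<close>.\<close>

lemma differentiable_times_shift:
  assumes "\<And>s. s \<in> S \<Longrightarrow> f differentiable (at s within S)" "x \<in> S"
    "differentiable_times S k (nth_deriv S 1 f) x"
  shows "differentiable_times S (Suc k) f x"
  using assms(2,3)
proof (induction k arbitrary: x)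
  case 0
  then show ?case using assms(1)[of x] by (auto intro: exI[of _ 1])
next
  case (Suc k)
  obtain e where e: "e > 0" "\<And>s. s \<in> S \<inter> ball x e \<Longrightarrow> differentiable_times S k (nth_deriv S 1 f) s"
    using Suc.prems(2) by (auto simp del: One_nat_def)
  have "nth_deriv S (Suc k) f differentiable (at x within S)"
    using Suc.prems(2) unfolding nth_deriv_Suc_shift by simp
  moreover have "\<forall>s\<in>S \<inter> ball x e. differentiable_times S (Suc k) f s"
    using e(2) Suc.IH by blast
  ultimately show ?case
    using e(1) differentiable_times.simps(2)[of S "Suc k" f x] by blast
qed

lemma nth_deriv_eqI:
  fixes f :: "real \<Rightarrow> real"
  assumes "a < b" "x \<in> {a..b}" "(nth_deriv {a..b} k f has_vector_derivative d) (at x within {a..b})"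
  shows "nth_deriv {a..b} (Suc k) f x = d"
  using vector_derivative_within_closed_interval[OF assms] by simp

text \<open>Existence and value are proved together: the formula of order \<open>k\<close> has to
  hold on a neighbourhood of \<open>x\<close> before it can be differentiated at
  \<open>x\<close>.\<close>

lemma nth_deriv_linear:
  fixes f g :: "real \<Rightarrow> real"
  assumes ab: "a < b" and "x \<in> {a..b}" "differentiable_times {a..b} k f x" "differentiable_times {a..b} k g x"
  shows "differentiable_times {a..b} k (\<lambda>s. f s + c * g s) x \<and>
    nth_deriv {a..b} k (\<lambda>s. f s + c * g s) x = nth_deriv {a..b} k f x + c * nth_deriv {a..b} k g x"
  using assms(2-)
proof (induction k arbitrary: x)
  case (Suc k)
  let ?S = "{a..b}"
  obtain e1 where e1: "e1 > 0" "\<And>s. s \<in> ?S \<inter> ball x e1 \<Longrightarrow> differentiable_times ?S k f s"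
    using Suc.prems(2) by auto
  obtain e2 where e2: "e2 > 0" "\<And>s. s \<in> ?S \<inter> ball x e2 \<Longrightarrow> differentiable_times ?S k g s"
    using Suc.prems(3) by auto
  define e where "e = min e1 e2"
  have e: "e > 0" using e1 e2 by (simp add: e_def)
  have loc: "differentiable_times ?S k (\<lambda>s. f s + c * g s) s"
    "nth_deriv ?S k (\<lambda>s. f s + c * g s) s = nth_deriv ?S k f s + c * nth_deriv ?S k g s"
    if "s \<in> ?S" "s \<in> ball x e" for s
    using Suc.IH[of s] e1(2)[of s] e2(2)[of s] that by (auto simp: e_def)
  have "nth_deriv ?S k f differentiable (at x within ?S)" "nth_deriv ?S k g differentiable (at x within ?S)"
    using Suc.prems by auto
  then have fg: "(nth_deriv ?S k f has_vector_derivative nth_deriv ?S (Suc k) f x) (at x within ?S)"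
    "(nth_deriv ?S k g has_vector_derivative nth_deriv ?S (Suc k) g x) (at x within ?S)"
    by (simp_all add: vector_derivative_works)
  have "((\<lambda>s. nth_deriv ?S k f s + c * nth_deriv ?S k g s) has_vector_derivative
      nth_deriv ?S (Suc k) f x + c * nth_deriv ?S (Suc k) g x) (at x within ?S)"
    by (intro has_vector_derivative_add has_vector_derivative_mult_right fg)
  then have d: "(nth_deriv ?S k (\<lambda>s. f s + c * g s) has_vector_derivative
      nth_deriv ?S (Suc k) f x + c * nth_deriv ?S (Suc k) g x) (at x within ?S)"
    by (rule has_vector_derivative_transform_within[OF _ e Suc.prems(1)]) (use loc(2) in \<open>auto simp: dist_commute\<close>)
  have "nth_deriv ?S k (\<lambda>s. f s + c * g s) differentiable (at x within ?S)"
    using d by (rule differentiableI_vector)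
  then have "differentiable_times ?S (Suc k) (\<lambda>s. f s + c * g s) x" using e loc(1) by auto
  then show ?case using nth_deriv_eqI[OF ab Suc.prems(1) d] by blast
qed simp

lemma nth_deriv_const_0:
  assumes ab: "a < b" and "x \<in> {a..b}"
  shows "differentiable_times {a..b} k (\<lambda>s. 0) x \<and> nth_deriv {a..b} k (\<lambda>s. 0) x = 0"
  using assms(2)
proof (induction k arbitrary: x)
  case (Suc k)
  have d: "(nth_deriv {a..b} k (\<lambda>s. 0) has_vector_derivative 0) (at x within {a..b})"
    by (rule has_vector_derivative_transform[OF Suc.prems _ has_vector_derivative_const]) (use Suc.IH in auto)
  then show ?case
    using nth_deriv_eqI[OF ab Suc.prems d] Suc.IH differentiableI_vector[OF d] by (auto intro: exI[of _ 1])
qed simp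

lemma nth_deriv_sum:
  fixes f :: "'i \<Rightarrow> real \<Rightarrow> real"
  assumes ab: "a < b" and "x \<in> {a..b}" "finite I" "\<And>i. i \<in> I \<Longrightarrow> differentiable_times {a..b} k (f i) x"
  shows "differentiable_times {a..b} k (\<lambda>s. \<Sum>i\<in>I. c i * f i s) x \<and>
    nth_deriv {a..b} k (\<lambda>s. \<Sum>i\<in>I. c i * f i s) x = (\<Sum>i\<in>I. c i * nth_deriv {a..b} k (f i) x)"
  using assms(3,4)
proof (induction I rule: finite_induct)
  case empty
  then show ?case using nth_deriv_const_0[OF ab assms(2)] by simp
next
  case (insert i I)
  have eq: "(\<lambda>s. \<Sum>i\<in>insert i I. c i * f i s) = (\<lambda>s. (\<Sum>i\<in>I. c i * f i s) + c i * f i s)"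
    using insert.hyps by (simp add: add.commute)
  show ?case
    unfolding eq using insert nth_deriv_linear[OF ab assms(2), of k "\<lambda>s. \<Sum>i\<in>I. c i * f i s" "f i" "c i"]
    by (simp add: add.commute)
qed

lemma nth_deriv_poly:
  assumes ab: "a < b" and "x \<in> {a..b}"
  shows "nth_deriv {a..b} k (poly p) x = poly ((pderiv ^^ k) p) x"
  using assms(2)
proof (induction k arbitrary: x)
  case (Suc k)
  have "(poly ((pderiv ^^ k) p) has_vector_derivative poly ((pderiv ^^ Suc k) p) x) (at x within {a..b})"
    using poly_DERIV[of "(pderiv ^^ k) p" x]
    by (simp add: has_real_derivative_iff_has_vector_derivative has_vector_derivative_at_within)
  then have "(nth_deriv {a..b} k (poly p) has_vector_derivative poly ((pderiv ^^ Suc k) p) x) (at x within {a..b})"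
    by (rule has_vector_derivative_transform[OF Suc.prems, rotated]) (use Suc.IH in auto)
  then show ?case by (rule nth_deriv_eqI[OF ab Suc.prems])
qed simp

section \<open>Iterated primitives, right inverses of iterated derivatives\<close>

definition primitive :: "real \<Rightarrow> (real \<Rightarrow> real) \<Rightarrow> real \<Rightarrow> real" where
  "primitive a f x = integral {a..x} f"

lemma primitive_has_vector_derivative:
  assumes "continuous_on {a..b} f" "x \<in> {a..b}"
  shows "(primitive a f has_vector_derivative f x) (at x within {a..b})"
  using integral_has_vector_derivative[OF assms] by (simp add: primitive_def[abs_def])

lemma continuous_on_primitive:
  assumes "continuous_on {a..b} f"
  shows "continuous_on {a..b} (primitive a f)"
  by (rule continuous_on_vector_derivative[OF primitive_has_vector_derivative[OF assms]])

lemma continuous_on_iterated_primitive: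
  assumes "continuous_on {a..b} f"
  shows "continuous_on {a..b} ((primitive a ^^ m) f)"
  by (induction m) (auto simp: assms continuous_on_primitive)

lemma nth_deriv_primitive:
  assumes ab: "a < b" and f: "continuous_on {a..b} f" and x: "x \<in> {a..b}"
    and d: "differentiable_times {a..b} k f x"
  shows "differentiable_times {a..b} (Suc k) (primitive a f) x \<and>
    nth_deriv {a..b} (Suc k) (primitive a f) x = nth_deriv {a..b} k f x"
proof
  have 1: "nth_deriv {a..b} 1 (primitive a f) s = f s" if "s \<in> {a..b}" for s
    using nth_deriv_eqI[OF ab that, of 0] primitive_has_vector_derivative[OF f that] by simp
  show "nth_deriv {a..b} (Suc k) (primitive a f) x = nth_deriv {a..b} k f x"
    unfolding nth_deriv_Suc_shift by (rule nth_deriv_cong[OF 1 x])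
  show "differentiable_times {a..b} (Suc k) (primitive a f) x"
  proof (rule differentiable_times_shift[OF _ x])
    show "primitive a f differentiable (at s within {a..b})" if "s \<in> {a..b}" for s
      using primitive_has_vector_derivative[OF f that] by (rule differentiableI_vector)
    show "differentiable_times {a..b} k (nth_deriv {a..b} 1 (primitive a f)) x"
      by (rule differentiable_times_cong[OF _ x d]) (use 1 in auto)
  qed
qed

text \<open>Lifts terms that admit different numbers of derivatives at \<open>x\<close> to one
  common order, so that they can be differentiated as a single sum.\<close>

lemma nth_deriv_iterated_primitive:
  assumes ab: "a < b" and f: "continuous_on {a..b} f" and x: "x \<in> {a..b}"
    and d: "differentiable_times {a..b} k f x"
  shows "differentiable_times {a..b} (m + k) ((primitive a ^^ m) f) x \<and>
    nth_deriv {a..b} (m + k) ((primitive a ^^ m) f) x = nth_deriv {a..b} k f x"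
proof (induction m)
  case (Suc m)
  have "differentiable_times {a..b} (m + k) ((primitive a ^^ m) f) x" using Suc.IH by blast
  from nth_deriv_primitive[OF ab continuous_on_iterated_primitive[OF f] x this]
  show ?case using Suc.IH by (simp del: nth_deriv.simps differentiable_times.simps)
qed (use d in simp)

text \<open>The boundary term vanishes at \<open>a\<close> through the primitive and at
  \<open>b\<close> through the polynomial.\<close>

lemma integration_by_parts_primitive:
  fixes p :: "real poly"
  assumes ab: "a < b" and f: "continuous_on {a..b} f" and p: "poly p b = 0"
  shows "integral {a..b} (\<lambda>x. f x * poly p x) = - integral {a..b} (\<lambda>x. primitive a f x * poly (pderiv p) x)"
proof -
  have "((\<lambda>x. primitive a f x * poly (pderiv p) x + f x * poly p x) has_integral
    primitive a f b * poly p b - primitive a f a * poly p a) {a..b}"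
  proof (rule fundamental_theorem_of_calculus)
    fix x assume x: "x \<in> {a..b}"
    have "(poly p has_vector_derivative poly (pderiv p) x) (at x within {a..b})"
      using poly_DERIV[of p x]
      by (simp add: has_real_derivative_iff_has_vector_derivative has_vector_derivative_at_within)
    from has_vector_derivative_mult[OF primitive_has_vector_derivative[OF f x] this]
    show "((\<lambda>x. primitive a f x * poly p x) has_vector_derivative
      primitive a f x * poly (pderiv p) x + f x * poly p x) (at x within {a..b})" .
  qed (use ab in simp)
  then have "integral {a..b} (\<lambda>x. primitive a f x * poly (pderiv p) x + f x * poly p x) = 0"
    using p by (simp add: integral_unique primitive_def)
  moreover have "integral {a..b} (\<lambda>x. primitive a f x * poly (pderiv p) x + f x * poly p x) =
      integral {a..b} (\<lambda>x. primitive a f x * poly (pderiv p) x) + integral {a..b} (\<lambda>x. f x * poly p x)"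
    by (intro Henstock_Kurzweil_Integration.integral_add continuous_mult_integrable_on
        continuous_on_primitive f poly_continuous_on)
  ultimately show ?thesis by linarith
qed

lemma iterated_integration_by_parts:
  fixes \<eta> :: "real poly"
  assumes ab: "a < b" and f: "continuous_on {a..b} f" 
    and "\<And>j. k \<le> j \<Longrightarrow> j < k + m \<Longrightarrow> poly ((pderiv ^^ j) \<eta>) b = 0"
  shows "integral {a..b} (\<lambda>x. f x * poly ((pderiv ^^ k) \<eta>) x) =
    (-1) ^ m * integral {a..b} (\<lambda>x. (primitive a ^^ m) f x * poly ((pderiv ^^ (k + m)) \<eta>) x)"
  using assms(3)
proof (induction m)
  case (Suc m)
  have "integral {a..b} (\<lambda>x. f x * poly ((pderiv ^^ k) \<eta>) x) =
    (-1) ^ m * integral {a..b} (\<lambda>x. (primitive a ^^ m) f x * poly ((pderiv ^^ (k + m)) \<eta>) x)"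
    by (rule Suc.IH) (use Suc.prems in auto)
  also have "integral {a..b} (\<lambda>x. (primitive a ^^ m) f x * poly ((pderiv ^^ (k + m)) \<eta>) x) =
    - integral {a..b} (\<lambda>x. primitive a ((primitive a ^^ m) f) x * poly (pderiv ((pderiv ^^ (k + m)) \<eta>)) x)"
    by (rule integration_by_parts_primitive[OF ab continuous_on_iterated_primitive[OF f]]) (use Suc.prems in auto)
  finally show ?case by simp
qed simp

lemma pderiv_iterate_eq_0:
  fixes Q :: "real poly"
  assumes "\<forall>i\<ge>n. coeff Q i = 0"
  shows "(pderiv ^^ n) Q = 0"
  using assms
proof (induction n arbitrary: Q)
  case 0
  then show ?case by (simp add: poly_eq_iff)
next
  case (Suc n)
  have "\<forall>i\<ge>n. coeff (pderiv Q) i = 0" using Suc.prems by (auto simp: coeff_pderiv)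
  then have "(pderiv ^^ n) (pderiv Q) = 0" by (rule Suc.IH)
  then show ?case by (simp add: funpow_swap1)
qed

text \<open>The integral identity involves continuous functions only and identifies \<open>H\<close>
  with a polynomial on the whole interval. Differentiability of the \<open>G i\<close> is assumed at
  the given \<open>x\<close> alone, in the sense of \<open>differentiable_times\<close>, and there
  the \<open>n\<close>-th derivative of \<open>H\<close> is computed term by term.\<close>

lemma euler_lagrange_pointwise:
  fixes P :: "real \<Rightarrow> real" and G :: "'i \<Rightarrow> real \<Rightarrow> real" and \<kappa> :: "'i \<Rightarrow> nat"
  assumes ab: "a < b" and P: "continuous_on {a..b} P" and I: "finite I"
    and \<kappa>: "\<And>i. i \<in> I \<Longrightarrow> \<kappa> i \<le> n" and G: "\<And>i. i \<in> I \<Longrightarrow> continuous_on {a..b} (G i)"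
    and var: "\<And>\<eta> :: real poly. \<forall>j<n. poly ((pderiv ^^ j) \<eta>) a = 0 \<and> poly ((pderiv ^^ j) \<eta>) b = 0 \<Longrightarrow>
      integral {a..b} (\<lambda>x. P x * poly \<eta> x + (\<Sum>i\<in>I. G i x * poly ((pderiv ^^ \<kappa> i) \<eta>) x)) = 0"
    and x: "x \<in> {a..b}" and d: "\<And>i. i \<in> I \<Longrightarrow> differentiable_times {a..b} (\<kappa> i) (G i) x"
  shows "P x + (\<Sum>i\<in>I. (-1) ^ \<kappa> i * nth_deriv {a..b} (\<kappa> i) (G i) x) = 0"
proof -
  define H1 where "H1 s = (\<Sum>i\<in>I. (-1) ^ (n - \<kappa> i) * (primitive a ^^ (n - \<kappa> i)) (G i) s)" for s
  define H where "H s = H1 s + (-1) ^ n * (primitive a ^^ n) P s" for s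
  have cP: "continuous_on {a..b} ((primitive a ^^ n) P)" by (rule continuous_on_iterated_primitive[OF P])
  have cG: "continuous_on {a..b} ((primitive a ^^ m) (G i))" if "i \<in> I" for i m
    by (rule continuous_on_iterated_primitive[OF G[OF that]])
  have H1: "continuous_on {a..b} H1" unfolding H1_def by (intro continuous_intros cG)
  have H: "continuous_on {a..b} H" unfolding H_def by (intro continuous_intros H1 cP)
  have HJ: "integral {a..b} (\<lambda>s. H s * poly ((pderiv ^^ n) \<eta>) s) = 0"
    if \<eta>: "\<forall>j<n. poly ((pderiv ^^ j) \<eta>) a = 0 \<and> poly ((pderiv ^^ j) \<eta>) b = 0" for \<eta>
  proof -
    let ?p = "\<lambda>k. poly ((pderiv ^^ k) \<eta>)"
    have int: "(\<lambda>s. f s * ?p k s) integrable_on {a..b}" if "continuous_on {a..b} f" for f k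
      by (intro continuous_mult_integrable_on that poly_continuous_on)
    have "integral {a..b} (\<lambda>s. H s * ?p n s) =
      integral {a..b} (\<lambda>s. (\<Sum>i\<in>I. (-1) ^ (n - \<kappa> i) * ((primitive a ^^ (n - \<kappa> i)) (G i) s * ?p n s)) +
        (-1) ^ n * ((primitive a ^^ n) P s * ?p n s))"
      by (intro integral_cong) (simp add: H_def H1_def distrib_right sum_distrib_right mult.assoc)
    also have "\<dots> = (\<Sum>i\<in>I. (-1) ^ (n - \<kappa> i) * integral {a..b} (\<lambda>s. (primitive a ^^ (n - \<kappa> i)) (G i) s * ?p n s)) +
        (-1) ^ n * integral {a..b} (\<lambda>s. (primitive a ^^ n) P s * ?p n s)"
      using I int[OF cP] int[OF cG]
      by (simp add: Henstock_Kurzweil_Integration.integral_add integral_sum integrable_sum)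
    also have "(\<Sum>i\<in>I. (-1) ^ (n - \<kappa> i) * integral {a..b} (\<lambda>s. (primitive a ^^ (n - \<kappa> i)) (G i) s * ?p n s)) =
        (\<Sum>i\<in>I. integral {a..b} (\<lambda>s. G i s * ?p (\<kappa> i) s))"
    proof (rule sum.cong[OF refl])
      fix i assume i: "i \<in> I"
      show "(-1) ^ (n - \<kappa> i) * integral {a..b} (\<lambda>s. (primitive a ^^ (n - \<kappa> i)) (G i) s * ?p n s) =
        integral {a..b} (\<lambda>s. G i s * ?p (\<kappa> i) s)"
        using iterated_integration_by_parts[OF ab G[OF i], of "\<kappa> i" "n - \<kappa> i" \<eta>] \<eta> \<kappa>[OF i] by simp
    qed
    also have "(-1) ^ n * integral {a..b} (\<lambda>s. (primitive a ^^ n) P s * ?p n s) = integral {a..b} (\<lambda>s. P s * poly \<eta> s)"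
      using iterated_integration_by_parts[OF ab P, of 0 n \<eta>] \<eta> by simp
    also have "(\<Sum>i\<in>I. integral {a..b} (\<lambda>s. G i s * ?p (\<kappa> i) s)) + integral {a..b} (\<lambda>s. P s * poly \<eta> s) =
      integral {a..b} (\<lambda>s. P s * poly \<eta> s + (\<Sum>i\<in>I. G i s * ?p (\<kappa> i) s))"
      using I int[OF P, of 0] int[OF G]
      by (simp add: Henstock_Kurzweil_Integration.integral_add integral_sum integrable_sum)
    finally show ?thesis using var[OF \<eta>] by simp
  qed
  obtain Q where Q: "\<forall>i\<ge>n. coeff Q i = 0" "\<forall>s\<in>{a..b}. H s = poly Q s"
    by (rule du_Bois_Reymond_higher[OF ab H HJ])
  have "nth_deriv {a..b} n H x = nth_deriv {a..b} n (poly Q) x"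
    by (rule nth_deriv_cong[OF _ x]) (use Q(2) in auto)
  also have "\<dots> = 0"
    using nth_deriv_poly[OF ab x] pderiv_iterate_eq_0[OF Q(1)] by simp
  finally have 0: "nth_deriv {a..b} n H x = 0" .
  have dG: "differentiable_times {a..b} n ((primitive a ^^ (n - \<kappa> i)) (G i)) x \<and>
      nth_deriv {a..b} n ((primitive a ^^ (n - \<kappa> i)) (G i)) x = nth_deriv {a..b} (\<kappa> i) (G i) x" if "i \<in> I" for i
    using nth_deriv_iterated_primitive[OF ab G[OF that] x d[OF that], of "n - \<kappa> i"] \<kappa>[OF that] by simp
  have dP: "differentiable_times {a..b} n ((primitive a ^^ n) P) x \<and>
      nth_deriv {a..b} n ((primitive a ^^ n) P) x = P x"
    using nth_deriv_iterated_primitive[OF ab P x, of 0 n] by simp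
  have dH1: "differentiable_times {a..b} n H1 x \<and>
     nth_deriv {a..b} n H1 x = (\<Sum>i\<in>I. (-1) ^ (n - \<kappa> i) * nth_deriv {a..b} (\<kappa> i) (G i) x)"
    unfolding H1_def using nth_deriv_sum[OF ab x I, of n "\<lambda>i. (primitive a ^^ (n - \<kappa> i)) (G i)" "\<lambda>i. (-1) ^ (n - \<kappa> i)"] dG
    by simp
  have "nth_deriv {a..b} n H x = (\<Sum>i\<in>I. (-1) ^ (n - \<kappa> i) * nth_deriv {a..b} (\<kappa> i) (G i) x) + (-1) ^ n * P x"
    unfolding H_def using nth_deriv_linear[OF ab x, of n H1 "(primitive a ^^ n) P" "(-1) ^ n"] dH1 dP by simp
  \<comment> \<open>Multiplying by \<open>(-1) ^ n\<close> turns the sign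
    \<open>(-1) ^ (n - \<kappa> i)\<close> into \<open>(-1) ^ \<kappa> i\<close>, the sign of the
    right derivative, and removes the one in front of \<open>P x\<close>.\<close>
  then have "(-1) ^ n * ((\<Sum>i\<in>I. (-1) ^ (n - \<kappa> i) * nth_deriv {a..b} (\<kappa> i) (G i) x) + (-1) ^ n * P x) = 0"
    using 0 by simp
  moreover have "(-1) ^ n * ((-1) ^ (n - \<kappa> i) * r) = (-1) ^ \<kappa> i * r" if "i \<in> I" for i and r :: real
  proof -
    have "(-1) ^ n = (-1::real) ^ (n - \<kappa> i) * (-1) ^ \<kappa> i" using \<kappa>[OF that] by (simp add: power_add[symmetric])
    moreover have "(-1::real) ^ m * (-1) ^ m = 1" for m by (simp add: power_mult_distrib[symmetric])
    ultimately show ?thesis by (metis mult.assoc mult.commute mult.right_neutral)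
  qed
  moreover have "(-1) ^ n * ((-1) ^ n * P x) = P x"
    by (simp add: mult.assoc[symmetric] power_mult_distrib[symmetric])
  ultimately show ?thesis by (simp add: distrib_left sum_distrib_left)
qed

subsection \<open>Admissible variations\<close>

lemma absolutely_continuous_on_cong:
  assumes "absolutely_continuous_on a b f" "\<And>x. x \<in> {a..b} \<Longrightarrow> g x = f x"
  shows "absolutely_continuous_on a b g"
proof -
  have eq: "(\<Sum>K\<in>d. \<bar>g (Sup K) - g (Inf K)\<bar>) = (\<Sum>K\<in>d. \<bar>f (Sup K) - f (Inf K)\<bar>)"
    if "d division_of T" "T \<subseteq> {a..b}" for d T
  proof (rule sum.cong[OF refl])
    fix K assume "K \<in> d"
    with that(1) obtain u v where K: "K = {u..v}" "u \<le> v" "K \<subseteq> T" "Sup K = v" "Inf K = u"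
      by (rule division_interval_cases)
    then have "u \<in> K" "v \<in> K" by auto
    then have "u \<in> {a..b}" "v \<in> {a..b}" using K(3) that(2) by blast+
    then show "\<bar>g (Sup K) - g (Inf K)\<bar> = \<bar>f (Sup K) - f (Inf K)\<bar>" using K(4,5) assms(2) by simp
  qed
  show ?thesis
    unfolding absolutely_continuous_on_def
  proof (intro allI impI)
    fix \<epsilon> :: real assume "\<epsilon> > 0"
    obtain \<delta> where \<delta>: "\<delta> > 0" "\<And>d T. d division_of T \<Longrightarrow> T \<subseteq> {a..b} \<Longrightarrow> (\<Sum>K\<in>d. Sup K - Inf K) < \<delta>
        \<Longrightarrow> (\<Sum>K\<in>d. \<bar>f (Sup K) - f (Inf K)\<bar>) < \<epsilon>"
      by (rule absolutely_continuous_onE[OF assms(1) \<open>\<epsilon> > 0\<close>]) (rule that)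
    show "\<exists>\<delta>>0. \<forall>d T. d division_of T \<and> T \<subseteq> {a..b} \<and> (\<Sum>K\<in>d. Sup K - Inf K) < \<delta>
        \<longrightarrow> (\<Sum>K\<in>d. \<bar>g (Sup K) - g (Inf K)\<bar>) < \<epsilon>"
      using \<delta> eq by (intro exI[of _ \<delta>]) force
  qed
qed

lemma poly_Lipschitz_on_interval:
  fixes p :: "real poly"
  obtains C where "0 \<le> C" "\<And>x y. a \<le> x \<Longrightarrow> x \<le> y \<Longrightarrow> y \<le> b \<Longrightarrow> \<bar>poly p y - poly p x\<bar> \<le> C * (y - x)"
proof -
  have "bounded (poly (pderiv p) ` {a..b})"
    by (intro compact_imp_bounded compact_continuous_image poly_continuous_on compact_Icc)
  then obtain C where C: "0 < C" "\<And>x. x \<in> {a..b} \<Longrightarrow> \<bar>poly (pderiv p) x\<bar> \<le> C"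
    unfolding bounded_pos by auto
  have "\<bar>poly p y - poly p x\<bar> \<le> C * (y - x)" if xy: "a \<le> x" "x \<le> y" "y \<le> b" for x y
  proof (cases "x = y")
    case False
    then obtain z where z: "x < z" "z < y" "poly p y - poly p x = (y - x) * poly (pderiv p) z"
      using poly_MVT[of x y p] xy by auto
    have "\<bar>poly p y - poly p x\<bar> = \<bar>poly (pderiv p) z\<bar> * (y - x)" using z xy by (simp add: abs_mult)
    also have "\<dots> \<le> C * (y - x)" using C(2)[of z] z xy by (intro mult_right_mono) auto
    finally show ?thesis .
  qed simp
  then show thesis using that[of C] C(1) by auto
qed

text \<open>One differentiation of a variation, isolated because it is used in two ways: at every
  point for orders below \<open>n\<close>, and for order \<open>n\<close> only where the derivative
  of order \<open>n - 1\<close> is differentiable.\<close>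

lemma nth_deriv_step:
  fixes y :: "real \<Rightarrow> real"
  assumes ab: "a < b" and x: "x \<in> {a..b}"
    and eq: "\<And>s. s \<in> {a..b} \<Longrightarrow> nth_deriv {a..b} k u s = nth_deriv {a..b} k y s + h * poly ((pderiv ^^ k) \<eta>) s"
    and d: "nth_deriv {a..b} k y differentiable (at x within {a..b})"
  shows "nth_deriv {a..b} (Suc k) u x = nth_deriv {a..b} (Suc k) y x + h * poly ((pderiv ^^ Suc k) \<eta>) x"
    and "nth_deriv {a..b} k u differentiable (at x within {a..b})"
proof -
  have 1: "(nth_deriv {a..b} k y has_vector_derivative nth_deriv {a..b} (Suc k) y x) (at x within {a..b})"
    using d by (simp add: vector_derivative_works)
  have 2: "(poly ((pderiv ^^ k) \<eta>) has_vector_derivative poly ((pderiv ^^ Suc k) \<eta>) x) (at x within {a..b})"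
    using poly_DERIV[of "(pderiv ^^ k) \<eta>" x]
    by (simp add: has_real_derivative_iff_has_vector_derivative has_vector_derivative_at_within)
  have "((\<lambda>s. nth_deriv {a..b} k y s + h * poly ((pderiv ^^ k) \<eta>) s) has_vector_derivative
    nth_deriv {a..b} (Suc k) y x + h * poly ((pderiv ^^ Suc k) \<eta>) x) (at x within {a..b})"
    by (intro has_vector_derivative_add has_vector_derivative_mult_right 1 2)
  then have 3: "(nth_deriv {a..b} k u has_vector_derivative
    nth_deriv {a..b} (Suc k) y x + h * poly ((pderiv ^^ Suc k) \<eta>) x) (at x within {a..b})"
    by (rule has_vector_derivative_transform[OF x, rotated]) (use eq in auto)
  then show "nth_deriv {a..b} (Suc k) u x = nth_deriv {a..b} (Suc k) y x + h * poly ((pderiv ^^ Suc k) \<eta>) x"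
    by (rule nth_deriv_eqI[OF ab x])
  show "nth_deriv {a..b} k u differentiable (at x within {a..b})" using 3 by (rule differentiableI_vector)
qed

lemma nth_deriv_variation:
  fixes y :: "real \<Rightarrow> real"
  assumes ab: "a < b" and y: "y \<in> AC_space n a b" and "k < n" "x \<in> {a..b}"
  shows "nth_deriv {a..b} k (\<lambda>s. y s + h * poly \<eta> s) x = nth_deriv {a..b} k y x + h * poly ((pderiv ^^ k) \<eta>) x"
  using assms(3,4)
proof (induction k arbitrary: x)
  case (Suc k)
  show ?case
  proof (rule nth_deriv_step(1)[OF ab Suc.prems(2)])
    show "nth_deriv {a..b} k y differentiable (at x within {a..b})"
      using y Suc.prems unfolding AC_space_def by blast
  qed (use Suc in auto)
qed simp

text \<open>For \<open>k = n\<close> the value of \<^const>\<open>nth_deriv\<close> is junk where the derivative of order \<open>n - 1\<close> is not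
  differentiable.\<close>

lemma nth_deriv_variation_ae:
  fixes y :: "real \<Rightarrow> real"
  assumes ab: "a < b" and y: "y \<in> AC_space n a b" and k: "k \<in> {1..n}"
  shows "negligible {x \<in> {a..b}. nth_deriv {a..b} k (\<lambda>s. y s + h * poly \<eta> s) x \<noteq>
    nth_deriv {a..b} k y x + h * poly ((pderiv ^^ k) \<eta>) x}" (is "negligible ?N")
proof (cases "k < n")
  case True
  then have "?N = {}" using nth_deriv_variation[OF ab y True] by blast
  then show ?thesis by (simp only: negligible_empty)
next
  case False
  then have n: "k = Suc (n - 1)" "n - 1 < n" using k by auto
  have "absolutely_continuous_on a b (nth_deriv {a..b} (n - 1) y)" using y unfolding AC_space_def by blast
  then have "negligible {x \<in> {a..b}. \<not> nth_deriv {a..b} (n - 1) y differentiable (at x within {a..b})}"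
    by (rule absolutely_continuous_on_differentiable_ae)
  moreover have "?N \<subseteq> {x \<in> {a..b}. \<not> nth_deriv {a..b} (n - 1) y differentiable (at x within {a..b})}"
    using nth_deriv_step(1)[OF ab _ nth_deriv_variation[OF ab y n(2)]] n(1) by fastforce
  ultimately show ?thesis by (rule negligible_subset)
qed

lemma AC_space_variation:
  fixes y :: "real \<Rightarrow> real"
  assumes ab: "a < b" and y: "y \<in> AC_space n a b" and n: "0 < n"
  shows "(\<lambda>s. y s + h * poly \<eta> s) \<in> AC_space n a b"
proof -
  let ?u = "\<lambda>s. y s + h * poly \<eta> s"
  have 1: "nth_deriv {a..b} j ?u differentiable (at x within {a..b})" if "Suc j < n" "x \<in> {a..b}" for j x
  proof (rule nth_deriv_step(2)[OF ab that(2) nth_deriv_variation[OF ab y]])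
    show "nth_deriv {a..b} j y differentiable (at x within {a..b})"
      using y that unfolding AC_space_def by blast
  qed (use that in auto)
  have 2: "continuous_on {a..b} (nth_deriv {a..b} j ?u)" if "j < n" for j
  proof (rule continuous_on_eq)
    have "continuous_on {a..b} (nth_deriv {a..b} j y)" using y that unfolding AC_space_def by blast
    then show "continuous_on {a..b} (\<lambda>s. nth_deriv {a..b} j y s + h * poly ((pderiv ^^ j) \<eta>) s)"
      by (intro continuous_intros)
  qed (use nth_deriv_variation[OF ab y that] in auto)
  obtain C where C: "0 \<le> C" "\<And>s t. a \<le> s \<Longrightarrow> s \<le> t \<Longrightarrow> t \<le> b \<Longrightarrow>
      \<bar>poly (smult h ((pderiv ^^ (n - 1)) \<eta>)) t - poly (smult h ((pderiv ^^ (n - 1)) \<eta>)) s\<bar> \<le> C * (t - s)"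
    by (rule poly_Lipschitz_on_interval[of a b "smult h ((pderiv ^^ (n - 1)) \<eta>)"]) (rule that)
  have "absolutely_continuous_on a b (nth_deriv {a..b} (n - 1) y)" using y unfolding AC_space_def by blast
  from absolutely_continuous_on_add_Lipschitz[OF this C(2) C(1)]
  have "absolutely_continuous_on a b (nth_deriv {a..b} (n - 1) ?u)"
    by (rule absolutely_continuous_on_cong) (use nth_deriv_variation[OF ab y] n in auto)
  then show ?thesis using 1 2 unfolding AC_space_def by blast
qed

text \<open>The affine relation may fail on a null set, which does not affect the integrals; in this
  way the arbitrary values of the derivative of order \<open>n\<close> drop out of the Caputo
  derivative.\<close>

lemma frac_left_variation:
  fixes f g p :: "real \<Rightarrow> real"
  assumes \<gamma>: "0 < \<gamma>" and x: "x \<in> {a..b}" and p: "continuous_on {a..b} p"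
    and neg: "negligible {t \<in> {a..b}. f t \<noteq> g t + h * p t}"
    and g: "(\<lambda>t. (x - t) powr (\<gamma> - 1) * g t) absolutely_integrable_on {a..x}"
  shows "(\<lambda>t. (x - t) powr (\<gamma> - 1) * f t) absolutely_integrable_on {a..x}"
    and "integral {a..x} (\<lambda>t. (x - t) powr (\<gamma> - 1) * f t) = integral {a..x} (\<lambda>t. (x - t) powr (\<gamma> - 1) * g t)
      + h * integral {a..x} (\<lambda>t. (x - t) powr (\<gamma> - 1) * p t)"
proof -
  let ?k = "\<lambda>t. (x - t) powr (\<gamma> - 1)"
  let ?N = "{t \<in> {a..b}. f t \<noteq> g t + h * p t}"
  have p': "(\<lambda>t. ?k t * p t) absolutely_integrable_on {a..x}"
    by (rule absolutely_integrable_frac_left[OF \<gamma> p x])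
  then have hp: "(\<lambda>t. h * (?k t * p t)) absolutely_integrable_on {a..x}"
    by (rule set_integrable_mult_right)
  have eq: "?k t * f t = ?k t * g t + h * (?k t * p t)" if "t \<in> {a..x} - ?N" for t
    using that x by (auto simp: algebra_simps)
  show "(\<lambda>t. ?k t * f t) absolutely_integrable_on {a..x}"
    by (rule absolutely_integrable_spike[OF set_integral_add(1)[OF g hp] neg eq])
  have "integral {a..x} (\<lambda>t. ?k t * f t) = integral {a..x} (\<lambda>t. ?k t * g t + h * (?k t * p t))"
    by (rule integral_spike[OF neg]) (use eq in auto)
  also have "\<dots> = integral {a..x} (\<lambda>t. ?k t * g t) + integral {a..x} (\<lambda>t. h * (?k t * p t))"
    using set_lebesgue_integral_eq_integral(1)[OF g] set_lebesgue_integral_eq_integral(1)[OF hp]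
    by (rule Henstock_Kurzweil_Integration.integral_add)
  finally show "integral {a..x} (\<lambda>t. ?k t * f t) = integral {a..x} (\<lambda>t. ?k t * g t) + h * integral {a..x} (\<lambda>t. ?k t * p t)"
    by simp
qed

text \<open>The Caputo derivative of a polynomial, written as a fractional integral of its formal
  derivative, so that continuity and fractional integration by parts apply directly.\<close>

definition caputo_poly :: "real \<Rightarrow> nat \<Rightarrow> real \<Rightarrow> real poly \<Rightarrow> real \<Rightarrow> real" where
  "caputo_poly a k \<gamma> \<eta> = rl_integral_left a (real k - \<gamma>) (poly ((pderiv ^^ k) \<eta>))"

lemma continuous_on_rl_integral_left:
  assumes "0 < \<gamma>" "continuous_on {a..b} g"
  shows "continuous_on {a..b} (rl_integral_left a \<gamma> g)"
  unfolding rl_integral_left_def[abs_def]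
  by (intro continuous_intros continuous_on_frac_left assms)

lemma caputo_left_variation:
  fixes y :: "real \<Rightarrow> real"
  assumes ab: "a < b" and y: "y \<in> AC_space n a b" and k: "k \<in> {1..n}" and \<gamma>: "\<gamma> < real k"
    and x: "x \<in> {a..b}"
    and int: "(\<lambda>t. (x - t) powr (real k - \<gamma> - 1) * nth_deriv {a..b} k y t) absolutely_integrable_on {a..x}"
  shows "(\<lambda>t. (x - t) powr (real k - \<gamma> - 1) * nth_deriv {a..b} k (\<lambda>s. y s + h * poly \<eta> s) t)
      absolutely_integrable_on {a..x}"
    and "caputo_left a b k \<gamma> (\<lambda>s. y s + h * poly \<eta> s) x = caputo_left a b k \<gamma> y x + h * caputo_poly a k \<gamma> \<eta> x"
proof -
  have "0 < real k - \<gamma>" using \<gamma> by simp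
  note * = frac_left_variation[OF this x poly_continuous_on nth_deriv_variation_ae[OF ab y k] int]
  show "(\<lambda>t. (x - t) powr (real k - \<gamma> - 1) * nth_deriv {a..b} k (\<lambda>s. y s + h * poly \<eta> s) t)
      absolutely_integrable_on {a..x}" by (rule *(1))
  show "caputo_left a b k \<gamma> (\<lambda>s. y s + h * poly \<eta> s) x = caputo_left a b k \<gamma> y x + h * caputo_poly a k \<gamma> \<eta> x"
    unfolding caputo_left_def caputo_poly_def rl_integral_left_def *(2) by (simp add: distrib_left)
qed

lemma rl_integral_left_variation:
  fixes y :: "real \<Rightarrow> real"
  assumes "0 < \<beta>" "x \<in> {a..b}" "(\<lambda>t. (x - t) powr (\<beta> - 1) * y t) absolutely_integrable_on {a..x}"
  shows "(\<lambda>t. (x - t) powr (\<beta> - 1) * (y t + h * poly \<eta> t)) absolutely_integrable_on {a..x}"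
    and "rl_integral_left a \<beta> (\<lambda>s. y s + h * poly \<eta> s) x = rl_integral_left a \<beta> y x + h * rl_integral_left a \<beta> (poly \<eta>) x"
proof -
  have "negligible {t \<in> {a..b}. y t + h * poly \<eta> t \<noteq> y t + h * poly \<eta> t}" by simp
  note * = frac_left_variation[OF assms(1,2) poly_continuous_on this assms(3)]
  show "(\<lambda>t. (x - t) powr (\<beta> - 1) * (y t + h * poly \<eta> t)) absolutely_integrable_on {a..x}" by (rule *(1))
  show "rl_integral_left a \<beta> (\<lambda>s. y s + h * poly \<eta> s) x = rl_integral_left a \<beta> y x + h * rl_integral_left a \<beta> (poly \<eta>) x"
    unfolding rl_integral_left_def *(2) by (simp add: distrib_left)
qed

lemma admissible_variation:
  fixes y :: "real \<Rightarrow> real"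
  assumes ab: "a < b" and n: "0 < n" and \<beta>: "0 < \<beta>" and \<alpha>: "\<And>k. k \<in> {1..n} \<Longrightarrow> \<alpha> k < real k"
    and y: "y \<in> admissible n a b \<alpha> \<beta> ya yb"
    and \<eta>: "\<forall>j<n. poly ((pderiv ^^ j) \<eta>) a = 0 \<and> poly ((pderiv ^^ j) \<eta>) b = 0"
  shows "(\<lambda>s. y s + h * poly \<eta> s) \<in> admissible n a b \<alpha> \<beta> ya yb"
    and "\<And>k x. k \<in> {1..n} \<Longrightarrow> x \<in> {a..b} \<Longrightarrow> caputo_left a b k (\<alpha> k) (\<lambda>s. y s + h * poly \<eta> s) x =
      caputo_left a b k (\<alpha> k) y x + h * caputo_poly a k (\<alpha> k) \<eta> x"
    and "\<And>x. x \<in> {a..b} \<Longrightarrow> rl_integral_left a \<beta> (\<lambda>s. y s + h * poly \<eta> s) x =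
      rl_integral_left a \<beta> y x + h * rl_integral_left a \<beta> (poly \<eta>) x"
proof -
  let ?u = "\<lambda>s. y s + h * poly \<eta> s"
  have yAC: "y \<in> AC_space n a b" and yint: "\<And>k x. k \<in> {1..n} \<Longrightarrow> x \<in> {a..b} \<Longrightarrow>
      (\<lambda>t. (x - t) powr (real k - \<alpha> k - 1) * nth_deriv {a..b} k y t) absolutely_integrable_on {a..x}"
    and ycont: "\<And>k. k \<in> {1..n} \<Longrightarrow> continuous_on {a..b} (caputo_left a b k (\<alpha> k) y)"
    and yint': "\<And>x. x \<in> {a..b} \<Longrightarrow> (\<lambda>t. (x - t) powr (\<beta> - 1) * y t) absolutely_integrable_on {a..x}"
    and ycont': "continuous_on {a..b} (rl_integral_left a \<beta> y)"
    and ybd: "\<forall>k<n. nth_deriv {a..b} k y a = ya k \<and> nth_deriv {a..b} k y b = yb k"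
    using y unfolding admissible_def frac_class_def by blast+
  note cap = caputo_left_variation[OF ab yAC _ \<alpha> _ yint]
  note rl = rl_integral_left_variation[OF \<beta> _ yint']
  show c: "caputo_left a b k (\<alpha> k) ?u x = caputo_left a b k (\<alpha> k) y x + h * caputo_poly a k (\<alpha> k) \<eta> x"
    if "k \<in> {1..n}" "x \<in> {a..b}" for k x
    using cap(2)[of k x] that by blast
  show r: "rl_integral_left a \<beta> ?u x = rl_integral_left a \<beta> y x + h * rl_integral_left a \<beta> (poly \<eta>) x"
    if "x \<in> {a..b}" for x
    using rl(2)[of x] that by blast
  have "continuous_on {a..b} (caputo_left a b k (\<alpha> k) ?u)" if k: "k \<in> {1..n}" for k
  proof (rule continuous_on_eq)
    have "0 < real k - \<alpha> k" using \<alpha>[OF k] by simp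
    then show "continuous_on {a..b} (\<lambda>x. caputo_left a b k (\<alpha> k) y x + h * caputo_poly a k (\<alpha> k) \<eta> x)"
      unfolding caputo_poly_def
      by (intro continuous_on_add continuous_on_mult continuous_on_const ycont k continuous_on_rl_integral_left poly_continuous_on)
  qed (use c[OF k] in auto)
  moreover have "continuous_on {a..b} (rl_integral_left a \<beta> ?u)"
  proof (rule continuous_on_eq)
    show "continuous_on {a..b} (\<lambda>x. rl_integral_left a \<beta> y x + h * rl_integral_left a \<beta> (poly \<eta>) x)"
      by (intro continuous_on_add continuous_on_mult continuous_on_const ycont' continuous_on_rl_integral_left poly_continuous_on \<beta>)
  qed (use r in auto)
  moreover have "?u \<in> AC_space n a b" by (rule AC_space_variation[OF ab yAC n])
  ultimately have "?u \<in> frac_class n a b \<alpha> \<beta>"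
    unfolding frac_class_def using cap(1) rl(1) by blast
  moreover have "nth_deriv {a..b} k ?u a = ya k \<and> nth_deriv {a..b} k ?u b = yb k" if "k < n" for k
    using nth_deriv_variation[OF ab yAC that, of _ h \<eta>] ab ybd \<eta> that by auto
  ultimately show "?u \<in> admissible n a b \<alpha> \<beta> ya yb"
    unfolding admissible_def by blast
qed

subsection \<open>The first variation\<close>

lemma integral_swap_primitive:
  fixes q g :: "real \<Rightarrow> real"
  assumes q: "continuous_on {a..b} q" and g: "continuous_on {a..b} g"
  shows "integral {a..b} (\<lambda>x. q x * integral {a..x} g) = integral {a..b} (\<lambda>t. integral {t..b} q * g t)"
proof -
  \<comment> \<open>The ordinary primitive is the fractional integral of order 1, except that
    \<open>0 powr 0\<close> is 0; the integrands differ at the single point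
    \<open>x\<close>.\<close>
  have "integral {a..x} (\<lambda>t. (x - t) powr (1 - 1) * g t) = integral {a..x} g" for x
    by (rule integral_spike[of "{x}"]) auto
  moreover have "integral {t..b} (\<lambda>x. (x - t) powr (1 - 1) * q x) = integral {t..b} q" for t
    by (rule integral_spike[of "{t}"]) auto
  ultimately show ?thesis using frac_integral_swap[OF zero_less_one q g] by simp
qed

lemma integral_rescaled:
  fixes f :: "real \<Rightarrow> real"
  assumes "continuous_on {a..b} f" "x \<in> {a..b}"
  shows "integral {a..x} f = (x - a) * integral {0..1} (\<lambda>r. f (x - (x - a) * r))"
proof -
  have "integral {a..x} (\<lambda>t. (x - t) powr (1 - 1) * f t) = integral {a..x} f"
    by (rule integral_spike[of "{x}"]) auto
  moreover have "integral {0..1} (\<lambda>r. r powr (1 - 1) * f (x - (x - a) * r)) = integral {0..1} (\<lambda>r. f (x - (x - a) * r))"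
    by (rule integral_spike[of "{0}"]) auto
  ultimately show ?thesis using frac_left_rescaled[OF zero_less_one assms] assms(2) by simp
qed

text \<open>Rescaling to the unit interval removes the moving upper limit, and joint continuity in
  \<open>h\<close> and \<open>x\<close> becomes that of an integral with parameters.\<close>

lemma continuous_on_parametric_primitive:
  fixes f :: "real \<Rightarrow> real \<Rightarrow> real"
  assumes f: "continuous_on (UNIV \<times> {a..b}) (\<lambda>(h, t). f h t)"
  shows "continuous_on (UNIV \<times> {a..b}) (\<lambda>(h, x). integral {a..x} (f h))"
proof -
  have fh: "continuous_on {a..b} (f h)" for h
  proof -
    have "continuous_on {a..b} (\<lambda>t. case (h, t) of (h, t) \<Rightarrow> f h t)"
      by (rule continuous_on_compose2[OF f]) (auto intro!: continuous_intros)
    then show ?thesis by simp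
  qed
  have "continuous_on (UNIV \<times> {a..b}) (\<lambda>p. integral (cbox 0 1) (\<lambda>r. f (fst p) (snd p - (snd p - a) * r)))"
  proof (rule integral_continuous_on_param)
    have "x - (x - a) * r \<in> {a..b}" if "x \<in> {a..b}" "r \<in> {0..1}" for x r
    proof -
      have "0 \<le> (x - a) * r" "(x - a) * r \<le> (x - a) * 1"
        using that by (intro mult_nonneg_nonneg mult_left_mono; simp)+
      then show ?thesis using that by auto
    qed
    then have "continuous_on ((UNIV \<times> {a..b}) \<times> cbox 0 1)
        (\<lambda>z. case (fst (fst z), snd (fst z) - (snd (fst z) - a) * snd z) of (h, t) \<Rightarrow> f h t)"
      by (intro continuous_on_compose2[OF f]) (auto intro!: continuous_intros)
    then show "continuous_on ((UNIV \<times> {a..b}) \<times> cbox 0 1) (\<lambda>(p, r). f (fst p) (snd p - (snd p - a) * r))"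
      by (simp add: case_prod_beta)
  qed
  then have "continuous_on (UNIV \<times> {a..b}) (\<lambda>p. (snd p - a) * integral {0..1} (\<lambda>r. f (fst p) (snd p - (snd p - a) * r)))"
    by (intro continuous_intros) (auto simp: cbox_interval)
  then show ?thesis
    by (rule continuous_on_eq) (auto simp: integral_rescaled[OF fh])
qed

text \<open>Stated for an abstract family of curves because it is applied twice: to
  \<open>l\<close>, and then to \<open>L\<close> along curves whose last component is the integral
  of \<open>l\<close> differentiated in the first application. The two continuity claims prepare for
  the second.\<close>

lemma C1_curve_integral:
  fixes F :: "'a::real_normed_vector \<Rightarrow> real" and F' :: "'a \<Rightarrow> 'a \<Rightarrow>\<^sub>L real" and G Gh :: "real \<Rightarrow> real \<Rightarrow> 'a"
  assumes dF: "\<And>p. p \<in> S \<Longrightarrow> (F has_derivative blinfun_apply (F' p)) (at p within S)"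
    and cF: "continuous_on S F'"
    and GS: "\<And>h x. x \<in> {a..b} \<Longrightarrow> G h x \<in> S"
    and cG: "continuous_on (UNIV \<times> {a..b}) (\<lambda>(h, x). G h x)"
    and cGh: "continuous_on (UNIV \<times> {a..b}) (\<lambda>(h, x). Gh h x)"
    and dG: "\<And>h x. x \<in> {a..b} \<Longrightarrow> ((\<lambda>h. G h x) has_vector_derivative Gh h x) (at h)"
  shows "continuous_on (UNIV \<times> {a..b}) (\<lambda>(h, x). F (G h x))"
    and "continuous_on (UNIV \<times> {a..b}) (\<lambda>(h, x). blinfun_apply (F' (G h x)) (Gh h x))"
    and "\<And>h x. x \<in> {a..b} \<Longrightarrow> ((\<lambda>h. integral {a..x} (\<lambda>t. F (G h t))) has_vector_derivative
      integral {a..x} (\<lambda>t. blinfun_apply (F' (G h t)) (Gh h t))) (at h)"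
proof -
  have F: "continuous_on S F" using dF by (rule has_derivative_continuous_on)
  have cG': "continuous_on (UNIV \<times> {a..b}) (\<lambda>p. G (fst p) (snd p))"
    "continuous_on (UNIV \<times> {a..b}) (\<lambda>p. Gh (fst p) (snd p))"
    using cG cGh by (simp_all add: case_prod_beta)
  show 1: "continuous_on (UNIV \<times> {a..b}) (\<lambda>(h, x). F (G h x))"
    unfolding case_prod_beta by (rule continuous_on_compose2[OF F cG'(1)]) (use GS in auto)
  have "continuous_on (UNIV \<times> {a..b}) (\<lambda>p. F' (G (fst p) (snd p)))"
    by (rule continuous_on_compose2[OF cF cG'(1)]) (use GS in auto)
  then show 2: "continuous_on (UNIV \<times> {a..b}) (\<lambda>(h, x). blinfun_apply (F' (G h x)) (Gh h x))"
    unfolding case_prod_beta by (intro continuous_intros cG'(2))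
  fix h0 x assume x: "x \<in> {a..b}"
  have sub: "UNIV \<times> {a..x} \<subseteq> UNIV \<times> {a..b}" using x by auto
  have "((\<lambda>h. integral (cbox a x) (\<lambda>t. F (G h t))) has_vector_derivative
      integral (cbox a x) (\<lambda>t. blinfun_apply (F' (G h0 t)) (Gh h0 t))) (at h0 within UNIV)"
  proof (rule leibniz_rule_vector_derivative)
    fix h t assume "t \<in> cbox a x"
    then have t: "t \<in> {a..b}" using x by (auto simp: cbox_interval)
    \<comment> \<open>\<open>F\<close> is differentiable only within \<open>S\<close>. For fixed
      \<open>t\<close> the curve in \<open>h\<close> stays inside \<open>S\<close>, so the chain
      rule is applied within its range.\<close>
    have "(F has_derivative blinfun_apply (F' (G h t))) (at (G h t) within range (\<lambda>h. G h t))"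
      by (rule has_derivative_subset[OF dF[OF GS[OF t]]]) (use GS[OF t] in auto)
    from vector_derivative_diff_chain_within[OF dG[OF t, of h] this]
    show "((\<lambda>h. F (G h t)) has_vector_derivative blinfun_apply (F' (G h t)) (Gh h t)) (at h within UNIV)"
      by (simp add: o_def)
  next
    fix h
    have "continuous_on {a..x} (\<lambda>t. case (h, t) of (h, x) \<Rightarrow> F (G h x))"
      by (rule continuous_on_compose2[OF 1]) (use x in \<open>auto intro!: continuous_intros\<close>)
    then show "(\<lambda>t. F (G h t)) integrable_on cbox a x"
      by (simp add: integrable_continuous_real cbox_interval)
  next
    show "continuous_on (UNIV \<times> cbox a x) (\<lambda>(h, t). blinfun_apply (F' (G h t)) (Gh h t))"
      using continuous_on_subset[OF 2 sub] by (simp add: cbox_interval)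
  qed auto
  then show "((\<lambda>h. integral {a..x} (\<lambda>t. F (G h t))) has_vector_derivative
      integral {a..x} (\<lambda>t. blinfun_apply (F' (G h0 t)) (Gh h0 t))) (at h0)"
    by (simp add: cbox_interval)
qed

text \<open>\<open>partial\<close> is a two-sided derivative, while at the end points of
  \<open>A\<close> the function is differentiable only from within. A direction with first component
  0 never leaves \<open>A \<times> UNIV\<close>, so the two notions agree.\<close>

lemma partial_eq_derivative:
  fixes F :: "real \<times> 'c::real_normed_vector \<Rightarrow> real"
  assumes F: "(F has_derivative blinfun_apply D) (at p within A \<times> UNIV)" and p: "fst p \<in> A" and e: "fst e = 0"
  shows "partial F e p = blinfun_apply D e"
proof -
  have d: "((\<lambda>s. p + s *\<^sub>R e) has_vector_derivative e) (at 0)"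
    by (auto intro!: derivative_eq_intros)
  have "range (\<lambda>s. p + s *\<^sub>R e) \<subseteq> A \<times> UNIV"
    using p e by (intro image_subsetI) (simp add: mem_Times_iff)
  then have "(F has_derivative blinfun_apply D) (at (p + 0 *\<^sub>R e) within range (\<lambda>s. p + s *\<^sub>R e))"
    using has_derivative_subset[OF F] by simp
  from vector_derivative_diff_chain_within[OF d this]
  have "((\<lambda>s. F (p + s *\<^sub>R e)) has_vector_derivative blinfun_apply D e) (at 0)"
    by (simp add: o_def)
  then have "((\<lambda>s. F (p + s *\<^sub>R e)) has_field_derivative blinfun_apply D e) (at 0)"
    by (simp add: has_real_derivative_iff_has_vector_derivative)
  then show ?thesis unfolding partial_def by (rule DERIV_imp_deriv)
qed

lemma linear_vec_expansion:
  fixes f :: "real ^ 'n \<Rightarrow> real"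
  assumes "linear f"
  shows "f v = (\<Sum>i\<in>UNIV. v $ i * f (axis i 1))"
proof -
  have "v = (\<Sum>i\<in>UNIV. v $ i *\<^sub>R axis i 1)"
    using basis_expansion[of v] by (simp add: scalar_mult_eq_scaleR)
  then have "f v = f (\<Sum>i\<in>UNIV. v $ i *\<^sub>R axis i 1)" by simp
  also have "\<dots> = (\<Sum>i\<in>UNIV. v $ i * f (axis i 1))"
    using assms by (simp add: linear_sum linear_scale)
  finally show ?thesis .
qed

lemma curly_derivative_expansion:
  fixes D :: "(real \<times> real \<times> (real ^ 'n) \<times> real) \<Rightarrow>\<^sub>L real"
  shows "blinfun_apply D (0, u, v, w) = u * blinfun_apply D (0, 1, 0, 0)
    + (\<Sum>i\<in>UNIV. v $ i * blinfun_apply D (0, 0, axis i 1, 0)) + w * blinfun_apply D (0, 0, 0, 1)"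
proof -
  have lin: "linear (\<lambda>v. blinfun_apply D (0, 0, v, 0))"
  proof (intro linearI)
    fix r :: real and v w :: "real ^ 'n"
    show "blinfun_apply D (0, 0, v + w, 0) = blinfun_apply D (0, 0, v, 0) + blinfun_apply D (0, 0, w, 0)"
      by (simp add: blinfun.add_right[symmetric])
    show "blinfun_apply D (0, 0, r *\<^sub>R v, 0) = r *\<^sub>R blinfun_apply D (0, 0, v, 0)"
      using blinfun.scaleR_right[of D r "(0, 0, v, 0)"] by simp
  qed
  have "(0, u, v, w) = u *\<^sub>R (0, 1, 0, 0) + (0, 0, v, 0) + w *\<^sub>R ((0, 0, 0, 1) :: real \<times> real \<times> (real ^ 'n) \<times> real)"
    by simp
  then have "blinfun_apply D (0, u, v, w) = u * blinfun_apply D (0, 1, 0, 0) + blinfun_apply D (0, 0, v, 0) + w * blinfun_apply D (0, 0, 0, 1)"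
    by (simp only: blinfun.add_right blinfun.scaleR_right real_scaleR_def)
  then show ?thesis using linear_vec_expansion[OF lin, of v] by simp
qed

lemma bracket_derivative_expansion:
  fixes D :: "(real \<times> real \<times> (real ^ 'n) \<times> real \<times> real) \<Rightarrow>\<^sub>L real"
  shows "blinfun_apply D (0, u, v, w, z) = u * blinfun_apply D (0, 1, 0, 0, 0)
    + (\<Sum>i\<in>UNIV. v $ i * blinfun_apply D (0, 0, axis i 1, 0, 0)) + w * blinfun_apply D (0, 0, 0, 1, 0)
    + z * blinfun_apply D (0, 0, 0, 0, 1)"
proof -
  have lin: "linear (\<lambda>v. blinfun_apply D (0, 0, v, 0, 0))"
  proof (intro linearI)
    fix r :: real and v w :: "real ^ 'n"
    show "blinfun_apply D (0, 0, v + w, 0, 0) = blinfun_apply D (0, 0, v, 0, 0) + blinfun_apply D (0, 0, w, 0, 0)"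
      by (simp add: blinfun.add_right[symmetric])
    show "blinfun_apply D (0, 0, r *\<^sub>R v, 0, 0) = r *\<^sub>R blinfun_apply D (0, 0, v, 0, 0)"
      using blinfun.scaleR_right[of D r "(0, 0, v, 0, 0)"] by simp
  qed
  have "(0, u, v, w, z) = u *\<^sub>R (0, 1, 0, 0, 0) + (0, 0, v, 0, 0) + w *\<^sub>R (0, 0, 0, 1, 0)
      + z *\<^sub>R ((0, 0, 0, 0, 1) :: real \<times> real \<times> (real ^ 'n) \<times> real \<times> real)"
    by simp
  then have "blinfun_apply D (0, u, v, w, z) = u * blinfun_apply D (0, 1, 0, 0, 0) + blinfun_apply D (0, 0, v, 0, 0)
      + w * blinfun_apply D (0, 0, 0, 1, 0) + z * blinfun_apply D (0, 0, 0, 0, 1)"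
    by (simp only: blinfun.add_right blinfun.scaleR_right real_scaleR_def)
  then show ?thesis using linear_vec_expansion[OF lin, of v] by simp
qed

text \<open>Fractional operators do not appear: the curves are affine in \<open>h\<close> with
  arbitrary continuous base and direction, which leaves pure C^1 calculus. The continuity of the
  partial derivatives along the base curve is recorded because later integrations by parts rely on
  it.\<close>

lemma first_variation:
  fixes L :: "real \<times> real \<times> (real ^ 'n) \<times> real \<times> real \<Rightarrow> real"
    and l :: "real \<times> real \<times> (real ^ 'n) \<times> real \<Rightarrow> real"
    and a b :: real and cy ey cw ew :: "real \<Rightarrow> real" and cv ev :: "real \<Rightarrow> real ^ 'n"
  assumes c_def: "\<And>h x. c h x = (x, cy x + h * ey x, cv x + h *\<^sub>R ev x, cw x + h * ew x)"
    and z_def: "\<And>h x. z h x = integral {a..x} (\<lambda>t. l (c h t))"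
    and B_def: "\<And>h x. B h x = (x, cy x + h * ey x, cv x + h *\<^sub>R ev x, cw x + h * ew x, z h x)"
    and Z_def: "\<And>x. Z x = integral {x..b} (\<lambda>t. partial L (0, 0, 0, 0, 1) (B 0 t))"
    and ab: "a < b" and L: "C1_on ({a..b} \<times> UNIV) L" and l: "C1_on ({a..b} \<times> UNIV) l"
    and cont: "continuous_on {a..b} cy" "continuous_on {a..b} ey" "continuous_on {a..b} cv"
      "continuous_on {a..b} ev" "continuous_on {a..b} cw" "continuous_on {a..b} ew"
    and min: "\<And>h. integral {a..b} (\<lambda>x. L (B 0 x)) \<le> integral {a..b} (\<lambda>x. L (B h x))"
  shows "integral {a..b} (\<lambda>x.
      (partial L (0, 1, 0, 0, 0) (B 0 x) + Z x * partial l (0, 1, 0, 0) (c 0 x)) * ey x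
      + (\<Sum>i\<in>UNIV. (partial L (0, 0, axis i 1, 0, 0) (B 0 x) + Z x * partial l (0, 0, axis i 1, 0) (c 0 x)) * ev x $ i)
      + (partial L (0, 0, 0, 1, 0) (B 0 x) + Z x * partial l (0, 0, 0, 1) (c 0 x)) * ew x) = 0"
    and "\<And>e. fst e = 0 \<Longrightarrow> continuous_on {a..b} (\<lambda>x. partial L e (B 0 x))"
    and "\<And>e. fst e = 0 \<Longrightarrow> continuous_on {a..b} (\<lambda>x. partial l e (c 0 x))"
proof -
  obtain L' where L': "\<And>p. p \<in> {a..b} \<times> UNIV \<Longrightarrow> (L has_derivative blinfun_apply (L' p)) (at p within {a..b} \<times> UNIV)"
    "continuous_on ({a..b} \<times> UNIV) L'"
    using L unfolding C1_on_def by blast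
  obtain l' where l': "\<And>p. p \<in> {a..b} \<times> UNIV \<Longrightarrow> (l has_derivative blinfun_apply (l' p)) (at p within {a..b} \<times> UNIV)"
    "continuous_on ({a..b} \<times> UNIV) l'"
    using l unfolding C1_on_def by blast
  note cont' = cont[THEN continuous_on_compose2[where f = snd and s = "UNIV \<times> {a..b}"]]
  have cc: "continuous_on (UNIV \<times> {a..b}) (\<lambda>(h, x). c h x)"
    unfolding c_def case_prod_beta by (intro continuous_intros cont') auto
  have ce: "continuous_on (UNIV \<times> {a..b}) (\<lambda>(h, x). (0, ey x, ev x, ew x))"
    unfolding case_prod_beta by (intro continuous_intros cont') auto
  have cd: "((\<lambda>h. c h x) has_vector_derivative (0, ey x, ev x, ew x)) (at h)" for h x
    unfolding c_def by (auto intro!: derivative_eq_intros has_vector_derivative_Pair)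
  have cS: "c h x \<in> {a..b} \<times> UNIV" if "x \<in> {a..b}" for h x using that by (simp add: c_def)
  note lz = C1_curve_integral[OF l' cS cc ce cd]
  \<comment> \<open>The \<open>h\<close>-derivative of the inner integral \<open>z\<close>; it
    becomes the last component of the direction in which \<open>L\<close> is differentiated.\<close>
  define \<zeta> where "\<zeta> h x = integral {a..x} (\<lambda>t. blinfun_apply (l' (c h t)) (0, ey t, ev t, ew t))" for h x
  have zc: "continuous_on (UNIV \<times> {a..b}) (\<lambda>(h, x). z h x)"
    unfolding z_def by (rule continuous_on_parametric_primitive, rule lz(1))
  have \<zeta>c: "continuous_on (UNIV \<times> {a..b}) (\<lambda>(h, x). \<zeta> h x)"
    unfolding \<zeta>_def by (rule continuous_on_parametric_primitive, rule lz(2))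
  have zd: "((\<lambda>h. z h x) has_vector_derivative \<zeta> h x) (at h)" if "x \<in> {a..b}" for h x
    unfolding z_def \<zeta>_def by (rule lz(3)) (use that in auto)
  have Bc: "continuous_on (UNIV \<times> {a..b}) (\<lambda>(h, x). B h x)"
    using zc unfolding B_def case_prod_beta by (intro continuous_intros cont') auto
  have Be: "continuous_on (UNIV \<times> {a..b}) (\<lambda>(h, x). (0, ey x, ev x, ew x, \<zeta> h x))"
    using \<zeta>c unfolding case_prod_beta by (intro continuous_intros cont') auto
  have Bd: "((\<lambda>h. B h x) has_vector_derivative (0, ey x, ev x, ew x, \<zeta> h x)) (at h)" if "x \<in> {a..b}" for h x
    unfolding B_def by (auto intro!: derivative_eq_intros has_vector_derivative_Pair zd that)
  have BS: "B h x \<in> {a..b} \<times> UNIV" if "x \<in> {a..b}" for h x using that by (simp add: B_def)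
  note LJ = C1_curve_integral[OF L' BS Bc Be Bd]
  have slice: "continuous_on {a..b} (f h)" if "continuous_on (UNIV \<times> {a..b}) (\<lambda>(h, x). f h x)"
    for f :: "real \<Rightarrow> real \<Rightarrow> 'z::topological_space" and h
  proof -
    have "continuous_on {a..b} (\<lambda>t. case (h, t) of (h, t) \<Rightarrow> f h t)"
      by (rule continuous_on_compose2[OF that]) (auto intro!: continuous_intros)
    then show ?thesis by simp
  qed
  have B0: "continuous_on {a..b} (B 0)" and c0: "continuous_on {a..b} (c 0)" 
    using slice[OF Bc] slice[OF cc] by auto
  have pL: "partial L e (B 0 x) = blinfun_apply (L' (B 0 x)) e" if "x \<in> {a..b}" "fst e = 0" for x e
    by (rule partial_eq_derivative[OF L'(1)[OF BS[OF that(1)]]]) (use that in \<open>auto simp: B_def\<close>)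
  have pl: "partial l e (c 0 x) = blinfun_apply (l' (c 0 x)) e" if "x \<in> {a..b}" "fst e = 0" for x e
    by (rule partial_eq_derivative[OF l'(1)[OF cS[OF that(1)]]]) (use that in \<open>auto simp: c_def\<close>)
  have L'B: "continuous_on {a..b} (\<lambda>x. L' (B 0 x))"
    by (rule continuous_on_compose2[OF L'(2) B0]) (use BS in blast)
  have l'c: "continuous_on {a..b} (\<lambda>x. l' (c 0 x))"
    by (rule continuous_on_compose2[OF l'(2) c0]) (use cS in blast)
  show contL: "continuous_on {a..b} (\<lambda>x. partial L e (B 0 x))" if "fst e = 0" for e
  proof (rule continuous_on_eq)
    show "continuous_on {a..b} (\<lambda>x. blinfun_apply (L' (B 0 x)) e)" by (intro continuous_intros L'B)
  qed (use pL that in auto)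
  show contl: "continuous_on {a..b} (\<lambda>x. partial l e (c 0 x))" if "fst e = 0" for e
  proof (rule continuous_on_eq)
    show "continuous_on {a..b} (\<lambda>x. blinfun_apply (l' (c 0 x)) e)" by (intro continuous_intros l'c)
  qed (use pl that in auto)
  have "((\<lambda>h. integral {a..b} (\<lambda>t. L (B h t))) has_vector_derivative
      integral {a..b} (\<lambda>t. blinfun_apply (L' (B 0 t)) (0, ey t, ev t, ew t, \<zeta> 0 t))) (at 0)"
    using LJ(3)[of b 0] ab by simp
  then have "((\<lambda>h. integral {a..b} (\<lambda>t. L (B h t))) has_field_derivative
      integral {a..b} (\<lambda>t. blinfun_apply (L' (B 0 t)) (0, ey t, ev t, ew t, \<zeta> 0 t))) (at 0)"
    by (simp add: has_real_derivative_iff_has_vector_derivative)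
  \<comment> \<open>Minimality holds for every real \<open>h\<close>, so 0 is an interior minimum
    and any radius, here 1, will do.\<close>
  then have J0: "integral {a..b} (\<lambda>t. blinfun_apply (L' (B 0 t)) (0, ey t, ev t, ew t, \<zeta> 0 t)) = 0"
    by (rule DERIV_local_min[OF _ zero_less_one]) (use min in auto)
  define M where "M x = partial L (0, 1, 0, 0, 0) (B 0 x) * ey x
      + (\<Sum>i\<in>UNIV. partial L (0, 0, axis i 1, 0, 0) (B 0 x) * ev x $ i) + partial L (0, 0, 0, 1, 0) (B 0 x) * ew x" for x
  define m where "m x = partial l (0, 1, 0, 0) (c 0 x) * ey x
      + (\<Sum>i\<in>UNIV. partial l (0, 0, axis i 1, 0) (c 0 x) * ev x $ i) + partial l (0, 0, 0, 1) (c 0 x) * ew x" for x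
  have mc: "continuous_on {a..b} m" unfolding m_def by (intro continuous_intros contl cont) auto
  have Mc: "continuous_on {a..b} M" unfolding M_def by (intro continuous_intros contL cont) auto
  have \<zeta>m: "\<zeta> 0 x = integral {a..x} m" if "x \<in> {a..b}" for x
    unfolding \<zeta>_def
  proof (rule integral_cong)
    fix t assume "t \<in> {a..x}"
    then have "t \<in> {a..b}" using that by auto
    then show "blinfun_apply (l' (c 0 t)) (0, ey t, ev t, ew t) = m t"
      unfolding m_def by (subst curly_derivative_expansion) (simp add: pl mult.commute)
  qed
  define q where "q x = partial L (0, 0, 0, 0, 1) (B 0 x)" for x
  have qc: "continuous_on {a..b} q" unfolding q_def by (rule contL) simp
  have Zq: "Z = (\<lambda>x. integral {x..b} q)" by (simp add: Z_def q_def[abs_def] fun_eq_iff)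
  \<comment> \<open>Continuity of \<open>Z\<close> is the case of order 1 of the right fractional
    integral, again up to the value of \<open>0 powr 0\<close> at one point.\<close>
  have "continuous_on {a..b} (\<lambda>x. integral {x..b} (\<lambda>t. (t - x) powr (1 - 1) * q t))"
    by (rule continuous_on_frac_right[OF zero_less_one qc])
  moreover have "integral {x..b} (\<lambda>t. (t - x) powr (1 - 1) * q t) = Z x" for x
    unfolding Zq by (rule integral_spike[of "{x}"]) auto
  ultimately have Zc: "continuous_on {a..b} Z" by simp
  have prc: "continuous_on {a..b} (\<lambda>x. integral {a..x} m)"
    by (rule indefinite_integral_continuous_1[OF integrable_continuous_real[OF mc]])
  have "integral {a..b} (\<lambda>t. blinfun_apply (L' (B 0 t)) (0, ey t, ev t, ew t, \<zeta> 0 t)) =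
      integral {a..b} (\<lambda>x. M x + q x * integral {a..x} m)"
  proof (rule integral_cong)
    fix t assume t: "t \<in> {a..b}"
    then show "blinfun_apply (L' (B 0 t)) (0, ey t, ev t, ew t, \<zeta> 0 t) = M t + q t * integral {a..t} m"
      unfolding M_def q_def \<zeta>m[OF t] by (subst bracket_derivative_expansion) (simp add: pL mult.commute)
  qed
  also have "\<dots> = integral {a..b} M + integral {a..b} (\<lambda>x. q x * integral {a..x} m)"
    by (intro Henstock_Kurzweil_Integration.integral_add integrable_continuous_real continuous_intros Mc qc prc)
  \<comment> \<open>The variation of \<open>z\<close> at \<open>x\<close> depends on all earlier
    points; exchanging the integrals makes it local in \<open>m\<close>, with weight
    \<open>Z\<close>.\<close>
  also have "integral {a..b} (\<lambda>x. q x * integral {a..x} m) = integral {a..b} (\<lambda>x. Z x * m x)"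
    unfolding Zq by (rule integral_swap_primitive[OF qc mc])
  also have "integral {a..b} M + integral {a..b} (\<lambda>x. Z x * m x) = integral {a..b} (\<lambda>x. M x + Z x * m x)"
    by (intro Henstock_Kurzweil_Integration.integral_add[symmetric] integrable_continuous_real continuous_intros Mc Zc mc)
  also have "(\<lambda>x. M x + Z x * m x) = (\<lambda>x. 
      (partial L (0, 1, 0, 0, 0) (B 0 x) + Z x * partial l (0, 1, 0, 0) (c 0 x)) * ey x
      + (\<Sum>i\<in>UNIV. (partial L (0, 0, axis i 1, 0, 0) (B 0 x) + Z x * partial l (0, 0, axis i 1, 0) (c 0 x)) * ev x $ i)
      + (partial L (0, 0, 0, 1, 0) (B 0 x) + Z x * partial l (0, 0, 0, 1) (c 0 x)) * ew x)"
    by (simp add: M_def m_def fun_eq_iff distrib_left distrib_right sum.distrib sum_distrib_left mult.assoc)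
  finally show "integral {a..b} (\<lambda>x.
      (partial L (0, 1, 0, 0, 0) (B 0 x) + Z x * partial l (0, 1, 0, 0) (c 0 x)) * ey x
      + (\<Sum>i\<in>UNIV. (partial L (0, 0, axis i 1, 0, 0) (B 0 x) + Z x * partial l (0, 0, axis i 1, 0) (c 0 x)) * ev x $ i)
      + (partial L (0, 0, 0, 1, 0) (B 0 x) + Z x * partial l (0, 0, 0, 1) (c 0 x)) * ew x) = 0"
    unfolding J0 by (rule sym)
qed

subsection \<open>The Euler-Lagrange equation\<close>

lemma continuous_on_rl_integral_right:
  fixes f :: "real \<Rightarrow> real"
  assumes "0 < \<gamma>" "continuous_on {a..b} f"
  shows "continuous_on {a..b} (rl_integral_right b \<gamma> f)"
  unfolding rl_integral_right_def[abs_def]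
  by (intro continuous_intros continuous_on_frac_right assms)

lemma frac_right_add:
  fixes f g :: "real \<Rightarrow> real"
  assumes "0 < \<gamma>" "continuous_on {a..b} f" "continuous_on {a..b} g" "x \<in> {a..b}"
  shows "integral {x..b} (\<lambda>t. (t - x) powr (\<gamma> - 1) * (f t + g t)) =
    integral {x..b} (\<lambda>t. (t - x) powr (\<gamma> - 1) * f t) + integral {x..b} (\<lambda>t. (t - x) powr (\<gamma> - 1) * g t)"
  unfolding distrib_left
  using absolutely_integrable_frac_right[OF assms(1,2,4)] absolutely_integrable_frac_right[OF assms(1,3,4)]
  by (intro Henstock_Kurzweil_Integration.integral_add set_lebesgue_integral_eq_integral(1))

lemma rl_integral_right_add:
  fixes f g :: "real \<Rightarrow> real"
  assumes "0 < \<gamma>" "continuous_on {a..b} f" "continuous_on {a..b} g" "x \<in> {a..b}"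
  shows "rl_integral_right b \<gamma> (\<lambda>s. f s + g s) x = rl_integral_right b \<gamma> f x + rl_integral_right b \<gamma> g x"
  unfolding rl_integral_right_def frac_right_add[OF assms] by (rule distrib_left)

lemma fractional_integration_by_parts:
  fixes q g :: "real \<Rightarrow> real"
  assumes "0 < \<gamma>" "continuous_on {a..b} q" "continuous_on {a..b} g"
  shows "integral {a..b} (\<lambda>x. q x * rl_integral_left a \<gamma> g x) = integral {a..b} (\<lambda>x. rl_integral_right b \<gamma> q x * g x)"
proof -
  have "integral {a..b} (\<lambda>x. q x * rl_integral_left a \<gamma> g x) =
    1 / Gamma \<gamma> * integral {a..b} (\<lambda>x. q x * integral {a..x} (\<lambda>t. (x - t) powr (\<gamma> - 1) * g t))"
    unfolding rl_integral_left_def integral_mult_right[symmetric] by (intro integral_cong) simp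
  also have "\<dots> = 1 / Gamma \<gamma> * integral {a..b} (\<lambda>t. integral {t..b} (\<lambda>x. (x - t) powr (\<gamma> - 1) * q x) * g t)"
    by (simp only: frac_integral_swap[OF assms])
  also have "\<dots> = integral {a..b} (\<lambda>x. rl_integral_right b \<gamma> q x * g x)"
    unfolding rl_integral_right_def integral_mult_right[symmetric] by (intro integral_cong) simp
  finally show ?thesis .
qed

text \<open>The variation yields one fractional integral of a sum, the equation has two separate
  right derivatives. Splitting uses their separate existence, and the factor
  \<open>1 / Gamma\<close> has to pass through the iterated derivative.\<close>

lemma nth_deriv_rl_integral_right_add:
  fixes f g :: "real \<Rightarrow> real"
  assumes ab: "a < b" and x: "x \<in> {a..b}" and \<gamma>: "\<gamma> < real k"
    and f: "continuous_on {a..b} f" "rl_deriv_right_exists a b k \<gamma> f x"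
    and g: "continuous_on {a..b} g" "rl_deriv_right_exists a b k \<gamma> g x"
  shows "differentiable_times {a..b} k (rl_integral_right b (real k - \<gamma>) (\<lambda>s. f s + g s)) x"
    and "(-1) ^ k * nth_deriv {a..b} k (rl_integral_right b (real k - \<gamma>) (\<lambda>s. f s + g s)) x =
      rl_deriv_right a b k \<gamma> f x + rl_deriv_right a b k \<gamma> g x"
proof -
  define A where "A \<phi> s = integral {s..b} (\<lambda>t. (t - s) powr (real k - \<gamma> - 1) * \<phi> t)" for \<phi> :: "real \<Rightarrow> real" and s
  define c where "c = 1 / Gamma (real k - \<gamma>)"
  have pos: "0 < real k - \<gamma>" using \<gamma> by simp
  have "differentiable_times {a..b} k (A f) x" "differentiable_times {a..b} k (A g) x"
    using f(2) g(2) unfolding rl_deriv_right_exists_def A_def[abs_def] by blast+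
  from nth_deriv_linear[OF ab x this, of 1]
  have 1: "differentiable_times {a..b} k (\<lambda>s. A f s + 1 * A g s) x"
    "nth_deriv {a..b} k (\<lambda>s. A f s + 1 * A g s) x = nth_deriv {a..b} k (A f) x + nth_deriv {a..b} k (A g) x"
    by auto
  \<comment> \<open>The summand 0 brings a scalar multiple into the form that
    \<open>nth_deriv_linear\<close> handles.\<close>
  have 2: "differentiable_times {a..b} k (\<lambda>s. 0 + c * (A f s + 1 * A g s)) x"
    "nth_deriv {a..b} k (\<lambda>s. 0 + c * (A f s + 1 * A g s)) x = c * (nth_deriv {a..b} k (A f) x + nth_deriv {a..b} k (A g) x)"
    using nth_deriv_linear[OF ab x _ 1(1), of "\<lambda>s. 0" c] nth_deriv_const_0[OF ab x, of k] 1(2) by auto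
  have eq: "0 + c * (A f s + 1 * A g s) = rl_integral_right b (real k - \<gamma>) (\<lambda>s. f s + g s) s" if "s \<in> {a..b}" for s
    unfolding rl_integral_right_def frac_right_add[OF pos f(1) g(1) that] by (simp add: A_def c_def)
  show "differentiable_times {a..b} k (rl_integral_right b (real k - \<gamma>) (\<lambda>s. f s + g s)) x"
    by (rule differentiable_times_cong[OF eq x 2(1)])
  have "nth_deriv {a..b} k (rl_integral_right b (real k - \<gamma>) (\<lambda>s. f s + g s)) x =
      nth_deriv {a..b} k (\<lambda>s. 0 + c * (A f s + 1 * A g s)) x"
    by (rule nth_deriv_cong[OF eq[symmetric] x])
  then show "(-1) ^ k * nth_deriv {a..b} k (rl_integral_right b (real k - \<gamma>) (\<lambda>s. f s + g s)) x =
      rl_deriv_right a b k \<gamma> f x + rl_deriv_right a b k \<gamma> g x"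
    unfolding 2(2) by (simp add: rl_deriv_right_def A_def[abs_def] c_def add_divide_distrib distrib_left)
qed

theorem theorem19:
  fixes a b \<beta> :: real and n :: nat and idx :: "'n::finite \<Rightarrow> nat"
    and \<alpha> ya yb :: "nat \<Rightarrow> real" and y :: "real \<Rightarrow> real"
    and L :: "real \<times> real \<times> (real ^ 'n) \<times> real \<times> real \<Rightarrow> real"
    and l :: "real \<times> real \<times> (real ^ 'n) \<times> real \<Rightarrow> real"
  defines "B \<equiv> bracket l a b idx \<alpha> \<beta> y"
    and "C \<equiv> curly a b idx \<alpha> \<beta> y"
  defines "Lv \<equiv> \<lambda>i x. partial L (0, 0, axis i 1, 0, 0) (B x)"
    and "lv \<equiv> \<lambda>i x. partial l (0, 0, axis i 1, 0) (C x)"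
    and "Z \<equiv> \<lambda>x. integral {x..b} (\<lambda>t. partial L (0, 0, 0, 0, 1) (B t))"
  assumes "a < b" and "\<beta> > 0"
    and "bij_betw idx UNIV {1..n}"
    and "\<And>k. k \<in> {1..n} \<Longrightarrow> real k - 1 < \<alpha> k \<and> \<alpha> k < real k"
    and "C1_on ({a..b} \<times> UNIV) L" and "C1_on ({a..b} \<times> UNIV) l"
    and "y \<in> admissible n a b \<alpha> \<beta> ya yb"
    and "\<And>u. u \<in> admissible n a b \<alpha> \<beta> ya yb \<Longrightarrow>
           J_functional L l a b idx \<alpha> \<beta> y \<le> J_functional L l a b idx \<alpha> \<beta> u"
  shows "\<forall>x\<in>{a..b}.
    (\<forall>i. rl_deriv_right_exists a b (idx i) (\<alpha> (idx i)) (Lv i) x \<and>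
         rl_deriv_right_exists a b (idx i) (\<alpha> (idx i)) (\<lambda>s. Z s * lv i s) x) \<longrightarrow>
    partial L (0, 1, 0, 0, 0) (B x)
    + (\<Sum>i\<in>UNIV. rl_deriv_right a b (idx i) (\<alpha> (idx i)) (Lv i) x)
    + rl_integral_right b \<beta> (\<lambda>s. partial L (0, 0, 0, 1, 0) (B s)) x
    + Z x * partial l (0, 1, 0, 0) (C x)
    + (\<Sum>i\<in>UNIV. rl_deriv_right a b (idx i) (\<alpha> (idx i)) (\<lambda>s. Z s * lv i s) x)
    + rl_integral_right b \<beta> (\<lambda>s. Z s * partial l (0, 0, 0, 1) (C s)) x = 0"
proof (intro ballI impI)
  note ab = \<open>a < b\<close> and \<beta> = \<open>\<beta> > 0\<close> and yadm = \<open>y \<in> admissible n a b \<alpha> \<beta> ya yb\<close>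
  fix x assume x: "x \<in> {a..b}"
    and ex: "\<forall>i. rl_deriv_right_exists a b (idx i) (\<alpha> (idx i)) (Lv i) x \<and>
         rl_deriv_right_exists a b (idx i) (\<alpha> (idx i)) (\<lambda>s. Z s * lv i s) x"
  have idx: "idx i \<in> {1..n}" for i using \<open>bij_betw idx UNIV {1..n}\<close> by (auto simp: bij_betw_def)
  \<comment> \<open>The index type is inhabited, and its image under \<open>idx\<close> lies in
    \<open>{1..n}\<close>.\<close>
  then have n: "0 < n" by fastforce
  have \<alpha>: "\<alpha> k < real k" if "k \<in> {1..n}" for k using assms(9) that by blast
  have pos: "0 < real (idx i) - \<alpha> (idx i)" for i using \<alpha>[OF idx, of i] by simp
  have yF: "y \<in> frac_class n a b \<alpha> \<beta>" using yadm by (simp add: admissible_def)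
  then have yAC: "y \<in> AC_space n a b" by (simp add: frac_class_def)
  have cy: "continuous_on {a..b} y"
    using yAC n unfolding AC_space_def by (auto dest: spec[where x = 0])
  have cv: "continuous_on {a..b} (caputo_vec a b idx \<alpha> y)"
    using yF idx unfolding caputo_vec_def[abs_def] frac_class_def by (intro continuous_on_vec_lambda) blast
  have cw: "continuous_on {a..b} (rl_integral_left a \<beta> y)" using yF by (simp add: frac_class_def)
  define Ly Lw ly lw where "Ly s = partial L (0, 1, 0, 0, 0) (B s)" and "Lw s = partial L (0, 0, 0, 1, 0) (B s)"
    and "ly s = partial l (0, 1, 0, 0) (C s)" and "lw s = partial l (0, 0, 0, 1) (C s)" for s

  have FV: "integral {a..b} (\<lambda>s. (Ly s + Z s * ly s) * poly \<eta> s
      + (\<Sum>i\<in>UNIV. (Lv i s + Z s * lv i s) * caputo_poly a (idx i) (\<alpha> (idx i)) \<eta> s)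
      + (Lw s + Z s * lw s) * rl_integral_left a \<beta> (poly \<eta>) s) = 0 \<and>
      (\<forall>e. fst e = 0 \<longrightarrow> continuous_on {a..b} (\<lambda>s. partial L e (B s))) \<and>
      (\<forall>e. fst e = 0 \<longrightarrow> continuous_on {a..b} (\<lambda>s. partial l e (C s)))"
    if \<eta>: "\<forall>j<n. poly ((pderiv ^^ j) \<eta>) a = 0 \<and> poly ((pderiv ^^ j) \<eta>) b = 0" for \<eta>
  proof -
    define ev :: "real \<Rightarrow> real ^ 'n" where "ev s = (\<chi> i. caputo_poly a (idx i) (\<alpha> (idx i)) \<eta> s)" for s
    let ?ew = "rl_integral_left a \<beta> (poly \<eta>)"
    \<comment> \<open>Affine in \<open>h\<close> by construction. On \<open>{a..b}\<close> these
      agree with \<open>curly\<close> and \<open>bracket\<close> of the varied function by the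
      formulas for admissible variations.\<close>
    define c where "c h s = (s, y s + h * poly \<eta> s, caputo_vec a b idx \<alpha> y s + h *\<^sub>R ev s, rl_integral_left a \<beta> y s + h * ?ew s)" for h s
    define z where "z h s = integral {a..s} (\<lambda>t. l (c h t))" for h s
    define Bh where "Bh h s = (s, y s + h * poly \<eta> s, caputo_vec a b idx \<alpha> y s + h *\<^sub>R ev s, rl_integral_left a \<beta> y s + h * ?ew s, z h s)" for h s
    let ?u = "\<lambda>h s. y s + h * poly \<eta> s"
    note adm = admissible_variation[OF ab n \<beta> \<alpha> yadm \<eta>]
    have cu: "curly a b idx \<alpha> \<beta> (?u h) s = c h s" if "s \<in> {a..b}" for h s
      using adm(2)[OF _ idx that, of _ h] adm(3)[OF _ that, of h]
      by (simp add: curly_def c_def caputo_vec_def ev_def vec_eq_iff)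
    have Bu: "bracket l a b idx \<alpha> \<beta> (?u h) s = Bh h s" if "s \<in> {a..b}" for h s
    proof -
      have "integral {a..s} (\<lambda>t. l (curly a b idx \<alpha> \<beta> (?u h) t)) = z h s"
        unfolding z_def using that by (intro integral_cong) (simp add: cu)
      then show ?thesis using cu[OF that, of h] by (simp add: bracket_def curly_def c_def Bh_def)
    qed
    have Ju: "J_functional L l a b idx \<alpha> \<beta> (?u h) = integral {a..b} (\<lambda>s. L (Bh h s))" for h
      unfolding J_functional_def by (intro integral_cong) (simp add: Bu)
    \<comment> \<open>At \<open>h = 0\<close> the equality holds on the whole line, so
      \<open>C\<close> and \<open>B\<close> can be substituted as functions.\<close>
    have c0: "c 0 = C" by (simp add: fun_eq_iff c_def C_def curly_def)
    have B0: "Bh 0 = B" by (simp add: fun_eq_iff Bh_def B_def bracket_def z_def c0 C_def)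
    have min: "integral {a..b} (\<lambda>s. L (Bh 0 s)) \<le> integral {a..b} (\<lambda>s. L (Bh h s))" for h
    proof -
      have "J_functional L l a b idx \<alpha> \<beta> y = integral {a..b} (\<lambda>s. L (Bh 0 s))"
        by (simp add: J_functional_def B0 B_def)
      moreover have "?u h \<in> admissible n a b \<alpha> \<beta> ya yb" by (rule adm(1))
      ultimately show ?thesis using assms(13) Ju by metis
    qed
    have Z: "Z s = integral {s..b} (\<lambda>t. partial L (0, 0, 0, 0, 1) (Bh 0 t))" for s
      by (simp add: Z_def B0)
    have ecv: "continuous_on {a..b} ev"
      unfolding ev_def[abs_def] caputo_poly_def
      by (intro continuous_on_vec_lambda continuous_on_rl_integral_left pos poly_continuous_on)
    have ecw: "continuous_on {a..b} ?ew"
      by (intro continuous_on_rl_integral_left \<beta> poly_continuous_on)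
    note fv = first_variation[OF c_def z_def Bh_def Z ab \<open>C1_on ({a..b} \<times> UNIV) L\<close> \<open>C1_on ({a..b} \<times> UNIV) l\<close>
        cy poly_continuous_on cv ecv cw ecw min]
    show ?thesis
      using fv unfolding B0 c0 by (simp add: Ly_def Lw_def ly_def lw_def Lv_def lv_def ev_def)
  qed
  \<comment> \<open>The continuity statements in \<open>FV\<close> do not depend on the variation;
    the zero polynomial is an admissible choice for extracting them.\<close>
  have "(pderiv ^^ j) (0 :: real poly) = 0" for j by (induction j) simp_all
  then have FV0: "\<forall>j<n. poly ((pderiv ^^ j) 0) a = 0 \<and> poly ((pderiv ^^ j) 0) b = 0" by simp
  have contL: "continuous_on {a..b} (\<lambda>s. partial L e (B s))" if "fst e = 0" for e
    using FV[OF FV0] that by blast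
  have contl: "continuous_on {a..b} (\<lambda>s. partial l e (C s))" if "fst e = 0" for e
    using FV[OF FV0] that by blast
  have cL: "continuous_on {a..b} Ly" "continuous_on {a..b} Lw" "continuous_on {a..b} (Lv i)" for i
    unfolding Ly_def Lw_def Lv_def by (intro contL; simp)+
  have cl: "continuous_on {a..b} ly" "continuous_on {a..b} lw" "continuous_on {a..b} (lv i)" for i
    unfolding ly_def lw_def lv_def by (intro contl; simp)+
  have "continuous_on {a..b} (\<lambda>s. integral {s..b} (\<lambda>t. (t - s) powr (1 - 1) * partial L (0, 0, 0, 0, 1) (B t)))"
    by (intro continuous_on_frac_right contL) auto
  moreover have "integral {s..b} (\<lambda>t. (t - s) powr (1 - 1) * partial L (0, 0, 0, 0, 1) (B t)) = Z s" for s
    unfolding Z_def by (rule integral_spike[of "{s}"]) auto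
  ultimately have cZ: "continuous_on {a..b} Z" by simp
  have cZl: "continuous_on {a..b} (\<lambda>s. Z s * ly s)" "continuous_on {a..b} (\<lambda>s. Z s * lw s)"
    "continuous_on {a..b} (\<lambda>s. Z s * lv i s)" for i
    by (intro continuous_on_mult cZ cl)+

  \<comment> \<open>\<open>W\<close> and \<open>q i\<close> are the full coefficients of the
    fractional integral and of the Caputo derivatives of \<eta>, with the contribution of
    \<open>z\<close> included. Integration by parts turns them into the right integrals in
    \<open>P\<close> and \<open>G i\<close>, which multiply \<eta> and its derivative of order
    \<open>idx i\<close>.\<close>
  define W where "W s = Lw s + Z s * lw s" for s
  define q where "q i s = Lv i s + Z s * lv i s" for i s
  define P where "P s = (Ly s + Z s * ly s) + rl_integral_right b \<beta> W s" for s
  define G where "G i = rl_integral_right b (real (idx i) - \<alpha> (idx i)) (q i)" for i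
  have cW: "continuous_on {a..b} W" unfolding W_def by (intro continuous_on_add cL cZl)
  have cq: "continuous_on {a..b} (q i)" for i unfolding q_def by (intro continuous_on_add cL cZl)
  have cP0: "continuous_on {a..b} (\<lambda>s. Ly s + Z s * ly s)" by (intro continuous_on_add cL cZl)
  have cRW: "continuous_on {a..b} (rl_integral_right b \<beta> W)" by (rule continuous_on_rl_integral_right[OF \<beta> cW])
  have cP: "continuous_on {a..b} P" unfolding P_def by (intro continuous_on_add cP0 cRW)
  have cG: "continuous_on {a..b} (G i)" for i unfolding G_def by (rule continuous_on_rl_integral_right[OF pos cq])

  have var: "integral {a..b} (\<lambda>s. P s * poly \<eta> s + (\<Sum>i\<in>UNIV. G i s * poly ((pderiv ^^ idx i) \<eta>) s)) = 0"
    if \<eta>: "\<forall>j<n. poly ((pderiv ^^ j) \<eta>) a = 0 \<and> poly ((pderiv ^^ j) \<eta>) b = 0" for \<eta>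
  proof -
    let ?p0 = "\<lambda>s. (Ly s + Z s * ly s) * poly \<eta> s"
    let ?e = "\<lambda>i. caputo_poly a (idx i) (\<alpha> (idx i)) \<eta>" and ?w = "rl_integral_left a \<beta> (poly \<eta>)"
    have int: "(\<lambda>s. f s * g s) integrable_on {a..b}" if "continuous_on {a..b} f" "continuous_on {a..b} g"
      for f g :: "real \<Rightarrow> real"
      using that by (rule continuous_mult_integrable_on)
    have ce: "continuous_on {a..b} (?e i)" for i
      unfolding caputo_poly_def by (intro continuous_on_rl_integral_left pos poly_continuous_on)
    have cw: "continuous_on {a..b} ?w" by (intro continuous_on_rl_integral_left \<beta> poly_continuous_on)
    have i0: "?p0 integrable_on {a..b}" by (rule int[OF cP0 poly_continuous_on])
    have i1: "(\<lambda>s. \<Sum>i\<in>UNIV. q i s * ?e i s) integrable_on {a..b}"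
      by (intro integrable_sum int cq ce) simp
    have i2: "(\<lambda>s. W s * ?w s) integrable_on {a..b}" by (rule int[OF cW cw])
    have j1: "(\<lambda>s. \<Sum>i\<in>UNIV. G i s * poly ((pderiv ^^ idx i) \<eta>) s) integrable_on {a..b}"
      by (intro integrable_sum int cG poly_continuous_on) simp
    have j2: "(\<lambda>s. rl_integral_right b \<beta> W s * poly \<eta> s) integrable_on {a..b}"
      by (rule int[OF cRW poly_continuous_on])
    have "0 = integral {a..b} (\<lambda>s. ?p0 s + (\<Sum>i\<in>UNIV. q i s * ?e i s) + W s * ?w s)"
      using FV[OF \<eta>] unfolding q_def W_def by simp
    also have "\<dots> = integral {a..b} ?p0 + integral {a..b} (\<lambda>s. \<Sum>i\<in>UNIV. q i s * ?e i s) + integral {a..b} (\<lambda>s. W s * ?w s)"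
      using i0 i1 i2 by (simp add: Henstock_Kurzweil_Integration.integral_add integrable_add)
    also have "integral {a..b} (\<lambda>s. \<Sum>i\<in>UNIV. q i s * ?e i s) = integral {a..b} (\<lambda>s. \<Sum>i\<in>UNIV. G i s * poly ((pderiv ^^ idx i) \<eta>) s)"
    proof -
      have "integral {a..b} (\<lambda>s. \<Sum>i\<in>UNIV. q i s * ?e i s) = (\<Sum>i\<in>UNIV. integral {a..b} (\<lambda>s. q i s * ?e i s))"
        by (intro integral_sum int cq ce) simp
      also have "\<dots> = (\<Sum>i\<in>UNIV. integral {a..b} (\<lambda>s. G i s * poly ((pderiv ^^ idx i) \<eta>) s))"
        unfolding G_def caputo_poly_def
        by (intro sum.cong refl fractional_integration_by_parts pos cq poly_continuous_on)
      also have "\<dots> = integral {a..b} (\<lambda>s. \<Sum>i\<in>UNIV. G i s * poly ((pderiv ^^ idx i) \<eta>) s)"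
        by (intro integral_sum[symmetric] int cG poly_continuous_on) simp
      finally show ?thesis .
    qed
    also have "integral {a..b} (\<lambda>s. W s * ?w s) = integral {a..b} (\<lambda>s. rl_integral_right b \<beta> W s * poly \<eta> s)"
      by (rule fractional_integration_by_parts[OF \<beta> cW poly_continuous_on])
    also have "integral {a..b} ?p0 + integral {a..b} (\<lambda>s. \<Sum>i\<in>UNIV. G i s * poly ((pderiv ^^ idx i) \<eta>) s)
        + integral {a..b} (\<lambda>s. rl_integral_right b \<beta> W s * poly \<eta> s) =
      integral {a..b} (\<lambda>s. ?p0 s + (\<Sum>i\<in>UNIV. G i s * poly ((pderiv ^^ idx i) \<eta>) s) + rl_integral_right b \<beta> W s * poly \<eta> s)"
      using i0 j1 j2 by (simp add: Henstock_Kurzweil_Integration.integral_add integrable_add)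
    also have "\<dots> = integral {a..b} (\<lambda>s. P s * poly \<eta> s + (\<Sum>i\<in>UNIV. G i s * poly ((pderiv ^^ idx i) \<eta>) s))"
      by (intro integral_cong) (simp add: P_def distrib_right)
    finally show ?thesis by (rule sym)
  qed
  \<comment> \<open>Up to sign, the iterated derivative of \<open>G i\<close> is the sum of the two
    right derivatives attached to index \<open>i\<close>.\<close>
  have D: "differentiable_times {a..b} (idx i) (G i) x"
    "(-1) ^ idx i * nth_deriv {a..b} (idx i) (G i) x = rl_deriv_right a b (idx i) (\<alpha> (idx i)) (Lv i) x
      + rl_deriv_right a b (idx i) (\<alpha> (idx i)) (\<lambda>s. Z s * lv i s) x" for i
    using nth_deriv_rl_integral_right_add[OF ab x \<alpha>[OF idx[of i]] cL(3) _ cZl(3)] ex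
    unfolding G_def q_def by blast+
  have "P x + (\<Sum>i\<in>UNIV. (-1) ^ idx i * nth_deriv {a..b} (idx i) (G i) x) = 0"
    by (rule euler_lagrange_pointwise[OF ab cP _ _ cG var x D(1)]) (use idx in auto)
  moreover have "rl_integral_right b \<beta> W x = rl_integral_right b \<beta> Lw x + rl_integral_right b \<beta> (\<lambda>s. Z s * lw s) x"
    unfolding W_def by (rule rl_integral_right_add[OF \<beta> cL(2) cZl(2) x])
  ultimately show "partial L (0, 1, 0, 0, 0) (B x)
    + (\<Sum>i\<in>UNIV. rl_deriv_right a b (idx i) (\<alpha> (idx i)) (Lv i) x)
    + rl_integral_right b \<beta> (\<lambda>s. partial L (0, 0, 0, 1, 0) (B s)) x
    + Z x * partial l (0, 1, 0, 0) (C x)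
    + (\<Sum>i\<in>UNIV. rl_deriv_right a b (idx i) (\<alpha> (idx i)) (\<lambda>s. Z s * lv i s) x)
    + rl_integral_right b \<beta> (\<lambda>s. Z s * partial l (0, 0, 0, 1) (C s)) x = 0"
    unfolding D(2) P_def by (simp add: sum.distrib Ly_def Lw_def[abs_def] ly_def lw_def[abs_def])
qed

end
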